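(* Let $\Omega\subset\mathbb R^3$ be the meshed domain of the context. Then for all $(s^h,\hat s^h)\in\widetilde S(\Omega)\times\widetilde D(\partial\Omega)$, $$\widetilde{\mathrm{CURL}}\big(\widetilde{\mathrm{GRAD}}(s^h,\hat s^h)\big)=(0,0),$$ and for all $(\boldsymbol q^h,\hat{\boldsymbol q}^h)\in\widetilde D(\Omega)\times\widetilde C(\partial\Omega)$, $$\widetilde{\mathrm{DIV}}\big(\widetilde{\mathrm{CURL}}(\boldsymbol q^h,\hat{\boldsymbol q}^h)\big)=(0,0).$$
   Context: Fix $N\ge1$; let $-1=\xi_0<\dots<\xi_N=1$ be the Gauss–Lobatto–Legendre (GLL) nodes, i.e. the roots of $(1-\xi^2)L_N'(\xi)$, $L_N$ the Legendre polynomial of degree $N$. $\mathcal P$, $\mathcal Q$ are the polynomials on $[-1,1]$ of degree at most $N$, $N-1$. On $K=[-1,1]^3$: $G(K)=\mathcal P\otimes\mathcal P\otimes\mathcal P$; $C(K)=(\mathcal Q\otimes\mathcal P\otimes\mathcal P)\times(\mathcal P\otimes\mathcal Q\otimes\mathcal P)\times(\mathcal P\otimes\mathcal P\otimes\mathcal Q)$; $D(K)=(\mathcal P\otimes\mathcal Q\otimes\mathcal Q)\times(\mathcal Q\otimes\mathcal P\otimes\mathcal Q)\times(\mathcal Q\otimes\mathcal Q\otimes\mathcal P)$; $S(K)=\mathcal Q\otimes\mathcal Q\otimes\mathcal Q$. $\Omega\subset\mathbb R^3$ is a bounded Lipschitz domain partitioned into conforming non-overlapping elements $\Omega_m=\Phi_m(K)$,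 $\Phi_m$ diffeomorphisms with Jacobian matrix $\mathsf J$ ($\det\mathsf J>0$), such that the global map is continuous; the images of the GLL grid form a global mesh of nodes, small edges, small faces and small volumes. On each $\Omega_m$ functions are: $\bar f\circ\Phi_m^{-1}$, $\bar f\in G(K)$, globally continuous, for $G(\Omega)$; $(\mathsf J^{-\intercal}\bar{\boldsymbol v})\circ\Phi_m^{-1}$, $\bar{\boldsymbol v}\in C(K)$, with continuous tangential components, for $C(\Omega)$; $\big(\frac1{\det\mathsf J}\mathsf J\bar{\boldsymbol u}\big)\circ\Phi_m^{-1}$, $\bar{\boldsymbol u}\in D(K)$, with continuous normal component, for $D(\Omega)$; $\big(\frac1{\det\mathsf J}\bar g\big)\circ\Phi_m^{-1}$, $\bar g\in S(K)$, for $S(\Omega)$. Degrees of freedom (column vectors): $\mathcal N^0$ = nodal values on $G(\Omega)$; $\mathcal N^1$ = tangential line integrals along the oriented small edges on $C(\Omega)$; $\mathcal N^2$ = fluxes through the oriented small faces on $D(\Omega)$; $\mathcal N^3$ = integrals over the small volumes on $S(\Omega)$. $\Psi^0,\dots,\Psi^3$ are the row vectors of corresponding basis functions, so each function equals $\Psi^k\mathcal N^k(\cdot)$. Incidence matrices (entries $-1,0,1$) are defined by $\mathrm{grad}\,p^h=\Psi^1\mathbb E^{1,0}\mathcal N^0(p^h)$, $\mathrm{curl}\,\boldsymbol c^h=\Psi^2\mathbb E^{2,1}\mathcal N^1(\boldsymbol c^h)$, $\mathrm{div}\,\boldsymbol q^h=\Psi^3\mathbb E^{3,2}\mathcal N^2(\boldsymbol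 q^h)$. Mass matrices $\mathbb M^{(k)}=\int_\Omega(\Psi^k)^\intercal\Psi^k\,\mathrm d\Omega$; dual bases $\widetilde\Psi^{3-k}=\Psi^k(\mathbb M^{(k)})^{-1}$; dual degrees of freedom $\widetilde{\mathcal N}^{3-k}=\mathbb M^{(k)}\mathcal N^k$. $\widetilde G(\Omega),\widetilde C(\Omega),\widetilde D(\Omega),\widetilde S(\Omega)$ are $G(\Omega),C(\Omega),D(\Omega),S(\Omega)$ with elements expanded in the dual bases $\widetilde\Psi^3,\widetilde\Psi^2,\widetilde\Psi^1,\widetilde\Psi^0$. Inclusion matrices: for $k=0,1,2$, $\mathbb N_k$ has rows indexed by the $k$-dimensional mesh objects (nodes, small edges, small faces) and columns indexed by those contained in $\partial\Omega$; the column of a boundary object has a single non-zero entry, $\pm1$, in the row of that object (the sign compares the orientation of the boundary degree of freedom with the global one). Boundary spaces: $D(\partial\Omega)$, $C(\partial\Omega)$, $G(\partial\Omega)$ are the restrictions (traces) of $D(\Omega)$, $C(\Omega)$, $G(\Omega)$ to $\partial\Omega$, with bases $\Psi_b^k$ given by the traces of $\Psi^k\mathbb N_k$, $k=2,1,0$ respectively, and boundary mass matrices $\mathbb M_b^{(k)}=\int_{\partial\Omega}(\Psi_b^k)^\intercal\Psi_b^k\,\mathrm d\Gamma$; the dual boundary spaces $\widetilde D(\partial\Omega),\widetilde C(\partial\Omega),\widetilde G(\partial\Omega)$ consist of the expansions in the dual bases $\widetilde\Psi_b^{2-k}=\Psi_b^k(\mathbb M_b^{(k)})^{-1}$, with coefficient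 vectors $\widetilde{\mathcal B}^0,\widetilde{\mathcal B}^1,\widetilde{\mathcal B}^2$ respectively. Operators: $\widetilde{\mathrm{GRAD}}:\widetilde S(\Omega)\times\widetilde D(\partial\Omega)\to\widetilde D(\Omega)\times\widetilde C(\partial\Omega)$, $$\widetilde{\mathrm{GRAD}}(s^h,\hat s^h)=\Big(\widetilde\Psi^1\big(-(\mathbb E^{3,2})^\intercal\widetilde{\mathcal N}^0(s^h)+\mathbb N_2\widetilde{\mathcal B}^0(\hat s^h)\big),\;-\widetilde\Psi_b^1\,\mathbb N_1^\intercal(\mathbb E^{2,1})^\intercal\mathbb N_2\widetilde{\mathcal B}^0(\hat s^h)\Big);$$ $\widetilde{\mathrm{CURL}}:\widetilde D(\Omega)\times\widetilde C(\partial\Omega)\to\widetilde C(\Omega)\times\widetilde G(\partial\Omega)$, $$\widetilde{\mathrm{CURL}}(\boldsymbol q^h,\hat{\boldsymbol q}^h)=\Big(\widetilde\Psi^2\big((\mathbb E^{2,1})^\intercal\widetilde{\mathcal N}^1(\boldsymbol q^h)+\mathbb N_1\widetilde{\mathcal B}^1(\hat{\boldsymbol q}^h)\big),\;\widetilde\Psi_b^2\,\mathbb N_0^\intercal(\mathbb E^{1,0})^\intercal\mathbb N_1\widetilde{\mathcal B}^1(\hat{\boldsymbol q}^h)\Big);$$ $\widetilde{\mathrm{DIV}}:\widetilde C(\Omega)\times\widetilde G(\partial\Omega)\to\widetilde G(\Omega)\times 0$, $$\widetilde{\mathrm{DIV}}(\boldsymbol c^h,\hat c^h)=\Big(\widetilde\Psi^3\big(-(\mathbb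 E^{1,0})^\intercal\widetilde{\mathcal N}^2(\boldsymbol c^h)+\mathbb N_0\widetilde{\mathcal B}^2(\hat c^h)\big),\;0\Big).$$ *)

theory Defs
  imports "HOL-Analysis.Analysis" "HOL-Computational_Algebra.Polynomial"
begin

section \<open>Vector calculus on the physical space\<close>

definition partial :: "(real^3 \<Rightarrow> 'b::real_normed_vector) \<Rightarrow> real^3 \<Rightarrow> 3 \<Rightarrow> 'b" where
  "partial f x i = frechet_derivative f (at x) (axis i 1)"

definition gradient :: "(real^3 \<Rightarrow> real) \<Rightarrow> real^3 \<Rightarrow> real^3" where
  "gradient f x = (\<chi> i. partial f x i)"

definition curl :: "(real^3 \<Rightarrow> real^3) \<Rightarrow> real^3 \<Rightarrow> real^3" where
  "curl f x = vector [partial f x 2 $ 3 - partial f x 3 $ 2,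
                      partial f x 3 $ 1 - partial f x 1 $ 3,
                      partial f x 1 $ 2 - partial f x 2 $ 1]"

definition divergence :: "(real^3 \<Rightarrow> real^3) \<Rightarrow> real^3 \<Rightarrow> real" where
  "divergence f x = (\<Sum>i\<in>UNIV. partial f x i $ i)"

definition jac :: "(real^3 \<Rightarrow> real^3) \<Rightarrow> real^3 \<Rightarrow> real^3^3" where
  "jac f x = matrix (frechet_derivative f (at x))"

text \<open>Functions that are \<open>k\<close> times continuously differentiable on an open set.\<close>

primrec Ck :: "nat \<Rightarrow> (real^3) set \<Rightarrow> (real^3 \<Rightarrow> real^3) \<Rightarrow> bool" where
  "Ck 0 U f \<longleftrightarrow> continuous_on U f"
| "Ck (Suc k) U f \<longleftrightarrow>
     (\<forall>x\<in>U. f differentiable (at x)) \<and> (\<forall>i. Ck k U (\<lambda>x. partial f x i))"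


section \<open>Legendre polynomials and Gauss--Lobatto--Legendre nodes\<close>

text \<open>Rodrigues' formula.\<close>

definition legendre :: "nat \<Rightarrow> real poly" where
  "legendre n = smult (1 / (2 ^ n * fact n)) ((pderiv ^^ n) ([:-1, 0, 1:] ^ n))"

definition gll_nodes :: "nat \<Rightarrow> (nat \<Rightarrow> real) \<Rightarrow> bool" where
  "gll_nodes N \<xi> \<longleftrightarrow> strict_mono_on {..N} \<xi> \<and> \<xi> 0 = -1 \<and> \<xi> N = 1 \<and>
     \<xi> ` {..N} = {x. (1 - x\<^sup>2) * poly (pderiv (legendre N)) x = 0}"


section \<open>Reference element\<close>

definition refK :: "(real^3) set" where
  "refK = cbox (vec (-1)) (vec 1)"

text \<open>The tensor product of the univariate polynomials of degrees at most \<open>a\<close>, \<open>b\<close>, \<open>c\<close>.\<close>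

definition tensor :: "nat \<Rightarrow> nat \<Rightarrow> nat \<Rightarrow> (real^3 \<Rightarrow> real) set" where
  "tensor a b c = {f. \<exists>(n::nat) (p::nat \<Rightarrow> real poly) (q::nat \<Rightarrow> real poly) (r::nat \<Rightarrow> real poly).
     (\<forall>l<n. degree (p l) \<le> a \<and> degree (q l) \<le> b \<and> degree (r l) \<le> c) \<and>
     f = (\<lambda>x. \<Sum>l<n. poly (p l) (x$1) * poly (q l) (x$2) * poly (r l) (x$3))}"

definition refG :: "nat \<Rightarrow> (real^3 \<Rightarrow> real) set" where
  "refG N = tensor N N N"

definition refC :: "nat \<Rightarrow> (real^3 \<Rightarrow> real^3) set" where
  "refC N = {v. (\<lambda>x. v x $ 1) \<in> tensor (N-1) N N \<and>
                (\<lambda>x. v x $ 2) \<in> tensor N (N-1) N \<and>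
                (\<lambda>x. v x $ 3) \<in> tensor N N (N-1)}"

definition refD :: "nat \<Rightarrow> (real^3 \<Rightarrow> real^3) set" where
  "refD N = {u. (\<lambda>x. u x $ 1) \<in> tensor N (N-1) (N-1) \<and>
                (\<lambda>x. u x $ 2) \<in> tensor (N-1) N (N-1) \<and>
                (\<lambda>x. u x $ 3) \<in> tensor (N-1) (N-1) N}"

definition refS :: "nat \<Rightarrow> (real^3 \<Rightarrow> real) set" where
  "refS N = tensor (N-1) (N-1) (N-1)"


section \<open>Meshed domain\<close>

text \<open>Mesh objects (nodes, small edges, small faces, small volumes) are represented by the point
  sets they occupy, nodes by singletons; vectors and matrices indexed by mesh objects are functions
  on these sets. A function on \<open>\<Omega>\<close> that may jump across element interfaces is a family
  indexed by the elements, whose member for element \<open>m\<close> lives on the closed element and is \<open>0\<close>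
  outside it. A function on \<open>\<partial>\<Omega>\<close> is likewise a family indexed by the element faces on the boundary,
  where \<open>(m, n, s)\<close> stands for the image under the \<open>m\<close>-th map of the face of the cube
  on which the \<open>n\<close>-th coordinate is \<open>s\<close>.\<close>

type_synonym cell = "(real^3) set"
type_synonym ('m, 'b) bfun = "'m \<Rightarrow> real^3 \<Rightarrow> 'b"
type_synonym 'm bface = "'m \<times> 3 \<times> real"

record 'm mesh =
  pdeg :: nat
  gll :: "nat \<Rightarrow> real"
  Omega :: "(real^3) set"
  phi :: "'m \<Rightarrow> real^3 \<Rightarrow> real^3"
  orient :: "cell \<Rightarrow> real"  \<comment> \<open>global orientation relative to the one in \<open>owner\<close> below\<close>

definition elem :: "('m, 'z) mesh_scheme \<Rightarrow> 'm \<Rightarrow> (real^3) set" where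
  "elem M m = phi M m ` refK"

text \<open>Locally, in some orthonormal frame, \<open>\<Omega>\<close> is the set above the graph of a Lipschitz function.\<close>

definition lipschitz_domain :: "(real^3) set \<Rightarrow> bool" where
  "lipschitz_domain S \<longleftrightarrow> open S \<and> connected S \<and> S \<noteq> {} \<and>
     (\<forall>x\<in>frontier S. \<exists>(R :: real^3 \<Rightarrow> real^3) \<gamma> L r. orthogonal_transformation R \<and>
        L-lipschitz_on UNIV (\<gamma> :: real \<times> real \<Rightarrow> real) \<and> 0 < r \<and>
        (\<forall>z\<in>ball 0 r. x + R z \<in> S \<longleftrightarrow> \<gamma> (z$1, z$2) < z$3))"

text \<open>A diffeomorphism of the closed cube onto its image, i.e. the restriction of one between open
  sets; \<open>C\<^sup>2\<close> is what the classical curl and divergence of Piola-mapped fields require.\<close>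

definition element_map :: "(real^3 \<Rightarrow> real^3) \<Rightarrow> bool" where
  "element_map F \<longleftrightarrow>
     (\<exists>U g. open U \<and> refK \<subseteq> U \<and> open (F ` U) \<and> Ck 2 U F \<and> Ck 2 (F ` U) g \<and>
        (\<forall>\<xi>\<in>U. g (F \<xi>) = \<xi>)) \<and>
     (\<forall>\<xi>\<in>refK. 0 < det (jac F \<xi>))"

text \<open>Two elements meet in a common (possibly empty) face, edge or vertex, on which their
  parametrizations agree up to a symmetry of the cube; this is the continuity of the global map.\<close>

definition conforming :: "('m, 'z) mesh_scheme \<Rightarrow> bool" where
  "conforming M \<longleftrightarrow> (\<forall>m n. m \<noteq> n \<longrightarrow>
     (\<exists>F \<sigma>. F face_of refK \<and> orthogonal_transformation \<sigma> \<and> \<sigma> ` refK = refK \<and>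
        phi M m ` F = elem M m \<inter> elem M n \<and> (\<forall>\<xi>\<in>F. phi M m \<xi> = phi M n (\<sigma> \<xi>))))"

definition meshed_domain :: "('m::finite, 'z) mesh_scheme \<Rightarrow> bool" where
  "meshed_domain M \<longleftrightarrow>
     1 \<le> pdeg M \<and> gll_nodes (pdeg M) (gll M) \<and>
     bounded (Omega M) \<and> lipschitz_domain (Omega M) \<and>
     (\<forall>m. element_map (phi M m)) \<and>
     closure (Omega M) = (\<Union>m. elem M m) \<and>
     (\<forall>m n. m \<noteq> n \<longrightarrow> interior (elem M m) \<inter> interior (elem M n) = {}) \<and>
     conforming M \<and>
     (\<forall>X. orient M X \<in> {-1, 1})"

text \<open>In the reference grid an object of dimension \<open>card A\<close> is given by its lowest grid point \<open>I\<close>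
  and the set \<open>A\<close> of coordinate directions along which it extends by one grid interval.\<close>

definition ref_index :: "nat \<Rightarrow> (3 \<Rightarrow> nat) \<Rightarrow> 3 set \<Rightarrow> bool" where
  "ref_index N I A \<longleftrightarrow> (\<forall>d. if d \<in> A then I d < N else I d \<le> N)"

definition ref_cell :: "(nat \<Rightarrow> real) \<Rightarrow> (3 \<Rightarrow> nat) \<Rightarrow> 3 set \<Rightarrow> (real^3) set" where
  "ref_cell \<xi> I A = cbox (\<chi> d. \<xi> (I d)) (\<chi> d. if d \<in> A then \<xi> (Suc (I d)) else \<xi> (I d))"

definition cells :: "('m, 'z) mesh_scheme \<Rightarrow> nat \<Rightarrow> cell set" where
  "cells M k = {phi M m ` ref_cell (gll M) I A | m I A. ref_index (pdeg M) I A \<and> card A = k}"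

definition bcells :: "('m, 'z) mesh_scheme \<Rightarrow> nat \<Rightarrow> cell set" where
  "bcells M k = {X \<in> cells M k. X \<subseteq> frontier (Omega M)}"

text \<open>A reference parametrization of each mesh object. The degrees of freedom do not depend on this
  choice except for the sign, which is fixed by the arbitrary \<open>orient\<close>.\<close>

definition owner :: "('m, 'z) mesh_scheme \<Rightarrow> nat \<Rightarrow> cell \<Rightarrow> 'm \<times> (3 \<Rightarrow> nat) \<times> 3 set" where
  "owner M k X = (SOME (m, I, A). ref_index (pdeg M) I A \<and> card A = k \<and>
                                   X = phi M m ` ref_cell (gll M) I A)"


section \<open>Function spaces\<close>

definition broken :: "('m, 'z) mesh_scheme \<Rightarrow> ('m, 'b::zero) bfun \<Rightarrow> bool" where
  "broken M f \<longleftrightarrow> (\<forall>m x. x \<notin> elem M m \<longrightarrow> f m x = 0)"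

definition spaceG :: "('m, 'z) mesh_scheme \<Rightarrow> ('m, real) bfun set" where
  "spaceG M = {p. broken M p \<and>
     (\<forall>m. \<exists>q\<in>refG (pdeg M). \<forall>\<xi>\<in>refK. p m (phi M m \<xi>) = q \<xi>) \<and>
     (\<exists>P. continuous_on (closure (Omega M)) P \<and> (\<forall>m. \<forall>x\<in>elem M m. p m x = P x))}"

text \<open>By conformity \<open>{\<xi> \<in> refK. phi M m \<xi> \<in> elem M n}\<close> is the face (edge, vertex) along which the
  elements \<open>m\<close> and \<open>n\<close> meet, so that the images under the Jacobian of the differences \<open>\<eta> - \<xi>\<close> of
  its points span the tangent space of the interface at the image of \<open>\<xi>\<close>, and the cross products of
  two such vectors are its normal vectors (\<open>0\<close> unless the interface is two-dimensional).\<close>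

definition tangentially_continuous :: "('m, 'z) mesh_scheme \<Rightarrow> ('m, real^3) bfun \<Rightarrow> bool" where
  "tangentially_continuous M c \<longleftrightarrow> (\<forall>m n. \<forall>\<xi>\<in>refK. \<forall>\<eta>\<in>refK.
     phi M m \<xi> \<in> elem M n \<longrightarrow> phi M m \<eta> \<in> elem M n \<longrightarrow>
     c m (phi M m \<xi>) \<bullet> (jac (phi M m) \<xi> *v (\<eta> - \<xi>)) =
     c n (phi M m \<xi>) \<bullet> (jac (phi M m) \<xi> *v (\<eta> - \<xi>)))"

definition normally_continuous :: "('m, 'z) mesh_scheme \<Rightarrow> ('m, real^3) bfun \<Rightarrow> bool" where
  "normally_continuous M u \<longleftrightarrow> (\<forall>m n. \<forall>\<xi>\<in>refK. \<forall>\<eta>\<in>refK. \<forall>\<zeta>\<in>refK.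
     phi M m \<xi> \<in> elem M n \<longrightarrow> phi M m \<eta> \<in> elem M n \<longrightarrow> phi M m \<zeta> \<in> elem M n \<longrightarrow>
     u m (phi M m \<xi>) \<bullet>
       cross3 (jac (phi M m) \<xi> *v (\<eta> - \<xi>)) (jac (phi M m) \<xi> *v (\<zeta> - \<xi>)) =
     u n (phi M m \<xi>) \<bullet>
       cross3 (jac (phi M m) \<xi> *v (\<eta> - \<xi>)) (jac (phi M m) \<xi> *v (\<zeta> - \<xi>)))"

definition spaceC :: "('m, 'z) mesh_scheme \<Rightarrow> ('m, real^3) bfun set" where
  "spaceC M = {c. broken M c \<and>
     (\<forall>m. \<exists>v\<in>refC (pdeg M). \<forall>\<xi>\<in>refK.
        c m (phi M m \<xi>) = transpose (matrix_inv (jac (phi M m) \<xi>)) *v v \<xi>) \<and>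
     tangentially_continuous M c}"

definition spaceD :: "('m, 'z) mesh_scheme \<Rightarrow> ('m, real^3) bfun set" where
  "spaceD M = {q. broken M q \<and>
     (\<forall>m. \<exists>u\<in>refD (pdeg M). \<forall>\<xi>\<in>refK.
        q m (phi M m \<xi>) = (1 / det (jac (phi M m) \<xi>)) *\<^sub>R (jac (phi M m) \<xi> *v u \<xi>)) \<and>
     normally_continuous M q}"

definition spaceS :: "('m, 'z) mesh_scheme \<Rightarrow> ('m, real) bfun set" where
  "spaceS M = {s. broken M s \<and>
     (\<forall>m. \<exists>g\<in>refS (pdeg M). \<forall>\<xi>\<in>refK.
        s m (phi M m \<xi>) = (1 / det (jac (phi M m) \<xi>)) * g \<xi>)}"


section \<open>Degrees of freedom\<close>

definition dof0 :: "('m, 'z) mesh_scheme \<Rightarrow> ('m, real) bfun \<Rightarrow> cell \<Rightarrow> real" where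
  "dof0 M p X = (case owner M 0 X of (m, I, A) \<Rightarrow> p m (phi M m (\<chi> d. gll M (I d))))"

definition dof1 :: "('m, 'z) mesh_scheme \<Rightarrow> ('m, real^3) bfun \<Rightarrow> cell \<Rightarrow> real" where
  "dof1 M c X = (case owner M 1 X of (m, I, A) \<Rightarrow>
     let d = the_elem A; \<gamma> = (\<lambda>t. \<chi> j. if j = d then t else gll M (I j)) in
     orient M X * integral {gll M (I d) .. gll M (Suc (I d))}
       (\<lambda>t. c m (phi M m (\<gamma> t)) \<bullet> (jac (phi M m) (\<gamma> t) *v axis d 1)))"

text \<open>The point of the plane \<open>x$n = s\<close> whose other coordinates, in cyclic order, are \<open>y\<close>.
  Addition in the index type \<open>3\<close> is modulo \<open>3\<close>.\<close>

definition plane_point :: "3 \<Rightarrow> real \<Rightarrow> real \<times> real \<Rightarrow> real^3" where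
  "plane_point n s y = (\<chi> j. if j = n then s else if j = n + 1 then fst y else snd y)"

definition area_vector :: "('m, 'z) mesh_scheme \<Rightarrow> 'm \<Rightarrow> 3 \<Rightarrow> real^3 \<Rightarrow> real^3" where
  "area_vector M m n \<xi> =
     cross3 (jac (phi M m) \<xi> *v axis (n + 1) 1) (jac (phi M m) \<xi> *v axis (n + 2) 1)"

definition dof2 :: "('m, 'z) mesh_scheme \<Rightarrow> ('m, real^3) bfun \<Rightarrow> cell \<Rightarrow> real" where
  "dof2 M q X = (case owner M 2 X of (m, I, A) \<Rightarrow>
     let n = the_elem (- A) in
     orient M X * integral
       (cbox (gll M (I (n+1)), gll M (I (n+2))) (gll M (Suc (I (n+1))), gll M (Suc (I (n+2)))))
       (\<lambda>y. let \<xi> = plane_point n (gll M (I n)) y in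
            q m (phi M m \<xi>) \<bullet> area_vector M m n \<xi>))"

definition dof3 :: "('m, 'z) mesh_scheme \<Rightarrow> ('m, real) bfun \<Rightarrow> cell \<Rightarrow> real" where
  "dof3 M s X = (case owner M 3 X of (m, I, A) \<Rightarrow> integral X (s m))"


section \<open>Matrices and bases\<close>

text \<open>All index sets are finite sets of mesh objects.\<close>

definition mat_vec :: "cell set \<Rightarrow> (cell \<Rightarrow> cell \<Rightarrow> real) \<Rightarrow> (cell \<Rightarrow> real) \<Rightarrow> cell \<Rightarrow> real" where
  "mat_vec J A v = (\<lambda>X. \<Sum>Y\<in>J. A X Y * v Y)"

definition mat_transpose :: "(cell \<Rightarrow> cell \<Rightarrow> real) \<Rightarrow> cell \<Rightarrow> cell \<Rightarrow> real" where
  "mat_transpose A = (\<lambda>X Y. A Y X)"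

definition mat_inverse :: "cell set \<Rightarrow> (cell \<Rightarrow> cell \<Rightarrow> real) \<Rightarrow> cell \<Rightarrow> cell \<Rightarrow> real" where
  "mat_inverse J A = (THE B.
     (\<forall>X Y. X \<notin> J \<or> Y \<notin> J \<longrightarrow> B X Y = 0) \<and>
     (\<forall>X\<in>J. \<forall>Y\<in>J. (\<Sum>Z\<in>J. A X Z * B Z Y) = of_bool (X = Y)) \<and>
     (\<forall>X\<in>J. \<forall>Y\<in>J. (\<Sum>Z\<in>J. B X Z * A Z Y) = of_bool (X = Y)))"

text \<open>The function with coefficients \<open>a\<close>, i.e. a row vector of functions times a column vector.
  Here \<open>'i\<close> indexes the elements or the boundary element faces.\<close>

definition expand :: "cell set \<Rightarrow> (cell \<Rightarrow> 'i \<Rightarrow> real^3 \<Rightarrow> 'b::real_vector) \<Rightarrow> (cell \<Rightarrow> real)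
    \<Rightarrow> 'i \<Rightarrow> real^3 \<Rightarrow> 'b" where
  "expand J \<psi> a = (\<lambda>m x. \<Sum>X\<in>J. a X *\<^sub>R \<psi> X m x)"

definition dof_basis :: "cell set \<Rightarrow> ('m, 'b::real_vector) bfun set \<Rightarrow> (('m, 'b) bfun \<Rightarrow> cell \<Rightarrow> real)
    \<Rightarrow> (cell \<Rightarrow> ('m, 'b) bfun) \<Rightarrow> bool" where
  "dof_basis J V dof \<psi> \<longleftrightarrow>
     (\<forall>X\<in>J. \<psi> X \<in> V) \<and>
     (\<forall>X\<in>J. \<forall>Y\<in>J. dof (\<psi> X) Y = of_bool (X = Y)) \<and>
     (\<forall>f\<in>V. f = expand J \<psi> (dof f))"

definition mass :: "('m::finite, 'z) mesh_scheme \<Rightarrow> (cell \<Rightarrow> ('m, 'b::real_inner) bfun)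
    \<Rightarrow> cell \<Rightarrow> cell \<Rightarrow> real" where
  "mass M \<psi> X Y = (\<Sum>m\<in>UNIV. integral (elem M m) (\<lambda>x. \<psi> X m x \<bullet> \<psi> Y m x))"

text \<open>The row vector \<open>\<psi>\<close> times the inverse of the mass matrix \<open>A\<close>.\<close>

definition dual_basis :: "cell set \<Rightarrow> (cell \<Rightarrow> cell \<Rightarrow> real)
    \<Rightarrow> (cell \<Rightarrow> 'i \<Rightarrow> real^3 \<Rightarrow> 'b::real_vector) \<Rightarrow> cell \<Rightarrow> 'i \<Rightarrow> real^3 \<Rightarrow> 'b" where
  "dual_basis J A \<psi> = (\<lambda>Y. expand J \<psi> (\<lambda>X. mat_inverse J A X Y))"


section \<open>Boundary\<close>

definition cube_face :: "3 \<Rightarrow> real \<Rightarrow> (real^3) set" where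
  "cube_face n s = {\<xi> \<in> refK. \<xi> $ n = s}"

definition bfaces :: "('m, 'z) mesh_scheme \<Rightarrow> 'm bface set" where
  "bfaces M = {(m, n, s). s \<in> {-1, 1} \<and> phi M m ` cube_face n s \<subseteq> frontier (Omega M)}"

definition on_bface :: "('m, 'z) mesh_scheme \<Rightarrow> 'm bface \<Rightarrow> real^3 \<Rightarrow> bool" where
  "on_bface M F x \<longleftrightarrow> F \<in> bfaces M \<and> (case F of (m, n, s) \<Rightarrow> x \<in> phi M m ` cube_face n s)"

text \<open>Outward because the Jacobian determinant is positive.\<close>

definition unit_normal :: "('m, 'z) mesh_scheme \<Rightarrow> 'm bface \<Rightarrow> real^3 \<Rightarrow> real^3" where
  "unit_normal M F x = (case F of (m, n, s) \<Rightarrow>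
     s *\<^sub>R sgn (area_vector M m n (inv_into refK (phi M m) x)))"

text \<open>Traces: the value, the tangential component and the normal component.\<close>

definition trace0 :: "('m, 'z) mesh_scheme \<Rightarrow> ('m, real) bfun \<Rightarrow> 'm bface \<Rightarrow> real^3 \<Rightarrow> real" where
  "trace0 M p = (\<lambda>F x. if on_bface M F x then p (fst F) x else 0)"

definition trace1 :: "('m, 'z) mesh_scheme \<Rightarrow> ('m, real^3) bfun \<Rightarrow> 'm bface \<Rightarrow> real^3 \<Rightarrow> real^3" where
  "trace1 M c = (\<lambda>F x. if on_bface M F x
     then c (fst F) x - (c (fst F) x \<bullet> unit_normal M F x) *\<^sub>R unit_normal M F x else 0)"

definition trace2 :: "('m, 'z) mesh_scheme \<Rightarrow> ('m, real^3) bfun \<Rightarrow> 'm bface \<Rightarrow> real^3 \<Rightarrow> real" where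
  "trace2 M q = (\<lambda>F x. if on_bface M F x then q (fst F) x \<bullet> unit_normal M F x else 0)"

definition bmass :: "('m::finite, 'z) mesh_scheme \<Rightarrow> (cell \<Rightarrow> 'm bface \<Rightarrow> real^3 \<Rightarrow> 'b::real_inner)
    \<Rightarrow> cell \<Rightarrow> cell \<Rightarrow> real" where
  "bmass M \<psi> X Y = (\<Sum>(m, n, s)\<in>bfaces M. integral (cbox (-1, -1) (1, 1))
     (\<lambda>y. let \<xi> = plane_point n s y; x = phi M m \<xi> in
          (\<psi> X (m, n, s) x \<bullet> \<psi> Y (m, n, s) x) * norm (area_vector M m n \<xi>)))"


section \<open>The discrete de Rham complex and its dual\<close>

text \<open>\<open>bsign k X\<close> is the sign of the boundary degree of freedom of the boundary object \<open>X\<close> of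
  dimension \<open>k\<close> relative to the global one.\<close>

record 'm complex_data = "'m mesh" +
  psi0 :: "cell \<Rightarrow> ('m, real) bfun"
  psi1 :: "cell \<Rightarrow> ('m, real^3) bfun"
  psi2 :: "cell \<Rightarrow> ('m, real^3) bfun"
  psi3 :: "cell \<Rightarrow> ('m, real) bfun"
  E10 :: "cell \<Rightarrow> cell \<Rightarrow> real"
  E21 :: "cell \<Rightarrow> cell \<Rightarrow> real"
  E32 :: "cell \<Rightarrow> cell \<Rightarrow> real"
  bsign :: "nat \<Rightarrow> cell \<Rightarrow> real"

definition basis_functions :: "'m::finite complex_data \<Rightarrow> bool" where
  "basis_functions D \<longleftrightarrow>
     dof_basis (cells D 0) (spaceG D) (dof0 D) (psi0 D) \<and>
     dof_basis (cells D 1) (spaceC D) (dof1 D) (psi1 D) \<and>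
     dof_basis (cells D 2) (spaceD D) (dof2 D) (psi2 D) \<and>
     dof_basis (cells D 3) (spaceS D) (dof3 D) (psi3 D)"

text \<open>The differential operators act elementwise, in the interior of each element.\<close>

definition incidence_matrices :: "'m::finite complex_data \<Rightarrow> bool" where
  "incidence_matrices D \<longleftrightarrow>
     (\<forall>p\<in>spaceG D. \<forall>m. \<forall>x\<in>interior (elem D m).
        gradient (p m) x =
        expand (cells D 1) (psi1 D) (mat_vec (cells D 0) (E10 D) (dof0 D p)) m x) \<and>
     (\<forall>c\<in>spaceC D. \<forall>m. \<forall>x\<in>interior (elem D m).
        curl (c m) x =
        expand (cells D 2) (psi2 D) (mat_vec (cells D 1) (E21 D) (dof1 D c)) m x) \<and>
     (\<forall>q\<in>spaceD D. \<forall>m. \<forall>x\<in>interior (elem D m).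
        divergence (q m) x =
        expand (cells D 3) (psi3 D) (mat_vec (cells D 2) (E32 D) (dof2 D q)) m x)"

definition inclusion :: "'m complex_data \<Rightarrow> nat \<Rightarrow> cell \<Rightarrow> cell \<Rightarrow> real" where
  "inclusion D k X Y = (if X = Y then bsign D k Y else 0)"

text \<open>Tilded objects carry the complementary index: \<open>dpsi1\<close> is dual to \<open>psi2\<close>, etc.\<close>

definition dpsi1 :: "'m::finite complex_data \<Rightarrow> cell \<Rightarrow> ('m, real^3) bfun" where
  "dpsi1 D = dual_basis (cells D 2) (mass D (psi2 D)) (psi2 D)"

definition dpsi2 :: "'m::finite complex_data \<Rightarrow> cell \<Rightarrow> ('m, real^3) bfun" where
  "dpsi2 D = dual_basis (cells D 1) (mass D (psi1 D)) (psi1 D)"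

definition dpsi3 :: "'m::finite complex_data \<Rightarrow> cell \<Rightarrow> ('m, real) bfun" where
  "dpsi3 D = dual_basis (cells D 0) (mass D (psi0 D)) (psi0 D)"

definition ddof0 :: "'m::finite complex_data \<Rightarrow> ('m, real) bfun \<Rightarrow> cell \<Rightarrow> real" where
  "ddof0 D s = mat_vec (cells D 3) (mass D (psi3 D)) (dof3 D s)"

definition ddof1 :: "'m::finite complex_data \<Rightarrow> ('m, real^3) bfun \<Rightarrow> cell \<Rightarrow> real" where
  "ddof1 D q = mat_vec (cells D 2) (mass D (psi2 D)) (dof2 D q)"

definition ddof2 :: "'m::finite complex_data \<Rightarrow> ('m, real^3) bfun \<Rightarrow> cell \<Rightarrow> real" where
  "ddof2 D c = mat_vec (cells D 1) (mass D (psi1 D)) (dof1 D c)"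

definition bpsi0 :: "'m complex_data \<Rightarrow> cell \<Rightarrow> 'm bface \<Rightarrow> real^3 \<Rightarrow> real" where
  "bpsi0 D Y = trace0 D (expand (cells D 0) (psi0 D) (\<lambda>X. inclusion D 0 X Y))"

definition bpsi1 :: "'m complex_data \<Rightarrow> cell \<Rightarrow> 'm bface \<Rightarrow> real^3 \<Rightarrow> real^3" where
  "bpsi1 D Y = trace1 D (expand (cells D 1) (psi1 D) (\<lambda>X. inclusion D 1 X Y))"

definition bpsi2 :: "'m complex_data \<Rightarrow> cell \<Rightarrow> 'm bface \<Rightarrow> real^3 \<Rightarrow> real" where
  "bpsi2 D Y = trace2 D (expand (cells D 2) (psi2 D) (\<lambda>X. inclusion D 2 X Y))"

definition dbpsi0 :: "'m::finite complex_data \<Rightarrow> cell \<Rightarrow> 'm bface \<Rightarrow> real^3 \<Rightarrow> real" where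
  "dbpsi0 D = dual_basis (bcells D 2) (bmass D (bpsi2 D)) (bpsi2 D)"

definition dbpsi1 :: "'m::finite complex_data \<Rightarrow> cell \<Rightarrow> 'm bface \<Rightarrow> real^3 \<Rightarrow> real^3" where
  "dbpsi1 D = dual_basis (bcells D 1) (bmass D (bpsi1 D)) (bpsi1 D)"

definition dbpsi2 :: "'m::finite complex_data \<Rightarrow> cell \<Rightarrow> 'm bface \<Rightarrow> real^3 \<Rightarrow> real" where
  "dbpsi2 D = dual_basis (bcells D 0) (bmass D (bpsi0 D)) (bpsi0 D)"

text \<open>The dual spaces on \<open>\<Omega>\<close> have the same elements as the primal ones.\<close>

abbreviation (input) "dual_spaceS \<equiv> spaceS"
abbreviation (input) "dual_spaceD \<equiv> spaceD"

definition dual_bspaceD :: "'m::finite complex_data \<Rightarrow> ('m bface \<Rightarrow> real^3 \<Rightarrow> real) set" where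
  "dual_bspaceD D = range (expand (bcells D 2) (dbpsi0 D))"

definition dual_bspaceC :: "'m::finite complex_data \<Rightarrow> ('m bface \<Rightarrow> real^3 \<Rightarrow> real^3) set" where
  "dual_bspaceC D = range (expand (bcells D 1) (dbpsi1 D))"

definition coefficients :: "cell set \<Rightarrow> (cell \<Rightarrow> 'i \<Rightarrow> real^3 \<Rightarrow> 'b::real_vector)
    \<Rightarrow> ('i \<Rightarrow> real^3 \<Rightarrow> 'b) \<Rightarrow> cell \<Rightarrow> real" where
  "coefficients J \<psi> f = (THE b. (\<forall>X. X \<notin> J \<longrightarrow> b X = 0) \<and> f = expand J \<psi> b)"

definition bcoef0 :: "'m::finite complex_data \<Rightarrow> ('m bface \<Rightarrow> real^3 \<Rightarrow> real) \<Rightarrow> cell \<Rightarrow> real" where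
  "bcoef0 D = coefficients (bcells D 2) (dbpsi0 D)"

definition bcoef1 :: "'m::finite complex_data \<Rightarrow> ('m bface \<Rightarrow> real^3 \<Rightarrow> real^3) \<Rightarrow> cell \<Rightarrow> real" where
  "bcoef1 D = coefficients (bcells D 1) (dbpsi1 D)"

definition bcoef2 :: "'m::finite complex_data \<Rightarrow> ('m bface \<Rightarrow> real^3 \<Rightarrow> real) \<Rightarrow> cell \<Rightarrow> real" where
  "bcoef2 D = coefficients (bcells D 0) (dbpsi2 D)"

definition GRAD_dual :: "'m::finite complex_data \<Rightarrow>
    ('m, real) bfun \<times> ('m bface \<Rightarrow> real^3 \<Rightarrow> real) \<Rightarrow>
    ('m, real^3) bfun \<times> ('m bface \<Rightarrow> real^3 \<Rightarrow> real^3)" where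
  "GRAD_dual D = (\<lambda>(s, sb).
     let b = mat_vec (bcells D 2) (inclusion D 2) (bcoef0 D sb) in
     (expand (cells D 2) (dpsi1 D)
        (\<lambda>X. - mat_vec (cells D 3) (mat_transpose (E32 D)) (ddof0 D s) X + b X),
      expand (bcells D 1) (dbpsi1 D)
        (\<lambda>X. - mat_vec (cells D 1) (mat_transpose (inclusion D 1))
                 (mat_vec (cells D 2) (mat_transpose (E21 D)) b) X)))"

definition CURL_dual :: "'m::finite complex_data \<Rightarrow>
    ('m, real^3) bfun \<times> ('m bface \<Rightarrow> real^3 \<Rightarrow> real^3) \<Rightarrow>
    ('m, real^3) bfun \<times> ('m bface \<Rightarrow> real^3 \<Rightarrow> real)" where
  "CURL_dual D = (\<lambda>(q, qb).
     let b = mat_vec (bcells D 1) (inclusion D 1) (bcoef1 D qb) in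
     (expand (cells D 1) (dpsi2 D)
        (\<lambda>X. mat_vec (cells D 2) (mat_transpose (E21 D)) (ddof1 D q) X + b X),
      expand (bcells D 0) (dbpsi2 D)
        (mat_vec (cells D 0) (mat_transpose (inclusion D 0))
           (mat_vec (cells D 1) (mat_transpose (E10 D)) b))))"

definition DIV_dual :: "'m::finite complex_data \<Rightarrow>
    ('m, real^3) bfun \<times> ('m bface \<Rightarrow> real^3 \<Rightarrow> real) \<Rightarrow>
    ('m, real) bfun \<times> ('m bface \<Rightarrow> real^3 \<Rightarrow> real)" where
  "DIV_dual D = (\<lambda>(c, cb).
     let b = mat_vec (bcells D 0) (inclusion D 0) (bcoef2 D cb) in
     (expand (cells D 0) (dpsi3 D)
        (\<lambda>X. - mat_vec (cells D 1) (mat_transpose (E10 D)) (ddof2 D c) X + b X),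
      \<lambda>F x. 0))"

end

theory Submission
  imports Defs
begin

text \<open>Both compositions collapse once the incidence matrices are known to satisfy \<open>E32 E21 = 0\<close> and
  \<open>E21 E10 = 0\<close>, and once the entries of \<open>E21\<close> and \<open>E10\<close> that couple a boundary object with a
  non-boundary object of lower dimension vanish. The products vanish because
  \<open>div curl = 0\<close> and \<open>curl grad = 0\<close> hold for the polynomial pullbacks and the degrees of freedom
  separate the basis functions; the sparsity is Stokes' theorem on a small face and the fundamental
  theorem of calculus on a small edge.

  Recovering the coefficients of a dual expansion requires invertible mass matrices. For the boundary
  mass matrices this rests on the topological fact that the frontier of \<open>\<Omega>\<close> is covered by the element
  faces contained in it. Near a frontier point \<open>\<partial>\<Omega>\<close> is a Lipschitz graph and the element edges project
  to a null set, so frontier points off the edges are dense; such a point lies inside a single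
  element face, which belongs to no second element, since otherwise invariance of domain would make the
  point interior to the union of the two.\<close>

text \<open>Write b = N_2 B for the face data and e = E21^T b. The boundary component of GRAD
  carries -N_1^T e, which CURL sees as -N_1 N_1^T e. As the signs square to 1, N_1 N_1^T is the
  projection onto the boundary edges, so the cancellation against e requires e to be supported
  there; this is the purpose of the sparsity. The same happens one dimension lower with E10. Signs
  of incidence entries are never computed. An entry such as \<open>E21 D Y X\<close> is the flux
  through Y of the curl of the basis function of X, and vanishing is insensitive to orientation.
  This also tames the arbitrary choice in \<open>owner\<close>: an edge owned by one element may be
  met from another, and only the absolute value of its line integral has to be transferred. The
  covering of the frontier matters because \<open>bmass\<close> integrates over the element faces
  contained in it: a boundary node or edge met by no such face would not be detected by traces, and
  its coefficient could not be recovered.\<close>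

section \<open>Linear systems indexed by finite sets\<close>

text \<open>Gaussian elimination, by induction on the columns: a trivial kernel forces a non-zero
  entry in column \<open>Z\<close>, and its row \<open>W\<close> serves as pivot. Rows and columns
  have separate index sets because each step removes \<open>W\<close> from one and \<open>Z\<close>
  from the other.\<close>

lemma trivial_kernel_imp_solvable:
  fixes A :: "'a \<Rightarrow> 'b \<Rightarrow> real"
  assumes "finite J" "finite I" "card I = card J"
    and "\<And>a. (\<And>X. X \<in> I \<Longrightarrow> (\<Sum>Y\<in>J. A X Y * a Y) = 0) \<Longrightarrow> \<forall>Y\<in>J. a Y = 0"
  shows "\<exists>a. \<forall>X\<in>I. (\<Sum>Y\<in>J. A X Y * a Y) = b X"
  using assms
proof (induction J arbitrary: I A b rule: finite_induct)
  case empty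
  then show ?case by auto
next
  case (insert Z J)
  have "\<exists>W\<in>I. A W Z \<noteq> 0"
  proof (rule ccontr)
    assume "\<not> ?thesis"
    then have "(\<Sum>Y\<in>insert Z J. A X Y * of_bool (Y = Z)) = 0" if "X \<in> I" for X
      using that insert.hyps by (auto intro!: sum.neutral)
    from insert.prems(3)[OF this] show False by auto
  qed
  then obtain W where W: "W \<in> I" "A W Z \<noteq> 0" by blast
  \<comment> \<open>Schur complement of the pivot entry: the multiple of row \<open>W\<close> that
    clears column \<open>Z\<close> is subtracted from row \<open>X\<close>.\<close>
  define A' where "A' X Y = A X Y - A X Z * A W Y / A W Z" for X Y
  have reduce: "(\<Sum>Y\<in>J. A' X Y * a Y) =
      (\<Sum>Y\<in>J. A X Y * a Y) - A X Z / A W Z * (\<Sum>Y\<in>J. A W Y * a Y)" for X a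
  proof -
    have "(\<Sum>Y\<in>J. A' X Y * a Y) = (\<Sum>Y\<in>J. A X Y * a Y - A X Z / A W Z * (A W Y * a Y))"
      by (intro sum.cong) (auto simp: A'_def left_diff_distrib)
    then show ?thesis by (simp only: sum_subtractf sum_distrib_left)
  qed
  have "\<exists>a. \<forall>X\<in>I - {W}. (\<Sum>Y\<in>J. A' X Y * a Y) = b X - A X Z * b W / A W Z"
  proof (rule insert.IH)
    show "finite (I - {W})" "card (I - {W}) = card J"
      using insert W by auto
    fix a assume a: "\<And>X. X \<in> I - {W} \<Longrightarrow> (\<Sum>Y\<in>J. A' X Y * a Y) = 0"
    \<comment> \<open>The value at \<open>Z\<close> solves the pivot row, so a kernel vector of the
      reduced system becomes one of the full system.\<close>
    define a' where "a' = a(Z := - (\<Sum>Y\<in>J. A W Y * a Y) / A W Z)"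
    have a': "(\<Sum>Y\<in>J. A X Y * a' Y) = (\<Sum>Y\<in>J. A X Y * a Y)" for X
      using insert.hyps by (auto simp: a'_def intro!: sum.cong)
    have "(\<Sum>Y\<in>insert Z J. A X Y * a' Y) = 0" if "X \<in> I" for X
    proof (cases "X = W")
      case True
      then show ?thesis using insert.hyps W a'[of X] by (simp add: a'_def)
    next
      case False
      then have "(\<Sum>Y\<in>J. A X Y * a Y) = A X Z / A W Z * (\<Sum>Y\<in>J. A W Y * a Y)"
        using a[of X] reduce[of X a] that by simp
      then show ?thesis using insert.hyps W a'[of X] by (simp add: a'_def)
    qed
    then have "\<forall>Y\<in>insert Z J. a' Y = 0" by (rule insert.prems(3))
    then show "\<forall>Y\<in>J. a Y = 0"
      using insert.hyps by (auto simp: a'_def split: if_splits)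
  qed
  then obtain a where a: "\<And>X. X \<in> I - {W} \<Longrightarrow> (\<Sum>Y\<in>J. A' X Y * a Y) = b X - A X Z * b W / A W Z"
    by blast
  define a' where "a' = a(Z := (b W - (\<Sum>Y\<in>J. A W Y * a Y)) / A W Z)"
  have a': "(\<Sum>Y\<in>J. A X Y * a' Y) = (\<Sum>Y\<in>J. A X Y * a Y)" for X
    using insert.hyps by (auto simp: a'_def intro!: sum.cong)
  have "(\<Sum>Y\<in>insert Z J. A X Y * a' Y) = b X" if "X \<in> I" for X
  proof (cases "X = W")
    case True
    then show ?thesis using insert.hyps W a'[of X] by (simp add: a'_def)
  next
    case False
    have "(\<Sum>Y\<in>J. A X Y * a Y) = b X - A X Z * b W / A W Z + A X Z / A W Z * (\<Sum>Y\<in>J. A W Y * a Y)"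
      using a[of X] reduce[of X a] that False by simp
    moreover have "A X Z * a' Z = A X Z * b W / A W Z - A X Z / A W Z * (\<Sum>Y\<in>J. A W Y * a Y)"
      by (simp add: a'_def diff_divide_distrib right_diff_distrib)
    ultimately show ?thesis using insert.hyps a'[of X] by simp
  qed
  then show ?case by blast
qed

text \<open>\<open>mat_inverse\<close> is a definite description, so a two-sided inverse has to be
  exhibited and shown unique before its properties can be used. The columns of a right inverse come
  from solvability.\<close>

lemma mat_inverse_trivial_kernel:
  assumes J: "finite J"
    and ker: "\<And>a. (\<And>X. X \<in> J \<Longrightarrow> (\<Sum>Y\<in>J. A X Y * a Y) = 0) \<Longrightarrow> \<forall>Y\<in>J. a Y = 0"
  shows "\<forall>X\<in>J. \<forall>Y\<in>J. (\<Sum>Z\<in>J. A X Z * mat_inverse J A Z Y) = of_bool (X = Y)"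
proof -
  define P where "P B \<longleftrightarrow> (\<forall>X Y. X \<notin> J \<or> Y \<notin> J \<longrightarrow> B X Y = 0) \<and>
     (\<forall>X\<in>J. \<forall>Y\<in>J. (\<Sum>Z\<in>J. A X Z * B Z Y) = of_bool (X = Y)) \<and>
     (\<forall>X\<in>J. \<forall>Y\<in>J. (\<Sum>Z\<in>J. B X Z * A Z Y) = of_bool (X = Y))" for B
  have "\<exists>a. \<forall>X\<in>J. (\<Sum>Z\<in>J. A X Z * a Z) = of_bool (X = Y)" for Y
    by (rule trivial_kernel_imp_solvable[OF J J refl]) (rule ker)
  then have "\<exists>C. \<forall>Y. \<forall>X\<in>J. (\<Sum>Z\<in>J. A X Z * C Y Z) = of_bool (X = Y)"
    by (intro choice allI)
  then obtain C where C: "\<And>X Y. X \<in> J \<Longrightarrow> (\<Sum>Z\<in>J. A X Z * C Y Z) = of_bool (X = Y)"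
    by blast
  define B where "B X Y = (if X \<in> J \<and> Y \<in> J then C Y X else 0)" for X Y
  have AB: "(\<Sum>Z\<in>J. A X Z * B Z Y) = of_bool (X = Y)" if "X \<in> J" "Y \<in> J" for X Y
    using C[of X Y] that by (simp add: B_def cong: sum.cong)
  \<comment> \<open>A (B A - 1) = (A B) A - A = 0, so each column of B A - 1 lies in the
    kernel.\<close>
  have BA: "(\<Sum>Z\<in>J. B X Z * A Z Y) = of_bool (X = Y)" if "X \<in> J" "Y \<in> J" for X Y
  proof -
    have "\<forall>W\<in>J. (\<Sum>Z\<in>J. B W Z * A Z Y) - of_bool (W = Y) = 0"
    proof (rule ker)
      fix V assume V: "V \<in> J"
      have "(\<Sum>W\<in>J. A V W * (\<Sum>Z\<in>J. B W Z * A Z Y)) = (\<Sum>Z\<in>J. (\<Sum>W\<in>J. A V W * B W Z) * A Z Y)"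
        unfolding sum_distrib_left sum_distrib_right
        by (subst sum.swap) (simp add: mult.assoc)
      also have "\<dots> = (\<Sum>Z\<in>J. of_bool (V = Z) * A Z Y)"
        using AB V by (intro sum.cong) auto
      also have "\<dots> = A V Y" using J V by (simp add: of_bool_def if_distrib if_distribR cong: if_cong)
      finally have "(\<Sum>W\<in>J. A V W * (\<Sum>Z\<in>J. B W Z * A Z Y)) = A V Y" .
      moreover have "(\<Sum>W\<in>J. A V W * of_bool (W = Y)) = A V Y"
        using J \<open>Y \<in> J\<close> by (simp add: of_bool_def if_distrib cong: if_cong)
      ultimately show "(\<Sum>W\<in>J. A V W * ((\<Sum>Z\<in>J. B W Z * A Z Y) - of_bool (W = Y))) = 0"
        by (simp add: right_diff_distrib sum_subtractf)
    qed
    then show ?thesis using that by simp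
  qed
  have "P B" using AB BA by (auto simp: P_def B_def)
  moreover have "B' = B" if "P B'" for B'
  proof (intro ext)
    fix X Y
    show "B' X Y = B X Y"
    proof (cases "X \<in> J \<and> Y \<in> J")
      case True
      have "\<forall>Z\<in>J. B' Z Y - B Z Y = 0"
        by (rule ker) (use that AB True in \<open>simp add: P_def right_diff_distrib sum_subtractf\<close>)
      then show ?thesis using True by simp
    next
      case False
      then show ?thesis using that by (auto simp: P_def B_def)
    qed
  qed
  ultimately have "mat_inverse J A = B"
    unfolding mat_inverse_def P_def[symmetric] by (rule the_equality)
  then show "\<forall>X\<in>J. \<forall>Y\<in>J. (\<Sum>Z\<in>J. A X Z * mat_inverse J A Z Y) = of_bool (X = Y)"
    using AB by auto
qed

text \<open>The inverse matrix moves from the basis to the coefficients, which turns dual expansions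
  into primal ones.\<close>

lemma expand_dual_basis:
  "expand J (dual_basis J A \<psi>) a = expand J \<psi> (mat_vec J (mat_inverse J A) a)"
  unfolding expand_def dual_basis_def mat_vec_def scaleR_sum_right scaleR_sum_left
  by (intro ext, subst sum.swap) (simp add: mult.commute)

lemma mat_vec_mat_inverse:
  assumes J: "finite J"
    and ker: "\<And>a. (\<And>X. X \<in> J \<Longrightarrow> (\<Sum>Y\<in>J. A X Y * a Y) = 0) \<Longrightarrow> \<forall>Y\<in>J. a Y = 0"
    and X: "X \<in> J"
  shows "mat_vec J A (mat_vec J (mat_inverse J A) a) X = a X"
proof -
  have comp: "mat_vec J B (mat_vec J C a) X = (\<Sum>Z\<in>J. (\<Sum>Y\<in>J. B X Y * C Y Z) * a Z)" for B C
    unfolding mat_vec_def sum_distrib_left sum_distrib_right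
    by (subst sum.swap) (simp add: mult.assoc)
  have delta: "(\<Sum>Z\<in>J. of_bool (X = Z) * a Z) = a X"
    using J X by (simp add: of_bool_def if_distrib if_distribR cong: if_cong)
  show "mat_vec J A (mat_vec J (mat_inverse J A) a) X = a X"
    unfolding comp using mat_inverse_trivial_kernel[OF J ker] X delta by (simp cong: sum.cong)
qed

text \<open>Independence of \<open>\<psi>\<close> identifies A^-1 a with A^-1 b, and applying A
  gives a = b; this is the uniqueness that the definite description in \<open>coefficients\<close>
  asks for. Outside \<open>J\<close> that description prescribes 0, hence the conditional.\<close>

lemma coefficients_dual_basis:
  assumes J: "finite J"
    and ker: "\<And>a. (\<And>X. X \<in> J \<Longrightarrow> (\<Sum>Y\<in>J. A X Y * a Y) = 0) \<Longrightarrow> \<forall>Y\<in>J. a Y = 0"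
    and indep: "\<And>a. expand J \<psi> a = (\<lambda>i x. 0) \<Longrightarrow> \<forall>X\<in>J. a X = 0"
  shows "coefficients J (dual_basis J A \<psi>) (expand J (dual_basis J A \<psi>) a)
    = (\<lambda>X. if X \<in> J then a X else 0)"
  unfolding coefficients_def
proof (rule the_equality)
  show "(\<forall>X. X \<notin> J \<longrightarrow> (if X \<in> J then a X else 0) = 0) \<and>
    expand J (dual_basis J A \<psi>) a = expand J (dual_basis J A \<psi>) (\<lambda>X. if X \<in> J then a X else 0)"
    by (auto simp: expand_def cong: sum.cong)
next
  fix b assume b: "(\<forall>X. X \<notin> J \<longrightarrow> b X = 0) \<and>
    expand J (dual_basis J A \<psi>) a = expand J (dual_basis J A \<psi>) b"
  let ?B = "mat_inverse J A"
  have "expand J \<psi> (\<lambda>X. mat_vec J ?B a X - mat_vec J ?B b X) = (\<lambda>i x. 0)"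
    using b unfolding expand_dual_basis
    by (auto simp: expand_def fun_eq_iff scaleR_left_diff_distrib sum_subtractf)
  then have eq: "mat_vec J ?B a X = mat_vec J ?B b X" if "X \<in> J" for X
    using indep that by fastforce
  have "a X = b X" if "X \<in> J" for X
    using mat_vec_mat_inverse[OF J, of A, OF ker that, of a] mat_vec_mat_inverse[OF J, of A, OF ker that, of b] eq
    by (simp add: mat_vec_def cong: sum.cong)
  then show "b = (\<lambda>X. if X \<in> J then a X else 0)" using b by auto
qed

section \<open>Partial derivatives\<close>

lemma three_distinct [simp]:
  "(n :: 3) + 1 \<noteq> n" "n + 2 \<noteq> n" "n + 1 \<noteq> n + 2" "n \<noteq> n + 1" "n \<noteq> n + 2" "n + 2 \<noteq> n + 1"
  by simp_all

lemma UNIV_3_cyclic: "(UNIV :: 3 set) = {n, n + 1, n + 2}"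
proof -
  have "card {n, n + 1, n + 2} = card (UNIV :: 3 set)" by simp
  from card_subset_eq[OF _ _ this] show ?thesis by simp
qed

lemma has_derivative_axis_expansion:
  fixes v :: "real^3"
  assumes "linear f'"
  shows "f' v = (\<Sum>i\<in>UNIV. (v $ i) *\<^sub>R f' (axis i 1))"
proof -
  have "f' v = f' (\<Sum>i\<in>UNIV. (v $ i) *\<^sub>R axis i 1)"
    using basis_expansion[of v] by (simp add: scalar_mult_eq_scaleR)
  then show ?thesis
    using assms by (simp add: linear_sum linear_cmul)
qed

lemma has_derivative_partial:
  assumes "(f has_derivative f') (at x)"
  shows "partial f x i = f' (axis i 1)"
  using frechet_derivative_at[OF assms] by (simp add: partial_def)

lemma differentiable_has_derivative_partial:
  assumes "f differentiable (at x)"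
  shows "(f has_derivative (\<lambda>v. \<Sum>i\<in>UNIV. (v $ i) *\<^sub>R partial f x i)) (at x)"
proof -
  obtain f' where f': "(f has_derivative f') (at x)"
    using assms by (auto simp: differentiable_def)
  have "f' v = (\<Sum>i\<in>UNIV. (v $ i) *\<^sub>R partial f x i)" for v
    using has_derivative_axis_expansion[of f' v] has_derivative_linear[OF f']
    by (simp add: has_derivative_partial[OF f'])
  then have "f' = (\<lambda>v. \<Sum>i\<in>UNIV. (v $ i) *\<^sub>R partial f x i)" by blast
  with f' show ?thesis by simp
qed

lemma jac_mult:
  assumes "f differentiable (at x)"
  shows "jac f x *v v = (\<Sum>i\<in>UNIV. (v $ i) *\<^sub>R partial f x i)"
proof -
  have "(f has_derivative frechet_derivative f (at x)) (at x)"
    using assms by (simp add: frechet_derivative_works)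
  then have "linear (frechet_derivative f (at x))" by (rule has_derivative_linear)
  then have "jac f x *v v = frechet_derivative f (at x) v"
    by (simp add: jac_def matrix_works)
  then show ?thesis
    by (simp add: frechet_derivative_at[OF differentiable_has_derivative_partial[OF assms], symmetric])
qed

lemma jac_axis:
  assumes "f differentiable (at x)"
  shows "jac f x *v axis i 1 = partial f x i"
  using assms by (simp add: jac_mult axis_def if_distrib[of "\<lambda>a. a *\<^sub>R _"] cong: if_cong)

text \<open>Functions that agree near \<open>x\<close> have the same derivatives there, so the
  choice operator behind \<open>frechet_derivative\<close> picks the same one, even when no
  derivative exists.\<close>

lemma partial_cong:
  assumes "open S" "x \<in> S" "\<And>y. y \<in> S \<Longrightarrow> f y = g y"
  shows "partial f x i = partial g x i"
proof -
  have "(f has_derivative f') (at x) \<longleftrightarrow> (g has_derivative f') (at x)" for f'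
    using has_derivative_transform_within_open[OF _ assms(1,2), of f f' UNIV g]
      has_derivative_transform_within_open[OF _ assms(1,2), of g f' UNIV f] assms(3) by auto
  then show ?thesis by (simp add: partial_def frechet_derivative_def)
qed

lemma differentiable_transform_open:
  assumes "open S" "x \<in> S" "f differentiable (at x)" "\<And>y. y \<in> S \<Longrightarrow> g y = f y"
  shows "g differentiable (at x)"
proof -
  obtain f' where "(f has_derivative f') (at x)"
    using assms(3) by (auto simp: differentiable_def)
  then have "(g has_derivative f') (at x)"
    using has_derivative_transform_within_open[OF _ assms(1,2)] assms(4) by metis
  then show ?thesis by (auto simp: differentiable_def)
qed

lemma partial_chain:
  assumes "f differentiable (at (F x))" "F differentiable (at x)"
  shows "partial (\<lambda>x. f (F x)) x i = (\<Sum>j\<in>UNIV. (partial F x i $ j) *\<^sub>R partial f (F x) j)"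
proof -
  have "((f \<circ> F) has_derivative ((\<lambda>v. \<Sum>i\<in>UNIV. (v $ i) *\<^sub>R partial f (F x) i) \<circ>
      (\<lambda>v. \<Sum>i\<in>UNIV. (v $ i) *\<^sub>R partial F x i))) (at x)"
    by (intro diff_chain_at differentiable_has_derivative_partial assms)
  from has_derivative_partial[OF this, of i] show ?thesis
    by (simp add: o_def axis_def if_distrib[of "\<lambda>a. a *\<^sub>R _"] if_distrib[of "\<lambda>a. a * _"] cong: if_cong)
qed

lemma partial_bilinear:
  assumes "bounded_bilinear b" "f differentiable (at x)" "g differentiable (at x)"
  shows "partial (\<lambda>x. b (f x) (g x)) x i = b (f x) (partial g x i) + b (partial f x i) (g x)"
proof -
  have "((\<lambda>x. b (f x) (g x)) has_derivative
     (\<lambda>h. b (f x) (frechet_derivative g (at x) h) + b (frechet_derivative f (at x) h) (g x))) (at x)"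
    by (rule bounded_bilinear.FDERIV[OF assms(1)]) (use assms(2,3) frechet_derivative_works in blast)+
  from has_derivative_partial[OF this, of i] show ?thesis by (simp add: partial_def)
qed

lemmas partial_inner = partial_bilinear[OF bounded_bilinear_inner]

lemma bounded_bilinear_cross3: "bounded_bilinear cross3"
proof (rule bounded_bilinear.intro)
  show "\<exists>K. \<forall>a b. norm (cross3 a b) \<le> norm a * norm b * K"
  proof (intro exI[of _ 1] allI)
    fix a b :: "real^3"
    have "(norm (cross3 a b))\<^sup>2 \<le> (norm a * norm b)\<^sup>2"
      \<comment> \<open>Lagrange's identity: |a x b|^2 + (a . b)^2 = |a|^2 |b|^2.\<close>
      using norm_cross_dot[of a b] by (metis le_add_same_cancel1 zero_le_power2)
    then show "norm (cross3 a b) \<le> norm a * norm b * 1"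
      using power2_le_imp_le by fastforce
  qed
qed (simp_all add: cross_add_left cross_add_right cross_mult_left cross_mult_right)

lemmas partial_cross = partial_bilinear[OF bounded_bilinear_cross3]

lemma partial_sum:
  assumes "\<And>k. k \<in> S \<Longrightarrow> f k differentiable (at x)"
  shows "partial (\<lambda>x. \<Sum>k\<in>S. f k x) x i = (\<Sum>k\<in>S. partial (f k) x i)"
proof -
  have "((\<lambda>x. \<Sum>k\<in>S. f k x) has_derivative (\<lambda>h. \<Sum>k\<in>S. frechet_derivative (f k) (at x) h)) (at x)"
    using assms by (intro has_derivative_sum) (auto simp: frechet_derivative_works[symmetric])
  from has_derivative_partial[OF this, of i] show ?thesis by (simp add: partial_def)
qed

lemma differentiable_vec_nth:
  assumes "f differentiable (at x)"
  shows "(\<lambda>x. f x $ k) differentiable (at x)"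
  using assms bounded_linear.has_derivative[OF bounded_linear_vec_nth]
  unfolding differentiable_def by blast

lemma partial_nth:
  fixes f :: "real^3 \<Rightarrow> real^'n"
  assumes "f differentiable (at x)"
  shows "partial (\<lambda>x. f x $ k) x i = partial f x i $ k"
proof -
  have "((\<lambda>x. f x $ k) has_derivative (\<lambda>h. frechet_derivative f (at x) h $ k)) (at x)"
    using assms by (intro bounded_linear.has_derivative[OF bounded_linear_vec_nth])
       (auto simp: frechet_derivative_works[symmetric])
  from has_derivative_partial[OF this, of i] show ?thesis by (simp add: partial_def)
qed

lemma has_vector_derivative_axis_line:
  fixes f :: "real^3 \<Rightarrow> 'b::real_normed_vector"
  assumes "f differentiable (at (a + t *\<^sub>R axis i 1))"
  shows "((\<lambda>t. f (a + t *\<^sub>R axis i 1)) has_vector_derivative partial f (a + t *\<^sub>R axis i 1) i) (at t within T)"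
proof -
  have "((\<lambda>t. a + t *\<^sub>R axis i 1) has_derivative (\<lambda>h. h *\<^sub>R axis i (1::real))) (at t within T)"
    by (auto intro!: derivative_eq_intros)
  from has_derivative_compose[OF this differentiable_has_derivative_partial[OF assms]]
  show ?thesis
    by (simp add: has_vector_derivative_def axis_def mult.commute
        if_distrib[of "\<lambda>a. _ * a"] if_distrib[of "\<lambda>a. a *\<^sub>R _"] cong: if_cong)
qed

lemma has_real_derivative_axis_line:
  fixes f :: "real^3 \<Rightarrow> real"
  assumes "f differentiable (at (a + t *\<^sub>R axis i 1))"
  shows "((\<lambda>t. f (a + t *\<^sub>R axis i 1)) has_real_derivative partial f (a + t *\<^sub>R axis i 1) i) (at t within T)"
  using has_vector_derivative_axis_line[OF assms]
  by (simp add: has_real_derivative_iff_has_vector_derivative)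

text \<open>Two applications of the mean value theorem: along axis \<open>i\<close> to the
  difference of \<open>f\<close> over a step \<open>h\<close> in direction \<open>j\<close>, then
  along axis \<open>j\<close> to the partial derivative so obtained. The points involved move by at
  most \<open>h\<close> along each axis, hence the radius \<open>2 * h\<close>.\<close>

lemma second_difference_mvt:
  fixes f :: "real^3 \<Rightarrow> real"
  assumes h: "0 < h" and ball: "cball x (2 * h) \<subseteq> U"
    and d1: "\<And>y. y \<in> U \<Longrightarrow> f differentiable (at y)"
    and d2: "\<And>y. y \<in> U \<Longrightarrow> (\<lambda>y. partial f y i) differentiable (at y)"
  shows "\<exists>y\<in>cball x (2 * h). f (x + h *\<^sub>R axis i 1 + h *\<^sub>R axis j 1) - f (x + h *\<^sub>R axis i 1)
    - f (x + h *\<^sub>R axis j 1) + f x = h * h * partial (\<lambda>y. partial f y i) y j"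
proof -
  have in_ball: "x + s *\<^sub>R axis i 1 + t *\<^sub>R axis j 1 \<in> cball x (2 * h)" if "0 \<le> s" "s \<le> h" "0 \<le> t" "t \<le> h" for s t
  proof -
    have "norm (s *\<^sub>R axis i (1::real) + t *\<^sub>R axis j (1::real) :: real^3) \<le> s + t"
      using norm_triangle_ineq[of "s *\<^sub>R axis i (1::real)" "t *\<^sub>R axis j (1::real)"] that
      by (simp add: norm_axis_1)
    moreover have "dist x (x + s *\<^sub>R axis i 1 + t *\<^sub>R axis j 1) = norm (s *\<^sub>R axis i (1::real) + t *\<^sub>R axis j (1::real) :: real^3)"
      by (subst dist_commute) (simp add: dist_norm add.assoc)
    ultimately show ?thesis using that by simp
  qed
  define \<phi> where "\<phi> s = f (x + h *\<^sub>R axis j 1 + s *\<^sub>R axis i 1) - f (x + s *\<^sub>R axis i 1)" for s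
  define \<phi>' where "\<phi>' s = partial f (x + h *\<^sub>R axis j 1 + s *\<^sub>R axis i 1) i - partial f (x + s *\<^sub>R axis i 1) i" for s
  have "\<exists>s>0. s < h \<and> \<phi> h - \<phi> 0 = (h - 0) * \<phi>' s"
  proof (rule MVT2[OF h])
    fix s assume s: "0 \<le> s" "s \<le> h"
    have "x + h *\<^sub>R axis j 1 + s *\<^sub>R axis i 1 \<in> U" "x + s *\<^sub>R axis i 1 \<in> U"
      using in_ball[of s h] in_ball[of s 0] s h ball by (auto simp: ac_simps)
    then show "(\<phi> has_real_derivative \<phi>' s) (at s)"
      unfolding \<phi>_def \<phi>'_def
      by (intro DERIV_diff has_real_derivative_axis_line d1)
  qed
  then obtain s where s: "0 < s" "s < h" "\<phi> h - \<phi> 0 = h * \<phi>' s" by auto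
  have "\<exists>t>0. t < h \<and> partial f (x + s *\<^sub>R axis i 1 + h *\<^sub>R axis j 1) i - partial f (x + s *\<^sub>R axis i 1 + 0 *\<^sub>R axis j 1) i
      = (h - 0) * partial (\<lambda>y. partial f y i) (x + s *\<^sub>R axis i 1 + t *\<^sub>R axis j 1) j"
  proof (rule MVT2[OF h])
    fix t assume t: "0 \<le> t" "t \<le> h"
    have "x + s *\<^sub>R axis i 1 + t *\<^sub>R axis j 1 \<in> U"
      using in_ball[of s t] s t ball by auto
    then show "((\<lambda>t. partial f (x + s *\<^sub>R axis i 1 + t *\<^sub>R axis j 1) i) has_real_derivative
       partial (\<lambda>y. partial f y i) (x + s *\<^sub>R axis i 1 + t *\<^sub>R axis j 1) j) (at t)"
      by (intro has_real_derivative_axis_line d2)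
  qed
  then obtain t where t: "0 < t" "t < h"
    "\<phi>' s = h * partial (\<lambda>y. partial f y i) (x + s *\<^sub>R axis i 1 + t *\<^sub>R axis j 1) j"
    unfolding \<phi>'_def by (auto simp: ac_simps)
  show ?thesis
  proof (rule bexI)
    show "x + s *\<^sub>R axis i 1 + t *\<^sub>R axis j 1 \<in> cball x (2 * h)"
      using in_ball s t by simp
    show "f (x + h *\<^sub>R axis i 1 + h *\<^sub>R axis j 1) - f (x + h *\<^sub>R axis i 1)
      - f (x + h *\<^sub>R axis j 1) + f x
      = h * h * partial (\<lambda>y. partial f y i) (x + s *\<^sub>R axis i 1 + t *\<^sub>R axis j 1) j"
      using s(3) unfolding t(3) \<phi>_def by (simp add: ac_simps)
  qed
qed

text \<open>Schwarz's theorem: the second difference is unchanged when \<open>i\<close> and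
  \<open>j\<close> are swapped, and its quotient by the square of the step tends to either mixed
  partial.\<close>

lemma symmetric_second_partials_real:
  fixes f :: "real^3 \<Rightarrow> real"
  assumes U: "open U" "x \<in> U"
    and d1: "\<And>y. y \<in> U \<Longrightarrow> f differentiable (at y)"
    and d2: "\<And>y i. y \<in> U \<Longrightarrow> (\<lambda>y. partial f y i) differentiable (at y)"
    and cont: "\<And>i j. continuous_on U (\<lambda>y. partial (\<lambda>y. partial f y i) y j)"
  shows "partial (\<lambda>y. partial f y i) x j = partial (\<lambda>y. partial f y j) x i"
proof -
  define D where "D i j y = partial (\<lambda>y. partial f y i) y j" for i j y
  obtain r where r: "0 < r" "cball x r \<subseteq> U"
    using U open_contains_cball by blast
  define h where "h n = r / 2 * inverse (real (Suc n))" for n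
  have h: "0 < h n" "cball x (2 * h n) \<subseteq> U" for n
  proof -
    show "0 < h n" using r by (simp add: h_def)
    have "2 * h n \<le> r" using r by (simp add: h_def field_simps)
    then show "cball x (2 * h n) \<subseteq> U" using r by (meson order_trans subset_cball)
  qed
  have h0: "h \<longlonglongrightarrow> 0"
    unfolding h_def by (rule tendsto_mult_right_zero) (rule LIMSEQ_inverse_real_of_nat)
  define \<Delta> where "\<Delta> i j n = f (x + h n *\<^sub>R axis i 1 + h n *\<^sub>R axis j 1) - f (x + h n *\<^sub>R axis i 1)
    - f (x + h n *\<^sub>R axis j 1) + f x" for i j n
  have lim: "(\<lambda>n. \<Delta> i j n / (h n * h n)) \<longlonglongrightarrow> D i j x" for i j
  proof -
    have "\<exists>y. \<forall>n. y n \<in> cball x (2 * h n) \<and> \<Delta> i j n = h n * h n * D i j (y n)"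
      using second_difference_mvt[OF h d1 d2] unfolding D_def \<Delta>_def
      by (intro choice allI) blast
    then obtain y where y: "\<And>n. y n \<in> cball x (2 * h n)" "\<And>n. \<Delta> i j n = h n * h n * D i j (y n)"
      by blast
    have "(\<lambda>n. 2 * h n) \<longlonglongrightarrow> 0" using tendsto_mult_left[OF h0, of 2] by simp
    then have "y \<longlonglongrightarrow> x"
      by (rule metric_tendsto_imp_tendsto) (use y(1) h in \<open>auto simp: dist_commute less_imp_le intro!: always_eventually\<close>)
    moreover have "isCont (D i j) x"
      using cont[of i j] U unfolding D_def by (simp add: continuous_on_eq_continuous_at)
    ultimately have "(\<lambda>n. D i j (y n)) \<longlonglongrightarrow> D i j x" by (rule isCont_tendsto_compose[rotated])
    moreover have "\<Delta> i j n / (h n * h n) = D i j (y n)" for n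
      using y(2)[of n] h(1)[of n] by simp
    ultimately show ?thesis by simp
  qed
  have "\<Delta> i j n = \<Delta> j i n" for n by (simp add: \<Delta>_def ac_simps)
  with lim[of i j] lim[of j i] show ?thesis unfolding D_def using LIMSEQ_unique by simp
qed

lemma symmetric_second_partials:
  fixes f :: "real^3 \<Rightarrow> real^3"
  assumes "open U" "x \<in> U" "Ck 2 U f"
  shows "partial (\<lambda>y. partial f y i) x j = partial (\<lambda>y. partial f y j) x i"
proof (rule vec_eq_iff[THEN iffD2], rule allI)
  fix k
  have d1: "f differentiable (at y)" and d2: "(\<lambda>y. partial f y i) differentiable (at y)" if "y \<in> U" for y i
    using assms(3) that by (auto simp: numeral_2_eq_2)
  have cont: "continuous_on U (\<lambda>y. partial (\<lambda>y. partial f y i) y j)" for i j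
    using assms(3) by (auto simp: numeral_2_eq_2)
  have p2: "partial (\<lambda>y. partial (\<lambda>y. f y $ k) y i) y j = partial (\<lambda>y. partial f y i) y j $ k" if "y \<in> U" for i j y
  proof -
    have "partial (\<lambda>y. partial (\<lambda>y. f y $ k) y i) y j = partial (\<lambda>y. partial f y i $ k) y j"
      by (rule partial_cong[OF assms(1) that]) (simp add: partial_nth d1)
    then show ?thesis by (simp add: partial_nth d2 that)
  qed
  have "partial (\<lambda>y. partial (\<lambda>y. f y $ k) y i) x j = partial (\<lambda>y. partial (\<lambda>y. f y $ k) y j) x i"
  proof (rule symmetric_second_partials_real[OF assms(1,2)])
    fix y i assume y: "y \<in> U"
    show "(\<lambda>y. f y $ k) differentiable (at y)"
      using d1[OF y] by (rule differentiable_vec_nth)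
    have "(\<lambda>y. partial f y i $ k) differentiable (at y)"
      using d2[OF y] by (rule differentiable_vec_nth)
    then show "(\<lambda>y. partial (\<lambda>y. f y $ k) y i) differentiable (at y)"
      by (rule differentiable_transform_open[OF assms(1) y]) (simp add: partial_nth d1)
  next
    fix i j
    show "continuous_on U (\<lambda>y. partial (\<lambda>y. partial (\<lambda>y. f y $ k) y i) y j)"
      using continuous_on_component[OF cont[of i j], of k] by (simp add: p2 cong: continuous_on_cong)
  qed
  then show "partial (\<lambda>y. partial f y i) x j $ k = partial (\<lambda>y. partial f y j) x i $ k"
    by (simp add: p2 assms)
qed

section \<open>Pullback of curl and divergence\<close>

lemma three_arith: "(4 :: 3) = 1" "(5 :: 3) = 2"
  by simp_all

lemma three_eq_zero: "(3 :: 3) = 0"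
  by simp

text \<open>Scalar triple product of the columns; its cyclic invariance lets any column come
  first.\<close>

lemma det_columns:
  "det A = (A *v axis n 1) \<bullet> cross3 (A *v axis (n + 1) 1) (A *v axis (n + 2) 1)" for A :: "real^3^3"
  using exhaust_3[of n] by (elim disjE) (simp_all add: three_arith matrix_vector_mult_basis column_def inner_vec_def sum_3 cross_components det_3 algebra_simps)

lemma differentiable_cross3:
  assumes "f differentiable (at x)" "g differentiable (at x)"
  shows "(\<lambda>x. cross3 (f x) (g x)) differentiable (at x)"
  by (rule differentiableI, rule bounded_bilinear.FDERIV[OF bounded_bilinear_cross3])
     (use assms frechet_derivative_works in blast)+

text \<open>The curl is the vector form of the antisymmetric part of the derivative of
  \<open>c\<close>: the derivative along \<open>a\<close> tested with \<open>b\<close>, minus the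
  same with the roles exchanged.\<close>

lemma inner_cross_curl:
  fixes F c :: "real^3 \<Rightarrow> real^3"
  assumes "c differentiable (at x)"
  shows "curl c x \<bullet> cross3 a b =
    (\<Sum>k\<in>UNIV. a $ k *\<^sub>R partial c x k) \<bullet> b - (\<Sum>k\<in>UNIV. b $ k *\<^sub>R partial c x k) \<bullet> a"
  by (simp add: curl_def inner_vec_def sum_3 cross_components algebra_simps)

text \<open>The exterior derivative commutes with the pullback of 1-forms. Beyond the terms of
  \<open>inner_cross_curl\<close>, differentiation pairs \<open>c\<close> with second derivatives of
  \<open>F\<close>, and these cancel by symmetry.\<close>

lemma curl_pullback:
  assumes U: "open U" "\<xi> \<in> U" "Ck 2 U F" and c: "c differentiable (at (F \<xi>))"
  shows "curl c (F \<xi>) \<bullet> cross3 (partial F \<xi> i) (partial F \<xi> j) =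
    partial (\<lambda>\<zeta>. c (F \<zeta>) \<bullet> partial F \<zeta> j) \<xi> i - partial (\<lambda>\<zeta>. c (F \<zeta>) \<bullet> partial F \<zeta> i) \<xi> j"
proof -
  have F: "F differentiable (at \<xi>)" and dF: "(\<lambda>\<zeta>. partial F \<zeta> i) differentiable (at \<xi>)" for i
    using U by (auto simp: numeral_2_eq_2)
  have cF: "(\<lambda>\<zeta>. c (F \<zeta>)) differentiable (at \<xi>)"
    by (rule differentiable_compose[OF c F])
  show ?thesis
    using symmetric_second_partials[OF U, of i j]
    by (simp add: partial_inner cF dF partial_chain[OF c F] inner_cross_curl[OF c])
qed

text \<open>The analogue for 2-forms. Differentiating \<open>q\<close> gives the divergence times
  the Jacobian determinant; the derivatives of the cross products contribute nothing in
  total.\<close>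

lemma divergence_pullback:
  assumes U: "open U" "\<xi> \<in> U" "Ck 2 U F" and q: "q differentiable (at (F \<xi>))"
  shows "divergence q (F \<xi>) * (partial F \<xi> 1 \<bullet> cross3 (partial F \<xi> 2) (partial F \<xi> 3)) =
    (\<Sum>i\<in>UNIV. partial (\<lambda>\<zeta>. q (F \<zeta>) \<bullet> cross3 (partial F \<zeta> (i + 1)) (partial F \<zeta> (i + 2))) \<xi> i)"
proof -
  have F: "F differentiable (at \<xi>)" and dF: "(\<lambda>\<zeta>. partial F \<zeta> i) differentiable (at \<xi>)" for i
    using U by (auto simp: numeral_2_eq_2)
  have qF: "(\<lambda>\<zeta>. q (F \<zeta>)) differentiable (at \<xi>)"
    by (rule differentiable_compose[OF q F])
  have dc: "(\<lambda>\<zeta>. cross3 (partial F \<zeta> i) (partial F \<zeta> j)) differentiable (at \<xi>)" for i j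
    by (intro differentiable_cross3 dF)
  define D2 where "D2 i j = partial (\<lambda>\<zeta>. partial F \<zeta> i) \<xi> j" for i j
  have sym: "D2 i j = D2 j i" for i j
    unfolding D2_def by (rule symmetric_second_partials[OF U])
  have "(\<Sum>i\<in>UNIV. partial (\<lambda>\<zeta>. q (F \<zeta>) \<bullet> cross3 (partial F \<zeta> (i + 1)) (partial F \<zeta> (i + 2))) \<xi> i) =
    (\<Sum>i\<in>UNIV. (\<Sum>j\<in>UNIV. (partial F \<xi> i $ j) *\<^sub>R partial q (F \<xi>) j) \<bullet>
        cross3 (partial F \<xi> (i + 1)) (partial F \<xi> (i + 2))) +
    q (F \<xi>) \<bullet> (\<Sum>i\<in>UNIV. cross3 (partial F \<xi> (i + 1)) (D2 (i + 2) i) + cross3 (D2 (i + 1) i) (partial F \<xi> (i + 2)))"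
    unfolding inner_sum_right sum.distrib[symmetric]
    by (intro sum.cong refl) (simp add: partial_inner qF dc partial_cross dF partial_chain[OF q F] D2_def)
  \<comment> \<open>Piola identity: the cofactor matrix of the Jacobian is divergence-free. The six
    terms cancel in pairs by symmetry of \<open>D2\<close> and antisymmetry of the cross
    product.\<close>
  also have "(\<Sum>i\<in>UNIV. cross3 (partial F \<xi> (i + 1)) (D2 (i + 2) i) + cross3 (D2 (i + 1) i) (partial F \<xi> (i + 2))) = 0"
    using sym[of 1 2] sym[of 1 3] sym[of 2 3]
    by (simp add: sum_3 three_arith cross_skew[of "partial F \<xi> 1" "D2 3 2"]
      cross_skew[of "partial F \<xi> 2" "D2 3 1"] cross_skew[of "partial F \<xi> 3" "D2 2 1"])
  also have "(\<Sum>i\<in>UNIV. (\<Sum>j\<in>UNIV. (partial F \<xi> i $ j) *\<^sub>R partial q (F \<xi>) j) \<bullet>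
        cross3 (partial F \<xi> (i + 1)) (partial F \<xi> (i + 2))) =
     divergence q (F \<xi>) * (partial F \<xi> 1 \<bullet> cross3 (partial F \<xi> 2) (partial F \<xi> 3))"
    by (simp add: sum_3 three_arith divergence_def inner_vec_def cross_components algebra_simps)
  finally show ?thesis by simp
qed


section \<open>Tensor product polynomials\<close>

lemma tensor_product_has_derivative:
  fixes x :: "real^3"
  shows "((\<lambda>x. poly p (x$1) * poly q (x$2) * poly r (x$3)) has_derivative
    (\<lambda>h. poly p (x$1) * poly q (x$2) * (poly (pderiv r) (x$3) * h$3) +
      (poly p (x$1) * (poly (pderiv q) (x$2) * h$2) + poly (pderiv p) (x$1) * h$1 * poly q (x$2)) * poly r (x$3))) (at x)"
proof -
  have "((\<lambda>x. poly p (x$k)) has_derivative (\<lambda>h. poly (pderiv p) (x$k) * h$k)) (at x)" for p :: "real poly" and k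
    by (rule has_derivative_compose[OF bounded_linear.has_derivative[OF bounded_linear_vec_nth has_derivative_ident]])
       (use poly_DERIV[of p "x$k"] in \<open>simp add: has_field_derivative_def\<close>)
  then show ?thesis by (intro has_derivative_mult)
qed

lemma tensor_product_differentiable:
  "(\<lambda>x. poly p (x$1) * poly q (x$2) * poly r (x$3)) differentiable (at x)" for x :: "real^3"
  using tensor_product_has_derivative by (rule differentiableI)

lemma partial_tensor_product:
  "partial (\<lambda>x. poly p (x$1) * poly q (x$2) * poly r (x$3)) x i =
    poly (if i = 1 then pderiv p else p) (x$1) * poly (if i = 2 then pderiv q else q) (x$2) *
    poly (if i = 3 then pderiv r else r) (x$3)"
  unfolding has_derivative_partial[OF tensor_product_has_derivative]
  using exhaust_3[of i] by (elim disjE) (simp_all add: axis_def)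

lemma tensor_differentiable:
  assumes "f \<in> tensor a b c"
  shows "f differentiable (at x)"
  using assms unfolding tensor_def
  by (auto intro!: differentiable_sum tensor_product_differentiable)

lemma tensor_continuous_on: "f \<in> tensor a b c \<Longrightarrow> continuous_on S f"
  by (meson continuous_at_imp_continuous_on differentiable_imp_continuous_within tensor_differentiable)

text \<open>Differentiation replaces one factor of each product term by its derivative, so the
  degree bounds persist. Iteration yields the continuous second partials that Schwarz's theorem asks
  for.\<close>

lemma tensor_partial:
  assumes "f \<in> tensor a b c"
  shows "(\<lambda>x. partial f x i) \<in> tensor a b c"
proof -
  obtain n p q r where deg: "\<forall>l<(n::nat). degree (p l) \<le> a \<and> degree (q l) \<le> b \<and> degree (r l) \<le> c"
    and f: "f = (\<lambda>x. \<Sum>l<n. poly (p l) (x$1) * poly (q l) (x$2) * poly (r l) (x$3))"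
    using assms unfolding tensor_def by blast
  have "(\<lambda>x. partial f x i) = (\<lambda>x. \<Sum>l<n. poly (if i = 1 then pderiv (p l) else p l) (x$1) *
      poly (if i = 2 then pderiv (q l) else q l) (x$2) * poly (if i = 3 then pderiv (r l) else r l) (x$3))"
    unfolding f by (simp only: partial_sum tensor_product_differentiable partial_tensor_product)
  moreover have "degree (if b then pderiv s else s) \<le> m" if "degree s \<le> m" for b m and s :: "real poly"
    using that by (auto simp: degree_pderiv)
  ultimately show ?thesis using deg unfolding tensor_def mem_Collect_eq
    by (intro exI[of _ n] exI[of _ "\<lambda>l. if i = 1 then pderiv (p l) else p l"]
      exI[of _ "\<lambda>l. if i = 2 then pderiv (q l) else q l"] exI[of _ "\<lambda>l. if i = 3 then pderiv (r l) else r l"]) simp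
qed

lemma tensor_mixed_partials:
  assumes "f \<in> tensor a b c"
  shows "partial (\<lambda>y. partial f y i) x j = partial (\<lambda>y. partial f y j) x i"
  by (rule symmetric_second_partials_real[OF open_UNIV UNIV_I])
     (auto intro: tensor_differentiable[OF assms] tensor_differentiable[OF tensor_partial[OF assms]]
       tensor_continuous_on[OF tensor_partial[OF tensor_partial[OF assms]]])

text \<open>Common weakening of \<open>refC\<close> and \<open>refD\<close>: the degrees are
  forgotten, smoothness of the components is what remains.\<close>

definition polynomial_field :: "(real^3 \<Rightarrow> real^3) \<Rightarrow> bool" where
  "polynomial_field v \<longleftrightarrow> (\<forall>i. \<exists>a b c. (\<lambda>x. v x $ i) \<in> tensor a b c)"

lemma polynomial_field_refC: "v \<in> refC N \<Longrightarrow> polynomial_field v"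
  unfolding polynomial_field_def refC_def forall_3 by blast

lemma polynomial_field_refD: "v \<in> refD N \<Longrightarrow> polynomial_field v"
  unfolding polynomial_field_def refD_def forall_3 by blast

lemma polynomial_field_nth_differentiable: "polynomial_field v \<Longrightarrow> (\<lambda>x. v x $ i) differentiable (at x)"
  unfolding polynomial_field_def using tensor_differentiable by blast

lemma polynomial_field_nth_continuous_on: "polynomial_field v \<Longrightarrow> continuous_on S (\<lambda>x. v x $ i)"
  unfolding polynomial_field_def using tensor_continuous_on by blast

lemma polynomial_field_partial_continuous_on:
  "polynomial_field v \<Longrightarrow> continuous_on S (\<lambda>x. partial (\<lambda>x. v x $ i) x j)"
  unfolding polynomial_field_def using tensor_continuous_on[OF tensor_partial] by blast

lemma tensor_add:
  assumes "f \<in> tensor a b c" "g \<in> tensor a b c"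
  shows "(\<lambda>x. f x + g x) \<in> tensor a b c"
proof -
  obtain n p q r where f: "\<forall>l<(n::nat). degree (p l) \<le> a \<and> degree (q l) \<le> b \<and> degree (r l) \<le> c"
    "f = (\<lambda>x. \<Sum>l<n. poly (p l) (x$1) * poly (q l) (x$2) * poly (r l) (x$3))"
    using assms(1) unfolding tensor_def by blast
  obtain n' p' q' r' where g: "\<forall>l<(n'::nat). degree (p' l) \<le> a \<and> degree (q' l) \<le> b \<and> degree (r' l) \<le> c"
    "g = (\<lambda>x. \<Sum>l<n'. poly (p' l) (x$1) * poly (q' l) (x$2) * poly (r' l) (x$3))"
    using assms(2) unfolding tensor_def by blast
  \<comment> \<open>The two lists of product terms are concatenated, the second shifted by
    \<open>n\<close>.\<close>
  define P Q R where "P l = (if l < n then p l else p' (l - n))"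
    and "Q l = (if l < n then q l else q' (l - n))" and "R l = (if l < n then r l else r' (l - n))" for l
  have "(\<Sum>l<n + n'. poly (P l) (x$1) * poly (Q l) (x$2) * poly (R l) (x$3)) = f x + g x" for x
  proof -
    have split: "(\<Sum>l<n + n'. t l) = (\<Sum>l<n. t l) + (\<Sum>l<n'. t (l + n))" for t :: "nat \<Rightarrow> real"
      using sum.atLeastLessThan_concat[of 0 n "n + n'" t] sum.shift_bounds_nat_ivl[of t 0 n n']
      by (simp add: atLeast0LessThan add.commute)
    show ?thesis unfolding split by (simp add: f g P_def Q_def R_def)
  qed
  moreover have "\<forall>l<n + n'. degree (P l) \<le> a \<and> degree (Q l) \<le> b \<and> degree (R l) \<le> c"
    using f(1) g(1) by (auto simp: P_def Q_def R_def)
  ultimately show ?thesis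
    unfolding tensor_def mem_Collect_eq
    by (intro exI[of _ "n + n'"] exI[of _ P] exI[of _ Q] exI[of _ R]) auto
qed

lemma tensor_scale:
  assumes "f \<in> tensor a b c"
  shows "(\<lambda>x. k * f x) \<in> tensor a b c"
proof -
  obtain n p q r where f: "\<forall>l<(n::nat). degree (p l) \<le> a \<and> degree (q l) \<le> b \<and> degree (r l) \<le> c"
    "f = (\<lambda>x. \<Sum>l<n. poly (p l) (x$1) * poly (q l) (x$2) * poly (r l) (x$3))"
    using assms(1) unfolding tensor_def by blast
  then show ?thesis
    unfolding tensor_def mem_Collect_eq
    by (intro exI[of _ n] exI[of _ "\<lambda>l. smult k (p l)"] exI[of _ q] exI[of _ r])
       (auto simp: sum_distrib_left mult.assoc intro: order_trans[OF degree_smult_le])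
qed

lemma tensor_sum:
  assumes "finite J" "\<And>Y. Y \<in> J \<Longrightarrow> f Y \<in> tensor a b c"
  shows "(\<lambda>x. \<Sum>Y\<in>J. k Y * f Y x) \<in> tensor a b c"
  using assms
proof (induction J rule: finite_induct)
  case empty
  have "(\<lambda>x :: real^3. \<Sum>l<(0::nat). poly 0 (x$1) * poly 0 (x$2) * poly 0 (x$3)) \<in> tensor a b c"
    unfolding tensor_def mem_Collect_eq by (intro exI[of _ 0] exI) auto
  then show ?case by simp
next
  case (insert Y J)
  then show ?case by (simp add: tensor_add tensor_scale)
qed

lemma refC_sum:
  assumes "finite J" "\<And>Y. Y \<in> J \<Longrightarrow> v Y \<in> refC N"
  shows "(\<lambda>x. \<Sum>Y\<in>J. a Y *\<^sub>R v Y x) \<in> refC N"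
  using assms by (auto simp: refC_def intro!: tensor_sum)

lemma refD_sum:
  assumes "finite J" "\<And>Y. Y \<in> J \<Longrightarrow> v Y \<in> refD N"
  shows "(\<lambda>x. \<Sum>Y\<in>J. a Y *\<^sub>R v Y x) \<in> refD N"
  using assms by (auto simp: refD_def intro!: tensor_sum)

section \<open>Stokes' theorem on a rectangle\<close>

lemma plane_point_expansion:
  "plane_point n s y = s *\<^sub>R axis n 1 + fst y *\<^sub>R axis (n + 1) 1 + snd y *\<^sub>R axis (n + 2) 1"
proof -
  have cases: "j = n + 2" if "j \<noteq> n" "j \<noteq> n + 1" for j
    using UNIV_3_cyclic[of n] that by blast
  have "plane_point n s y $ j = (s *\<^sub>R axis n 1 + fst y *\<^sub>R axis (n + 1) 1 + snd y *\<^sub>R axis (n + 2) 1) $ j" for j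
    using cases[of j] by (cases "j = n"; cases "j = n + 1") (auto simp: plane_point_def axis_def)
  then show ?thesis by (simp add: vec_eq_iff)
qed

lemma plane_point_fst: "plane_point n s (t, u) = plane_point n s (0, u) + t *\<^sub>R axis (n + 1) 1"
  by (simp add: plane_point_expansion)

lemma plane_point_snd: "plane_point n s (t, u) = plane_point n s (t, 0) + u *\<^sub>R axis (n + 2) 1"
  by (simp add: plane_point_expansion)

lemma continuous_on_plane_point [continuous_intros]:
  "continuous_on S f \<Longrightarrow> continuous_on S (\<lambda>x. plane_point n s (f x))"
  unfolding plane_point_expansion by (intro continuous_intros)

lemma ftc_axis_line:
  fixes f :: "real^3 \<Rightarrow> real"
  assumes "a \<le> b" "\<And>x. f differentiable (at x)"
  shows "integral {a..b} (\<lambda>t. partial f (p + t *\<^sub>R axis i 1) i) = f (p + b *\<^sub>R axis i 1) - f (p + a *\<^sub>R axis i 1)"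
  by (rule integral_unique, rule fundamental_theorem_of_calculus[OF assms(1)])
     (rule has_vector_derivative_axis_line[OF assms(2)])

text \<open>Each term is integrated first in the direction of its own derivative, where the
  fundamental theorem applies; for the first term this means exchanging the order of
  integration.\<close>

lemma stokes_rectangle:
  assumes v: "polynomial_field v" and le: "a \<le> b" "c \<le> d"
  shows "integral (cbox (a, c) (b, d)) (\<lambda>y. partial (\<lambda>x. v x $ (n + 2)) (plane_point n s y) (n + 1)
      - partial (\<lambda>x. v x $ (n + 1)) (plane_point n s y) (n + 2)) =
    integral {c..d} (\<lambda>u. v (plane_point n s (b, u)) $ (n + 2)) - integral {c..d} (\<lambda>u. v (plane_point n s (a, u)) $ (n + 2))
    - (integral {a..b} (\<lambda>t. v (plane_point n s (t, d)) $ (n + 1)) - integral {a..b} (\<lambda>t. v (plane_point n s (t, c)) $ (n + 1)))"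
proof -
  have cont: "continuous_on S (\<lambda>y. partial (\<lambda>x. v x $ i) (plane_point n s (f y)) j)"
    if "continuous_on S f" for i j f and S :: "'z::topological_space set"
    by (rule continuous_on_compose2[OF polynomial_field_partial_continuous_on[OF v, of UNIV]])
       (auto intro!: continuous_intros that)
  have cont0: "continuous_on S (\<lambda>y. v (plane_point n s (f y)) $ i)"
    if "continuous_on S f" for i f and S :: "'z::topological_space set"
    by (rule continuous_on_compose2[OF polynomial_field_nth_continuous_on[OF v, of UNIV]])
       (auto intro!: continuous_intros that)
  let ?f = "\<lambda>y. partial (\<lambda>x. v x $ (n + 2)) (plane_point n s y) (n + 1)"
  let ?g = "\<lambda>y. partial (\<lambda>x. v x $ (n + 1)) (plane_point n s y) (n + 2)"
  have cf: "continuous_on S ?f" and cg: "continuous_on S ?g" for S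
    by (rule cont, rule continuous_on_id)+
  have "integral (cbox (a, c) (b, d)) (\<lambda>y. ?f y - ?g y) = integral (cbox (a, c) (b, d)) ?f - integral (cbox (a, c) (b, d)) ?g"
    by (intro integral_diff integrable_continuous cf cg)
  also have "integral (cbox (a, c) (b, d)) ?g = integral (cbox a b) (\<lambda>t. integral (cbox c d) (\<lambda>u. ?g (t, u)))"
    by (rule integral_prod_continuous[OF cg])
  also have "(\<lambda>t. integral (cbox c d) (\<lambda>u. ?g (t, u))) = (\<lambda>t. v (plane_point n s (t, d)) $ (n + 1) - v (plane_point n s (t, c)) $ (n + 1))"
    using ftc_axis_line[OF le(2) polynomial_field_nth_differentiable[OF v]]
    by (subst (1 2 3) plane_point_snd) (simp add: cbox_interval)
  also have "integral (cbox a b) \<dots> = integral {a..b} (\<lambda>t. v (plane_point n s (t, d)) $ (n + 1)) - integral {a..b} (\<lambda>t. v (plane_point n s (t, c)) $ (n + 1))"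
    unfolding cbox_interval by (intro integral_diff integrable_continuous_interval cont0 continuous_intros)
  also have "integral (cbox (a, c) (b, d)) ?f = integral (cbox a b) (\<lambda>t. integral (cbox c d) (\<lambda>u. ?f (t, u)))"
    by (rule integral_prod_continuous[OF cf])
  also have "\<dots> = integral (cbox c d) (\<lambda>u. integral (cbox a b) (\<lambda>t. ?f (t, u)))"
    by (rule integral_swap_continuous) (use cf in \<open>simp add: case_prod_unfold\<close>)
  also have "(\<lambda>u. integral (cbox a b) (\<lambda>t. ?f (t, u))) = (\<lambda>u. v (plane_point n s (b, u)) $ (n + 2) - v (plane_point n s (a, u)) $ (n + 2))"
    using ftc_axis_line[OF le(1) polynomial_field_nth_differentiable[OF v]]
    by (subst (1 2 3) plane_point_fst) (simp add: cbox_interval)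
  also have "integral (cbox c d) \<dots> = integral {c..d} (\<lambda>u. v (plane_point n s (b, u)) $ (n + 2)) - integral {c..d} (\<lambda>u. v (plane_point n s (a, u)) $ (n + 2))"
    unfolding cbox_interval by (intro integral_diff integrable_continuous_interval cont0 continuous_intros)
  finally show ?thesis .
qed

section \<open>The reference cube\<close>

lemma mem_refK: "\<xi> \<in> refK \<longleftrightarrow> (\<forall>i. \<bar>\<xi> $ i\<bar> \<le> 1)"
  unfolding refK_def mem_box_cart by (auto simp: abs_le_iff minus_le_iff) 

lemma interior_refK: "interior refK = {\<xi>. \<forall>i. \<bar>\<xi> $ i\<bar> < 1}"
  unfolding refK_def interior_cbox by (auto simp: mem_box_cart abs_less_iff minus_less_iff)

lemma zero_in_interior_refK: "0 \<in> interior refK"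
  by (simp add: interior_refK)

lemma convex_refK: "convex refK" and compact_refK: "compact refK"
  by (simp_all add: refK_def convex_box compact_cbox)

lemma closure_interior_refK: "closure (interior refK) = refK"
  using convex_closure_interior[OF convex_refK] zero_in_interior_refK compact_refK
  by (auto simp: compact_imp_closed)

text \<open>For s = -1 or s = 1 this is the relative interior of
  \<open>cube_face n s\<close>.\<close>

definition open_face :: "3 \<Rightarrow> real \<Rightarrow> (real^3) set" where
  "open_face n s = {\<xi>. \<xi> $ n = s \<and> (\<forall>j. j \<noteq> n \<longrightarrow> \<bar>\<xi> $ j\<bar> < 1)}"

lemma open_face_subset: "s \<in> {-1, 1} \<Longrightarrow> open_face n s \<subseteq> cube_face n s"
proof
  fix x assume s: "s \<in> {-1, 1}" and x: "x \<in> open_face n s"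
  have "\<bar>x $ i\<bar> \<le> 1" for i
    using s x by (cases "i = n") (auto simp: open_face_def less_imp_le)
  then show "x \<in> cube_face n s" using x by (auto simp: open_face_def cube_face_def mem_refK)
qed

lemma cube_face_subset: "cube_face n s \<subseteq> refK"
  by (auto simp: cube_face_def)

lemma eventually_in_open_line:
  fixes x v :: "real^3"
  assumes "open S" "x \<in> S"
  shows "\<exists>e>0. \<forall>t. \<bar>t\<bar> \<le> e \<longrightarrow> x + t *\<^sub>R v \<in> S"
proof -
  obtain r where r: "0 < r" "ball x r \<subseteq> S" using assms open_contains_ball by blast
  \<comment> \<open>The summand 1 keeps \<open>k\<close> positive when \<open>v\<close> is
    zero.\<close>
  define k where "k = norm v + 1"
  have k: "0 < k" "norm v = k - 1" by (simp_all add: k_def add_nonneg_pos)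
  have "norm (t *\<^sub>R v) < r" if "\<bar>t\<bar> \<le> r / (2 * k)" for t
  proof -
    have "norm (t *\<^sub>R v) \<le> r / (2 * k) * norm v"
      using mult_right_mono[OF that, of "norm v"] by simp
    also have "\<dots> < r / (2 * k) * (2 * k)"
      using r k by (intro mult_strict_left_mono divide_pos_pos) auto
    also have "\<dots> = r" using k by simp
    finally show ?thesis .
  qed
  then have "x + t *\<^sub>R v \<in> ball x r" if "\<bar>t\<bar> \<le> r / (2 * k)" for t
    using that by (simp add: dist_norm)
  then show ?thesis using r k by (intro exI[of _ "r / (2 * k)"]) auto
qed

text \<open>As \<xi> is relatively interior to the cube face, the segment from any \<eta> of that
  face to \<xi> can be prolonged a little within the cube. Then \<xi> is interior to a segment of
  the cube, and the defining property of a face puts \<eta> into \<open>F\<close>.\<close>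

lemma cube_face_subset_face:
  assumes F: "F face_of refK" and s: "s \<in> {-1, 1}" and \<xi>: "\<xi> \<in> open_face n s" "\<xi> \<in> F"
  shows "cube_face n s \<subseteq> F"
proof
  fix \<eta> assume \<eta>: "\<eta> \<in> cube_face n s"
  show "\<eta> \<in> F"
  proof (cases "\<eta> = \<xi>")
    case True then show ?thesis using \<xi> by simp
  next
    case False
    let ?S = "{\<zeta> :: real^3. \<forall>j\<in>- {n}. \<bar>\<zeta> $ j\<bar> < 1}"
    have "open ?S"
      unfolding Collect_ball_eq by (intro open_INT) (auto intro!: open_Collect_less continuous_intros)
    moreover have "\<xi> \<in> ?S" using \<xi> by (auto simp: open_face_def)
    ultimately obtain e where e: "e > 0" "\<And>t. \<bar>t\<bar> \<le> e \<Longrightarrow> \<xi> + t *\<^sub>R (\<xi> - \<eta>) \<in> ?S"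
      using eventually_in_open_line by blast
    define \<eta>' where "\<eta>' = \<xi> + e *\<^sub>R (\<xi> - \<eta>)"
    have "\<eta>' \<in> open_face n s"
      using e(1) e(2)[of e] \<xi> \<eta> by (auto simp: \<eta>'_def open_face_def cube_face_def)
    then have "\<eta>' \<in> refK" using open_face_subset[OF s] cube_face_subset by blast
    moreover have "\<xi> \<in> open_segment \<eta> \<eta>'"
    proof -
      \<comment> \<open>The weight 1 / (1 + e) comes from solving the definition of \<eta>' for
        \<xi>.\<close>
      have "\<xi> = (1 - 1 / (1 + e)) *\<^sub>R \<eta> + (1 / (1 + e)) *\<^sub>R \<eta>'"
      proof -
        have "(1 / (1 + e)) *\<^sub>R ((1 + e) *\<^sub>R \<xi>) = \<xi>" using e(1) by simp
        moreover have "(1 / (1 + e)) *\<^sub>R \<eta>' = (1 / (1 + e)) *\<^sub>R ((1 + e) *\<^sub>R \<xi>) - (e / (1 + e)) *\<^sub>R \<eta>"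
          by (simp add: \<eta>'_def scaleR_left_distrib scaleR_right_diff_distrib scaleR_right_distrib)
        moreover have "1 - 1 / (1 + e) = e / (1 + e)" using e(1) by (simp add: field_simps)
        ultimately show ?thesis by simp
      qed
      moreover have "\<eta> \<noteq> \<eta>'"
      proof
        assume "\<eta> = \<eta>'"
        moreover have "(1 + e) *\<^sub>R (\<xi> - \<eta>) = \<eta>' - \<eta>" by (simp add: \<eta>'_def scaleR_left_distrib)
        ultimately have "(1 + e) *\<^sub>R (\<xi> - \<eta>) = 0" by simp
        then show False using False e(1) by simp
      qed
      ultimately show ?thesis unfolding in_segment using e(1) by (intro conjI exI[of _ "1 / (1 + e)"]) auto
    qed
    ultimately show ?thesis
      using face_ofD[OF F, of \<xi> \<eta> \<eta>'] \<xi> \<eta> cube_face_subset by blast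
  qed
qed

text \<open>The midpoint of a point of the open face and a point of the cube off its plane is
  interior to the cube, where a proper face has no points.\<close>

lemma face_subset_cube_face:
  assumes F: "F face_of refK" "F \<noteq> refK" and s: "s \<in> {-1, 1}" and \<xi>: "\<xi> \<in> open_face n s" "\<xi> \<in> F"
  shows "F \<subseteq> cube_face n s"
proof
  fix \<zeta> assume \<zeta>: "\<zeta> \<in> F"
  then have "\<zeta> \<in> refK" using F face_of_imp_subset by blast
  show "\<zeta> \<in> cube_face n s"
  proof (rule ccontr)
    assume "\<not> ?thesis"
    then have ne: "\<zeta> $ n \<noteq> s" using \<open>\<zeta> \<in> refK\<close> by (auto simp: cube_face_def)
    define p where "p = (1/2) *\<^sub>R \<zeta> + (1/2) *\<^sub>R \<xi>"
    have "p \<in> F"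
      unfolding p_def using face_of_imp_convex[OF F(1)] \<zeta> \<xi> by (intro convexD) auto
    moreover have "\<bar>p $ i\<bar> < 1" for i
    proof (cases "i = n")
      case True
      have "\<bar>\<zeta> $ n\<bar> \<le> 1" using \<open>\<zeta> \<in> refK\<close> mem_refK by blast
      then show ?thesis using True \<xi> s ne by (auto simp: p_def open_face_def)
    next
      case False
      have "\<bar>\<zeta> $ i\<bar> \<le> 1" "\<bar>\<xi> $ i\<bar> < 1" using \<open>\<zeta> \<in> refK\<close> mem_refK \<xi> False by (auto simp: open_face_def)
      then show ?thesis by (simp add: p_def)
    qed
    then have "p \<in> interior refK" by (simp add: interior_refK)
    ultimately show False using face_of_disjoint_interior[OF F] by blast
  qed
qed

text \<open>The segment from \<eta> towards a point of the open face lies in the open face, except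
  possibly for \<eta> itself.\<close>

lemma cube_face_subset_closure:
  assumes "open_face n s \<noteq> {}"
  shows "cube_face n s \<subseteq> closure (open_face n s)"
proof
  fix \<eta> assume \<eta>: "\<eta> \<in> cube_face n s"
  obtain \<xi> where \<xi>: "\<xi> \<in> open_face n s" using assms by blast
  show "\<eta> \<in> closure (open_face n s)"
    unfolding closure_approachable
  proof safe
    fix r :: real assume "0 < r"
    then obtain e where e: "e > 0" "\<And>t. \<bar>t\<bar> \<le> e \<Longrightarrow> \<eta> + t *\<^sub>R (\<xi> - \<eta>) \<in> ball \<eta> r"
      using eventually_in_open_line[of "ball \<eta> r" \<eta> "\<xi> - \<eta>"] by auto
    define t where "t = min e 1"
    have t: "0 < t" "t \<le> 1" "t \<le> e" using e by (auto simp: t_def)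
    have "\<bar>(\<eta> + t *\<^sub>R (\<xi> - \<eta>)) $ j\<bar> < 1" if "j \<noteq> n" for j
    proof -
      have "\<bar>\<eta> $ j\<bar> \<le> 1" "\<bar>\<xi> $ j\<bar> < 1"
        using \<eta> \<xi> that by (auto simp: cube_face_def open_face_def mem_refK)
      then have "\<bar>(1 - t) * \<eta> $ j\<bar> \<le> 1 - t" "\<bar>t * \<xi> $ j\<bar> < t"
        using t by (auto simp: abs_mult mult_left_le)
      moreover have "(\<eta> + t *\<^sub>R (\<xi> - \<eta>)) $ j = (1 - t) * \<eta> $ j + t * \<xi> $ j"
        by (simp add: algebra_simps)
      ultimately show ?thesis by linarith
    qed
    then have "\<eta> + t *\<^sub>R (\<xi> - \<eta>) \<in> open_face n s"
      using \<eta> \<xi> by (auto simp: open_face_def cube_face_def)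
    moreover have "dist (\<eta> + t *\<^sub>R (\<xi> - \<eta>)) \<eta> < r"
      using e(2)[of t] t by (simp add: dist_commute)
    ultimately show "\<exists>y\<in>open_face n s. dist y \<eta> < r" by blast
  qed
qed

section \<open>Elements\<close>

locale mesh =
  fixes M :: "('m::finite, 'z) mesh_scheme"
  assumes meshed: "meshed_domain M"
begin

text \<open>\<open>jac\<close> and \<open>partial\<close> use two-sided derivatives, so points on
  the surface of the cube need an open domain around it. One such domain is fixed per element; the
  inverse is kept in the condition so that \<open>inv_phi\<close> exists on the same domain.\<close>

definition nbhd :: "'m \<Rightarrow> (real^3) set" where
  "nbhd m = (SOME U. \<exists>g. open U \<and> refK \<subseteq> U \<and> open (phi M m ` U) \<and> Ck 2 U (phi M m) \<and>
     Ck 2 (phi M m ` U) g \<and> (\<forall>\<xi>\<in>U. g (phi M m \<xi>) = \<xi>))"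

definition inv_phi :: "'m \<Rightarrow> real^3 \<Rightarrow> real^3" where
  "inv_phi m = (SOME g. Ck 2 (phi M m ` nbhd m) g \<and> (\<forall>\<xi>\<in>nbhd m. g (phi M m \<xi>) = \<xi>))"

abbreviation chart_image :: "'m \<Rightarrow> (real^3) set" where
  "chart_image m \<equiv> phi M m ` nbhd m"

lemma element_map_phi: "element_map (phi M m)"
  using meshed by (simp add: meshed_domain_def)

lemma nbhd_spec:
  "\<exists>g. open (nbhd m) \<and> refK \<subseteq> nbhd m \<and> open (chart_image m) \<and> Ck 2 (nbhd m) (phi M m) \<and>
     Ck 2 (chart_image m) g \<and> (\<forall>\<xi>\<in>nbhd m. g (phi M m \<xi>) = \<xi>)"
  unfolding nbhd_def by (rule someI_ex) (use element_map_phi in \<open>simp add: element_map_def\<close>)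

lemma open_nbhd: "open (nbhd m)" and refK_subset_nbhd: "refK \<subseteq> nbhd m"
  and C2_phi: "Ck 2 (nbhd m) (phi M m)"
  using nbhd_spec by blast+

lemma C2_inv_phi: "Ck 2 (chart_image m) (inv_phi m)"
  and inv_phi_phi: "\<xi> \<in> nbhd m \<Longrightarrow> inv_phi m (phi M m \<xi>) = \<xi>"
proof -
  have "Ck 2 (chart_image m) (inv_phi m) \<and> (\<forall>\<xi>\<in>nbhd m. inv_phi m (phi M m \<xi>) = \<xi>)"
    unfolding inv_phi_def
    by (rule someI_ex[of "\<lambda>g. Ck 2 (chart_image m) g \<and> (\<forall>\<xi>\<in>nbhd m. g (phi M m \<xi>) = \<xi>)"])
       (use nbhd_spec in blast)
  then show "Ck 2 (chart_image m) (inv_phi m)" "\<xi> \<in> nbhd m \<Longrightarrow> inv_phi m (phi M m \<xi>) = \<xi>" by auto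
qed

lemma inj_on_phi: "inj_on (phi M m) (nbhd m)"
  by (metis inj_onI inv_phi_phi)

lemma inj_on_phi_refK: "inj_on (phi M m) refK"
  using inj_on_phi refK_subset_nbhd inj_on_subset by blast

lemma phi_eq_iff: "\<xi> \<in> refK \<Longrightarrow> \<eta> \<in> refK \<Longrightarrow> phi M m \<xi> = phi M m \<eta> \<longleftrightarrow> \<xi> = \<eta>"
  using inj_on_phi_refK by (auto dest: inj_onD)

lemma phi_differentiable: "\<xi> \<in> nbhd m \<Longrightarrow> phi M m differentiable (at \<xi>)"
  and partial_phi_differentiable: "\<xi> \<in> nbhd m \<Longrightarrow> (\<lambda>\<xi>. partial (phi M m) \<xi> i) differentiable (at \<xi>)"
  and inv_phi_differentiable: "x \<in> chart_image m \<Longrightarrow> inv_phi m differentiable (at x)"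
  using C2_phi[of m] C2_inv_phi[of m] by (auto simp: numeral_2_eq_2)

lemma continuous_on_phi: "continuous_on (nbhd m) (phi M m)"
  using phi_differentiable
  by (auto intro!: continuous_at_imp_continuous_on differentiable_imp_continuous_within)

lemma continuous_on_phi_refK: "continuous_on refK (phi M m)"
  by (rule continuous_on_subset[OF continuous_on_phi refK_subset_nbhd])

lemma open_image_phi:
  assumes "open S" "S \<subseteq> nbhd m"
  shows "open (phi M m ` S)"
  using assms by (intro invariance_of_domain continuous_on_subset[OF continuous_on_phi]
      inj_on_subset[OF inj_on_phi])

lemma compact_elem: "compact (elem M m)"
  unfolding elem_def by (rule compact_continuous_image[OF continuous_on_phi_refK compact_refK])

lemma closed_elem: "closed (elem M m)"
  by (rule compact_imp_closed[OF compact_elem])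

lemma interior_refK_subset_nbhd: "interior refK \<subseteq> nbhd m"
  using interior_subset refK_subset_nbhd by blast

text \<open>For the inclusion from left to right, the preimage of the interior within the chart
  domain is open and, by injectivity on that domain, contained in the cube.\<close>

lemma interior_elem: "interior (elem M m) = phi M m ` interior refK"
proof
  show "phi M m ` interior refK \<subseteq> interior (elem M m)"
    unfolding elem_def
    by (intro interior_maximal image_mono interior_subset open_image_phi open_interior interior_refK_subset_nbhd)
  define V where "V = {\<xi> \<in> nbhd m. phi M m \<xi> \<in> interior (elem M m)}"
  have sub: "V \<subseteq> refK"
  proof
    fix \<xi> assume \<xi>: "\<xi> \<in> V"
    then have "phi M m \<xi> \<in> elem M m" using interior_subset by (auto simp: V_def)
    then obtain \<eta> where \<eta>: "\<eta> \<in> refK" "phi M m \<xi> = phi M m \<eta>" by (auto simp: elem_def)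
    then have "\<xi> = \<eta>" using \<xi> inj_onD[OF inj_on_phi \<eta>(2)] refK_subset_nbhd by (auto simp: V_def)
    then show "\<xi> \<in> refK" using \<eta> by simp
  qed
  moreover have "open V"
  proof -
    have "V = nbhd m \<inter> phi M m -` interior (elem M m)" by (auto simp: V_def)
    then show ?thesis
      using continuous_on_open_vimage[OF open_nbhd] continuous_on_phi open_interior by (metis Int_commute)
  qed
  ultimately have "V \<subseteq> interior refK" by (rule interior_maximal)
  show "interior (elem M m) \<subseteq> phi M m ` interior refK"
  proof
    fix x assume x: "x \<in> interior (elem M m)"
    then obtain \<xi> where \<xi>: "\<xi> \<in> refK" "x = phi M m \<xi>" using interior_subset by (auto simp: elem_def)
    then have "\<xi> \<in> V" using x refK_subset_nbhd by (auto simp: V_def)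
    then show "x \<in> phi M m ` interior refK" using \<open>V \<subseteq> interior refK\<close> \<xi> by blast
  qed
qed

lemma elem_subset_closure_interior: "elem M m \<subseteq> closure (interior (elem M m))"
proof -
  have "phi M m ` closure (interior refK) \<subseteq> closure (phi M m ` interior refK)"
    by (rule image_closure_subset) (auto simp: closure_interior_refK continuous_on_phi_refK closure_subset)
  then show ?thesis unfolding interior_elem by (simp add: closure_interior_refK elem_def)
qed

lemma interior_elem_not_empty: "interior (elem M m) \<noteq> {}"
  using zero_in_interior_refK by (auto simp: interior_elem)

lemma interior_elem_disjoint: "m \<noteq> n \<Longrightarrow> interior (elem M m) \<inter> interior (elem M n) = {}"
  and closure_Omega: "closure (Omega M) = (\<Union>m. elem M m)"
  and open_Omega: "open (Omega M)"
  using meshed by (simp_all add: meshed_domain_def lipschitz_domain_def)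

lemma elem_subset_closure_Omega: "elem M m \<subseteq> closure (Omega M)"
  by (auto simp: closure_Omega)

text \<open>Two facts are added to conformity. The common face is proper, since otherwise one
  element would contain the other although interiors are disjoint; and by injectivity, membership of
  an image point in the other element can be decided in the reference cube.\<close>

lemma conformingE:
  assumes "m \<noteq> n"
  obtains F \<sigma> where "F face_of refK" "F \<noteq> refK" "orthogonal_transformation \<sigma>" "\<sigma> ` refK = refK"
    "phi M m ` F = elem M m \<inter> elem M n" "\<And>\<xi>. \<xi> \<in> F \<Longrightarrow> phi M m \<xi> = phi M n (\<sigma> \<xi>)"
    "\<And>\<xi>. \<xi> \<in> refK \<Longrightarrow> phi M m \<xi> \<in> elem M n \<longleftrightarrow> \<xi> \<in> F"
proof -
  obtain F \<sigma> where *: "F face_of refK" "orthogonal_transformation \<sigma>" "\<sigma> ` refK = refK"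
    "phi M m ` F = elem M m \<inter> elem M n" "\<And>\<xi>. \<xi> \<in> F \<Longrightarrow> phi M m \<xi> = phi M n (\<sigma> \<xi>)"
    using meshed assms unfolding meshed_domain_def conforming_def by metis
  have "F \<noteq> refK"
  proof
    assume "F = refK"
    then have "elem M m \<subseteq> elem M n" using *(4) by (auto simp: elem_def)
    then have "interior (elem M m) \<subseteq> interior (elem M n)" by (rule interior_mono)
    then show False using interior_elem_disjoint[OF assms] interior_elem_not_empty[of m] by blast
  qed
  moreover have "phi M m \<xi> \<in> elem M n \<longleftrightarrow> \<xi> \<in> F" if "\<xi> \<in> refK" for \<xi>
  proof
    assume "phi M m \<xi> \<in> elem M n"
    then have "phi M m \<xi> \<in> phi M m ` F" using *(4) that by (auto simp: elem_def)
    then show "\<xi> \<in> F" using phi_eq_iff that face_of_imp_subset[OF *(1)] by auto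
  next
    assume "\<xi> \<in> F" then show "phi M m \<xi> \<in> elem M n" using *(4) by blast
  qed
  ultimately show ?thesis using * that by metis
qed

section \<open>Boundary faces\<close>

text \<open>Across a common face the map of one element and the reflected map of the other fit
  together to an injective continuous map, so invariance of domain applies.\<close>

lemma shared_face_interior:
  assumes mn: "m \<noteq> m'" and s: "s \<in> {-1, 1}" and \<xi>: "\<xi> \<in> open_face n s" and mem: "phi M m \<xi> \<in> elem M m'"
  shows "phi M m \<xi> \<in> interior (elem M m \<union> elem M m')"
proof -
  obtain F \<sigma> where F: "F face_of refK" "F \<noteq> refK" and \<sigma>: "orthogonal_transformation \<sigma>" "\<sigma> ` refK = refK"
    and img: "phi M m ` F = elem M m \<inter> elem M m'" and glue: "\<And>\<xi>. \<xi> \<in> F \<Longrightarrow> phi M m \<xi> = phi M m' (\<sigma> \<xi>)"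
    and iff: "\<And>\<xi>. \<xi> \<in> refK \<Longrightarrow> phi M m \<xi> \<in> elem M m' \<longleftrightarrow> \<xi> \<in> F"
    using conformingE[OF mn] by blast
  have "\<xi> \<in> refK" using open_face_subset[OF s] cube_face_subset \<xi> by blast
  then have "\<xi> \<in> F" using iff mem by blast
  have face1: "cube_face n s \<subseteq> F" by (rule cube_face_subset_face[OF F(1) s \<xi> \<open>\<xi> \<in> F\<close>])
  have face2: "F \<subseteq> cube_face n s" by (rule face_subset_cube_face[OF F s \<xi> \<open>\<xi> \<in> F\<close>])
  \<comment> \<open>Reflection in the plane that carries the cube face; it folds the outside next to
    the face back into the cube.\<close>
  define \<rho> :: "real^3 \<Rightarrow> real^3" where "\<rho> \<zeta> = \<zeta> + (2 * (s - \<zeta> $ n)) *\<^sub>R axis n 1" for \<zeta>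
  have \<rho>_nth: "\<rho> \<zeta> $ i = (if i = n then 2 * s - \<zeta> $ n else \<zeta> $ i)" for \<zeta> i
    by (simp add: \<rho>_def axis_def)
  have \<rho>_invol: "\<rho> (\<rho> \<zeta>) = \<zeta>" for \<zeta> by (simp add: vec_eq_iff \<rho>_nth)
  have \<rho>_fix: "\<rho> \<zeta> = \<zeta>" if "\<zeta> $ n = s" for \<zeta> using that by (simp add: vec_eq_iff \<rho>_nth)
  \<comment> \<open>An open box around \<xi>, of half-width 1 across the face: its inner half lies
    in the cube, its outer half does so after reflection.\<close>
  define B where "B = {\<zeta> :: real^3. (\<forall>j\<in>- {n}. \<bar>\<zeta> $ j\<bar> < 1) \<and> \<bar>\<zeta> $ n - s\<bar> < 1}"
  have "open B"
    unfolding B_def Collect_conj_eq Collect_ball_eq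
    by (intro open_Int open_INT) (auto intro!: open_Collect_less continuous_intros)
  have "\<xi> \<in> B" using \<xi> by (auto simp: B_def open_face_def)
  have below: "\<zeta> \<in> refK" if "\<zeta> \<in> B" "s * \<zeta> $ n \<le> 1" for \<zeta>
  proof -
    have "\<bar>\<zeta> $ i\<bar> \<le> 1" for i
      using that s by (cases "i = n") (auto simp: B_def less_imp_le)
    then show ?thesis by (simp add: mem_refK)
  qed
  have above: "\<rho> \<zeta> \<in> refK" if "\<zeta> \<in> B" "1 \<le> s * \<zeta> $ n" for \<zeta>
  proof -
    have "\<bar>\<rho> \<zeta> $ i\<bar> \<le> 1" for i
      using that s by (cases "i = n") (auto simp: B_def \<rho>_nth less_imp_le)
    then show ?thesis by (simp add: mem_refK)
  qed
  have \<sigma>_refK: "\<sigma> \<zeta> \<in> refK" if "\<zeta> \<in> refK" for \<zeta> using that \<sigma>(2) by blast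
  have \<sigma>_inj: "\<sigma> a = \<sigma> b \<longleftrightarrow> a = b" for a b
    using orthogonal_transformation_inj[OF \<sigma>(1)] by (simp add: inj_eq)
  \<comment> \<open>As \<open>s\<close> is -1 or 1, the condition
    \<open>s * \<zeta> $ n \<le> 1\<close> describes the inner side of the plane.\<close>
  define \<Phi> where "\<Phi> \<zeta> = (if s * \<zeta> $ n \<le> 1 then phi M m \<zeta> else phi M m' (\<sigma> (\<rho> \<zeta>)))" for \<zeta>
  have "continuous_on B \<Phi>"
    unfolding \<Phi>_def
  proof (rule continuous_on_cases_le)
    show "continuous_on {\<zeta> \<in> B. s * \<zeta> $ n \<le> 1} (phi M m)"
      by (rule continuous_on_subset[OF continuous_on_phi_refK]) (use below in auto)
    show "continuous_on {\<zeta> \<in> B. 1 \<le> s * \<zeta> $ n} (\<lambda>\<zeta>. phi M m' (\<sigma> (\<rho> \<zeta>)))"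
    proof (rule continuous_on_compose2[OF continuous_on_phi_refK])
      show "continuous_on {\<zeta> \<in> B. 1 \<le> s * \<zeta> $ n} (\<lambda>\<zeta>. \<sigma> (\<rho> \<zeta>))"
        unfolding \<rho>_def
        by (intro continuous_intros linear_continuous_on_compose[OF _ orthogonal_transformation_linear[OF \<sigma>(1)]])
    qed (use above \<sigma>_refK in auto)
    show "continuous_on B (\<lambda>\<zeta>. s * \<zeta> $ n)" by (intro continuous_intros)
    fix \<zeta> assume \<zeta>: "\<zeta> \<in> B" "s * \<zeta> $ n = 1"
    then have "\<zeta> $ n = s" using s by auto
    then have "\<zeta> \<in> F" using below[OF \<zeta>(1)] \<zeta> face1 by (auto simp: cube_face_def)
    then show "phi M m \<zeta> = phi M m' (\<sigma> (\<rho> \<zeta>))" using glue \<rho>_fix \<open>\<zeta> $ n = s\<close> by simp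
  qed
  moreover have "inj_on \<Phi> B"
  proof -
    \<comment> \<open>A collision between the two halves is a common point of both elements, hence
      comes from \<open>F\<close>, hence from the dividing plane.\<close>
    have mixed: False if "\<zeta> \<in> B" "\<zeta>' \<in> B" "s * \<zeta> $ n \<le> 1" "\<not> s * \<zeta>' $ n \<le> 1" "\<Phi> \<zeta> = \<Phi> \<zeta>'" for \<zeta> \<zeta>'
    proof -
      have *: "\<zeta> \<in> refK" "\<rho> \<zeta>' \<in> refK" using below above that by auto
      have eq: "phi M m \<zeta> = phi M m' (\<sigma> (\<rho> \<zeta>'))" using that by (simp add: \<Phi>_def)
      then have "phi M m \<zeta> \<in> elem M m'" using \<sigma>_refK * by (auto simp: elem_def)
      then have "\<zeta> \<in> F" using iff * by blast
      then have "phi M m' (\<sigma> \<zeta>) = phi M m' (\<sigma> (\<rho> \<zeta>'))" using glue eq by simp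
      then have "\<zeta> = \<rho> \<zeta>'" using phi_eq_iff \<sigma>_refK * \<sigma>_inj by auto
      moreover have "\<zeta> $ n = s" using \<open>\<zeta> \<in> F\<close> face2 by (auto simp: cube_face_def)
      ultimately have "\<zeta>' $ n = s" using \<rho>_nth[of \<zeta>' n] by simp
      then show False using that s by auto
    qed
    show ?thesis
    proof (rule inj_onI)
      fix \<zeta> \<zeta>' assume *: "\<zeta> \<in> B" "\<zeta>' \<in> B" "\<Phi> \<zeta> = \<Phi> \<zeta>'"
      consider "s * \<zeta> $ n \<le> 1" "s * \<zeta>' $ n \<le> 1" | "\<not> s * \<zeta> $ n \<le> 1" "\<not> s * \<zeta>' $ n \<le> 1"
        using mixed[of \<zeta> \<zeta>'] mixed[of \<zeta>' \<zeta>] * by auto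
      then show "\<zeta> = \<zeta>'"
      proof cases
        case 1
        then show ?thesis using * below phi_eq_iff by (auto simp: \<Phi>_def)
      next
        case 2
        then have "\<sigma> (\<rho> \<zeta>) = \<sigma> (\<rho> \<zeta>')" using * above phi_eq_iff \<sigma>_refK by (auto simp: \<Phi>_def)
        then show ?thesis using \<sigma>_inj \<rho>_invol by metis
      qed
    qed
  qed
  ultimately have "open (\<Phi> ` B)" using \<open>open B\<close> by (intro invariance_of_domain)
  moreover have "\<Phi> ` B \<subseteq> elem M m \<union> elem M m'"
    using below above \<sigma>_refK by (auto simp: \<Phi>_def elem_def)
  ultimately have "\<Phi> ` B \<subseteq> interior (elem M m \<union> elem M m')" by (simp add: interior_maximal)
  moreover have "s * \<xi> $ n \<le> 1" using \<xi> s by (auto simp: open_face_def)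
  then have "\<Phi> \<xi> = phi M m \<xi>" by (simp add: \<Phi>_def)
  ultimately show ?thesis using \<open>\<xi> \<in> B\<close> by (metis imageI subsetD)
qed

section \<open>Local geometry of a Lipschitz frontier\<close>

lemma open_below_graph:
  fixes R :: "real^3 \<Rightarrow> real^3" and \<gamma> :: "real \<times> real \<Rightarrow> real"
  assumes R: "orthogonal_transformation R" and cont: "continuous_on UNIV \<gamma>"
  shows "open ((\<lambda>z. x + R z) ` ({z. z $ 3 < \<gamma> (z$1, z$2)} \<inter> ball 0 r))"
proof (rule invariance_of_domain)
  show "open ({z :: real^3. z $ 3 < \<gamma> (z$1, z$2)} \<inter> ball 0 r)"
    by (intro open_Int open_Collect_less open_ball continuous_intros continuous_on_compose2[OF cont]) auto
qed (use orthogonal_transformation_inj[OF R] in \<open>auto simp: inj_on_def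
  intro!: continuous_intros linear_continuous_on_compose[OF _ orthogonal_transformation_linear[OF R]]\<close>)

text \<open>Places the centre of the chart on the graph. Since \<Omega> is open, \<open>x\<close> is
  not in \<Omega> and the graph value is not negative; were it positive, a neighbourhood of
  \<open>x\<close> would lie below the graph, away from the closure of \<Omega>.\<close>

lemma lipschitz_chart:
  assumes "x \<in> frontier (Omega M)"
  obtains R :: "real^3 \<Rightarrow> real^3" and \<gamma> r where "orthogonal_transformation R" "continuous_on UNIV \<gamma>" "0 < r"
    "\<gamma> (0, 0) = 0" "\<And>z. norm z < r \<Longrightarrow> x + R z \<in> Omega M \<longleftrightarrow> \<gamma> (z$1, z$2) < z$3"
proof -
  have "lipschitz_domain (Omega M)" using meshed by (simp add: meshed_domain_def)
  then obtain R :: "real^3 \<Rightarrow> real^3" and \<gamma> L r where R: "orthogonal_transformation R"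
    and lip: "L-lipschitz_on UNIV (\<gamma> :: real \<times> real \<Rightarrow> real)" and r: "0 < r"
    and chart: "\<And>z. z \<in> ball 0 r \<Longrightarrow> x + R z \<in> Omega M \<longleftrightarrow> \<gamma> (z$1, z$2) < z$3"
    using assms unfolding lipschitz_domain_def by metis
  have chart': "x + R z \<in> Omega M \<longleftrightarrow> \<gamma> (z$1, z$2) < z$3" if "norm z < r" for z
    using chart that by simp
  have cont: "continuous_on UNIV \<gamma>" by (rule lipschitz_on_continuous_on[OF lip])
  have R0: "R 0 = 0" using linear_0[OF orthogonal_transformation_linear[OF R]] .
  have "x \<notin> Omega M" using assms open_Omega by (simp add: frontier_def interior_open)
  then have "\<not> \<gamma> (0, 0) < 0" using chart'[of 0] r R0 by simp
  moreover have "\<not> 0 < \<gamma> (0, 0)"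
  proof
    assume pos: "0 < \<gamma> (0, 0)"
    define S where "S = {z :: real^3. z $ 3 < \<gamma> (z$1, z$2)} \<inter> ball 0 r"
    have "open ((\<lambda>z. x + R z) ` S)" unfolding S_def by (rule open_below_graph[OF R cont])
    moreover have "x \<in> (\<lambda>z. x + R z) ` S" using pos r R0 by (auto simp: S_def intro!: image_eqI[of _ _ 0])
    moreover have "(\<lambda>z. x + R z) ` S \<inter> Omega M = {}" using chart' by (auto simp: S_def)
    ultimately have "x \<notin> closure (Omega M)" by (metis open_Int_closure_eq_empty IntI empty_iff)
    then show False using assms by (simp add: frontier_def)
  qed
  ultimately have "\<gamma> (0, 0) = 0" by simp
  then show ?thesis using that R cont r chart' by blast
qed

text \<open>Excludes slits: in the chart, points straight below the centre lie in an open set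
  disjoint from \<Omega>, hence outside its closure, however close to the centre they are.\<close>

lemma frontier_Int_interior_closure:
  assumes "x \<in> frontier (Omega M)"
  shows "x \<notin> interior (closure (Omega M))"
proof
  assume int: "x \<in> interior (closure (Omega M))"
  obtain R :: "real^3 \<Rightarrow> real^3" and \<gamma> r where R: "orthogonal_transformation R" and cont: "continuous_on UNIV \<gamma>" and r: "0 < r"
    and g0: "\<gamma> (0, 0) = 0" and chart: "\<And>z. norm z < r \<Longrightarrow> x + R z \<in> Omega M \<longleftrightarrow> \<gamma> (z$1, z$2) < z$3"
    using lipschitz_chart[OF assms] by blast
  have lin: "linear R" by (rule orthogonal_transformation_linear[OF R])
  define S where "S = {z :: real^3. z $ 3 < \<gamma> (z$1, z$2)} \<inter> ball 0 r"
  have "open ((\<lambda>z. x + R z) ` S)" unfolding S_def by (rule open_below_graph[OF R cont])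
  moreover have "(\<lambda>z. x + R z) ` S \<inter> Omega M = {}" using chart by (auto simp: S_def)
  ultimately have empty: "(\<lambda>z. x + R z) ` S \<inter> closure (Omega M) = {}" by (metis open_Int_closure_eq_empty)
  obtain e where e: "e > 0" "\<And>t. \<bar>t\<bar> \<le> e \<Longrightarrow> x + t *\<^sub>R R (axis 3 1) \<in> interior (closure (Omega M))"
    using eventually_in_open_line[OF open_interior int] by blast
  define t where "t = min e (r / 2)"
  have t: "0 < t" "t \<le> e" "t < r" using e r by (auto simp: t_def)
  have "norm ((-t) *\<^sub>R axis 3 1 :: real^3) = t" using t by (simp add: norm_axis_1)
  then have "(-t) *\<^sub>R axis 3 1 \<in> S"
    using t g0 by (simp add: S_def dist_norm) (simp add: axis_def)
  then have "x + R ((-t) *\<^sub>R axis 3 1) \<notin> closure (Omega M)" using empty by blast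
  moreover have "x + R ((-t) *\<^sub>R axis 3 1) \<in> closure (Omega M)"
    using e(2)[of "-t"] t interior_subset linear_cmul[OF lin, of "-t" "axis 3 1"] by auto
  ultimately show False by blast
qed

lemma frontier_interior_elem: "x \<in> frontier (Omega M) \<Longrightarrow> x \<notin> interior (elem M m)"
  using frontier_Int_interior_closure interior_mono[OF elem_subset_closure_Omega] by blast

text \<open>A second element at the given point would, by \<open>shared_face_interior\<close>, make
  a frontier point interior to the closure. Elements meet in whole faces of the cube, so no other
  point of the open face belongs to a second element either. If such a point were in \<Omega> it
  would be interior to its only element, which images of the surface of the cube are not. Passing to
  the closure gives the whole face.\<close>

lemma open_face_on_frontier:
  assumes s: "s \<in> {-1, 1}" and \<xi>: "\<xi> \<in> open_face n s" and fr: "phi M m \<xi> \<in> frontier (Omega M)"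
  shows "(m, n, s) \<in> bfaces M"
proof -
  have alone: "phi M m \<xi> \<notin> elem M m'" if "m' \<noteq> m" for m'
  proof
    assume "phi M m \<xi> \<in> elem M m'"
    then have "phi M m \<xi> \<in> interior (elem M m \<union> elem M m')"
      using shared_face_interior s \<xi> that by metis
    moreover have "interior (elem M m \<union> elem M m') \<subseteq> interior (closure (Omega M))"
      by (intro interior_mono Un_least elem_subset_closure_Omega)
    ultimately show False using frontier_Int_interior_closure[OF fr] by blast
  qed
  have "phi M m \<eta> \<in> frontier (Omega M)" if \<eta>: "\<eta> \<in> open_face n s" for \<eta>
  proof -
    have "\<eta> \<in> refK" "\<xi> \<in> cube_face n s" using open_face_subset[OF s] cube_face_subset \<eta> \<xi> by blast+
    have not_in: "phi M m \<eta> \<notin> elem M m'" if "m' \<noteq> m" for m'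
    proof
      assume mem: "phi M m \<eta> \<in> elem M m'"
      obtain F where F: "F face_of refK" "\<And>\<xi>. \<xi> \<in> refK \<Longrightarrow> phi M m \<xi> \<in> elem M m' \<longleftrightarrow> \<xi> \<in> F"
        using conformingE[of m m'] \<open>m' \<noteq> m\<close> by metis
      have "\<eta> \<in> F" using F(2) mem \<open>\<eta> \<in> refK\<close> by blast
      then have "\<xi> \<in> F" using cube_face_subset_face[OF F(1) s \<eta>] \<open>\<xi> \<in> cube_face n s\<close> by blast
      then show False
        using F(2) alone[OF that] \<open>\<xi> \<in> cube_face n s\<close> cube_face_subset by blast
    qed
    have "phi M m \<eta> \<notin> Omega M"
    proof
      assume mem: "phi M m \<eta> \<in> Omega M"
      \<comment> \<open>Removing the other elements, finitely many closed sets, leaves an open set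
        covered by element \<open>m\<close> alone.\<close>
      define V where "V = Omega M \<inter> - (\<Union>m'\<in>- {m}. elem M m')"
      have "open V"
        unfolding V_def by (intro open_Int open_Omega open_Compl closed_UN) (auto intro: closed_elem)
      moreover have "V \<subseteq> elem M m"
        using closure_subset[of "Omega M"] by (auto simp: V_def closure_Omega)
      moreover have "phi M m \<eta> \<in> V" using mem not_in by (auto simp: V_def)
      ultimately have "phi M m \<eta> \<in> interior (elem M m)" by (metis interior_maximal subsetD)
      then obtain \<zeta> where "\<zeta> \<in> interior refK" "phi M m \<eta> = phi M m \<zeta>" by (auto simp: interior_elem)
      then have "\<eta> \<in> interior refK"
        using phi_eq_iff[of \<eta> \<zeta> m] \<open>\<eta> \<in> refK\<close> interior_subset[of refK] by auto
      then have "\<bar>\<eta> $ n\<bar> < 1" by (simp add: interior_refK)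
      then show False using \<eta> s by (auto simp: open_face_def)
    qed
    moreover have "phi M m \<eta> \<in> closure (Omega M)"
      using elem_subset_closure_Omega[of m] \<open>\<eta> \<in> refK\<close> by (auto simp: elem_def)
    ultimately show ?thesis using open_Omega by (simp add: frontier_def interior_open)
  qed
  then have "phi M m ` closure (open_face n s) \<subseteq> frontier (Omega M)"
    using closure_mono[OF subset_trans[OF open_face_subset[OF s, of n] cube_face_subset]]
    by (intro image_closure_subset continuous_on_subset[OF continuous_on_phi_refK] frontier_closed)
       (auto simp: compact_imp_closed[OF compact_refK])
  moreover have "cube_face n s \<subseteq> closure (open_face n s)"
    using cube_face_subset_closure \<xi> by blast
  ultimately have "phi M m ` cube_face n s \<subseteq> frontier (Omega M)" by blast
  then show ?thesis using s by (simp add: bfaces_def)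
qed

text \<open>The twelve edges of the cube, parametrized by intervals so that their projections become
  differentiable curves in the plane.\<close>

definition edge_skeleton :: "(real^3) set" where
  "edge_skeleton = (\<Union>d. \<Union>a\<in>{-1, 1}. \<Union>b\<in>{-1, 1}. (\<lambda>t. plane_point d t (a, b)) ` {-1..1})"

lemma edge_skeleton_subset: "edge_skeleton \<subseteq> refK"
  by (auto simp: edge_skeleton_def mem_refK plane_point_def)

text \<open>Two coordinates of modulus 1 would put the point on an edge, none would put it in the
  interior; exactly one remains.\<close>

lemma not_edge_skeleton:
  assumes "\<xi> \<in> refK" "\<xi> \<notin> interior refK" "\<xi> \<notin> edge_skeleton"
  obtains n s where "s \<in> {-1, 1}" "\<xi> \<in> open_face n s"
proof -
  have le: "\<bar>\<xi> $ i\<bar> \<le> 1" for i using assms(1) by (simp add: mem_refK)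
  have not2: "\<not> (\<bar>\<xi> $ (d + 1)\<bar> = 1 \<and> \<bar>\<xi> $ (d + 2)\<bar> = 1)" for d
  proof
    assume *: "\<bar>\<xi> $ (d + 1)\<bar> = 1 \<and> \<bar>\<xi> $ (d + 2)\<bar> = 1"
    have "\<xi> = plane_point d (\<xi> $ d) (\<xi> $ (d + 1), \<xi> $ (d + 2))"
    proof -
      have "j = d + 2" if "j \<noteq> d" "j \<noteq> d + 1" for j using UNIV_3_cyclic[of d] that by blast
      then show ?thesis by (auto simp: vec_eq_iff plane_point_def)
    qed
    moreover have "\<xi> $ (d + 1) \<in> {-1, 1}" "\<xi> $ (d + 2) \<in> {-1, 1}" using * by auto
    moreover have "\<xi> $ d \<in> {-1..1}" using le[of d] by auto
    ultimately have "\<xi> \<in> edge_skeleton" unfolding edge_skeleton_def by blast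
    then show False using assms by simp
  qed
  obtain n where n: "\<bar>\<xi> $ n\<bar> = 1" using assms(2) le by (force simp: interior_refK not_less intro: antisym)
  have "\<bar>\<xi> $ j\<bar> < 1" if "j \<noteq> n" for j
  proof -
    have "j = n + 1 \<or> j = n + 2" using UNIV_3_cyclic[of n] that by blast
    then have "\<bar>\<xi> $ j\<bar> \<noteq> 1"
      using not2[of "n + 1"] not2[of "n + 2"] n three_eq_zero three_arith(1) by (auto simp: add.assoc)
    then show ?thesis using le[of j] by simp
  qed
  moreover have "\<xi> $ n \<in> {-1, 1}" using n by (auto simp: abs_if split: if_splits)
  ultimately show ?thesis using that[of "\<xi> $ n" n] by (simp add: open_face_def)
qed

text \<open>The frontier is locally a graph over a planar disc, whereas the element edges project to a
  null set of that disc.\<close>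

lemma frontier_approach_off_edges:
  assumes x: "x \<in> frontier (Omega M)" and "0 < \<delta>"
  obtains w where "w \<in> frontier (Omega M)" "dist w x < \<delta>" "\<And>m. w \<notin> phi M m ` edge_skeleton"
proof -
  obtain R :: "real^3 \<Rightarrow> real^3" and \<gamma> r where R: "orthogonal_transformation R" and cont: "continuous_on UNIV \<gamma>" and r: "0 < r"
    and g0: "\<gamma> (0, 0) = 0" and chart: "\<And>z. norm z < r \<Longrightarrow> x + R z \<in> Omega M \<longleftrightarrow> \<gamma> (z$1, z$2) < z$3"
    using lipschitz_chart[OF x] by blast
  have lin: "linear R" by (rule orthogonal_transformation_linear[OF R])
  \<comment> \<open>Orthogonality of \<open>R\<close> makes \<open>\<pi>\<close> read off the first
    two chart coordinates.\<close>
  define \<pi> where "\<pi> w = ((w - x) \<bullet> R (axis 1 1), (w - x) \<bullet> R (axis 2 1))" for w :: "real^3"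
  have \<pi>: "\<pi> (x + R z) = (z $ 1, z $ 2)" for z
    using R by (simp add: \<pi>_def orthogonal_transformation_def inner_axis)
  have "negligible (\<Union>m. \<pi> ` phi M m ` edge_skeleton)"
  proof -
    \<comment> \<open>A differentiable image of an interval in the plane is a null set.\<close>
    have "negligible ((\<lambda>t. \<pi> (phi M m (plane_point d t (a, b)))) ` {-1..1})" if "a \<in> {-1, 1}" "b \<in> {-1, 1}" for m d a b
    proof (rule negligible_differentiable_image_lowdim)
      show "(\<lambda>t. \<pi> (phi M m (plane_point d t (a, b)))) differentiable_on {-1..1}"
        unfolding differentiable_on_def
      proof
        fix t :: real assume t: "t \<in> {-1..1}"
        then have "plane_point d t (a, b) \<in> nbhd m"
          using that edge_skeleton_subset refK_subset_nbhd by (fastforce simp: edge_skeleton_def)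
        then obtain D where D: "(phi M m has_derivative D) (at (plane_point d t (a, b)))"
          using phi_differentiable by (auto simp: differentiable_def)
        have "((\<lambda>t. plane_point d t (a, b)) has_derivative (\<lambda>h. h *\<^sub>R axis d 1)) (at t within {-1..1})"
          unfolding plane_point_expansion by (auto intro!: derivative_eq_intros)
        from has_derivative_compose[OF this D]
        have D': "((\<lambda>t. phi M m (plane_point d t (a, b))) has_derivative (\<lambda>h. D (h *\<^sub>R axis d 1))) (at t within {-1..1})" .
        show "(\<lambda>t. \<pi> (phi M m (plane_point d t (a, b)))) differentiable (at t within {-1..1})"
          unfolding \<pi>_def
          by (intro differentiable_Pair differentiable_inner differentiable_diff differentiable_const differentiableI[OF D'])
      qed
    qed simp
    then have "negligible (\<Union>m. \<Union>d. \<Union>a\<in>{-1, 1}. \<Union>b\<in>{-1, 1}. (\<lambda>t. \<pi> (phi M m (plane_point d t (a, b)))) ` {-1..1})"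
      by (intro negligible_Union finite_imageI) auto
    then show ?thesis by (simp add: edge_skeleton_def image_UN image_Un image_image)
  qed
  moreover
  \<comment> \<open>Lift of a point of the plane to the graph.\<close>
  define Z where "Z y = (vector [fst y, snd y, \<gamma> y] :: real^3)" for y :: "real \<times> real"
  have Z_eq: "Z y = fst y *\<^sub>R axis 1 1 + snd y *\<^sub>R axis 2 1 + \<gamma> y *\<^sub>R axis 3 1" for y
    by (simp add: Z_def vec_eq_iff forall_3 axis_def)
  define S where "S = {y. norm (Z y) < min \<delta> r}"
  have "open S"
    unfolding S_def Z_eq using cont by (intro open_Collect_less continuous_intros) auto
  moreover have "(0, 0) \<in> S" using r \<open>0 < \<delta>\<close> g0 by (simp add: S_def Z_eq)
  ultimately obtain y where y: "y \<in> S" "y \<notin> (\<Union>m. \<pi> ` phi M m ` edge_skeleton)"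
    using open_not_negligible[of S] negligible_subset by blast
  let ?w = "x + R (Z y)"
  have nz: "norm (Z y) < r" "norm (Z y) < \<delta>" using y by (auto simp: S_def)
  have "?w \<notin> Omega M" using chart[OF nz(1)] by (simp add: Z_def)
  moreover have "?w \<in> closure (Omega M)"
    unfolding closure_approachable
  proof safe
    fix e :: real assume "0 < e"
    \<comment> \<open>An upward shift off the graph enters \<Omega>; the second bound keeps the
      shifted point inside the chart.\<close>
    define t where "t = min (e / 2) ((r - norm (Z y)) / 2)"
    have t: "0 < t" "t < e" "t < r - norm (Z y)" using nz \<open>0 < e\<close> by (auto simp: t_def min_def)
    have "norm (Z y + t *\<^sub>R axis 3 1) < r"
      using norm_triangle_ineq[of "Z y" "t *\<^sub>R axis 3 1"] t by (simp add: norm_axis_1)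
    then have "x + R (Z y + t *\<^sub>R axis 3 1) \<in> Omega M"
      using chart t by (simp add: Z_def axis_def)
    moreover have "dist (x + R (Z y + t *\<^sub>R axis 3 1)) ?w = t"
      using t orthogonal_transformation_norm[OF R, of "axis 3 1"]
      by (simp add: dist_norm linear_add[OF lin] linear_cmul[OF lin] norm_axis_1)
    ultimately show "\<exists>v\<in>Omega M. dist v ?w < e" using t by metis
  qed
  ultimately have "?w \<in> frontier (Omega M)" using open_Omega by (simp add: frontier_def interior_open)
  moreover have "dist ?w x < \<delta>" using nz orthogonal_transformation_norm[OF R] by (simp add: dist_norm)
  moreover have "?w \<notin> phi M m ` edge_skeleton" for m
  proof
    assume "?w \<in> phi M m ` edge_skeleton"
    then have "\<pi> ?w \<in> (\<Union>m. \<pi> ` phi M m ` edge_skeleton)" by blast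
    moreover have "\<pi> ?w = y" by (simp add: \<pi> Z_def)
    ultimately show False using y by simp
  qed
  ultimately show ?thesis using that by blast
qed

lemma finite_bfaces: "finite (bfaces M)"
  by (rule finite_subset[of _ "UNIV \<times> UNIV \<times> {-1, 1}"]) (auto simp: bfaces_def)

text \<open>The boundary faces form a finite family of compact sets, so their union is closed and it
  suffices to approximate \<open>x\<close> by frontier points off the element edges. Such a point is
  not interior to an element, so it comes from an open cube face, to which
  \<open>open_face_on_frontier\<close> applies.\<close>

lemma frontier_subset_bfaces:
  assumes x: "x \<in> frontier (Omega M)"
  shows "\<exists>(m, n, s)\<in>bfaces M. x \<in> phi M m ` cube_face n s"
proof -
  let ?B = "\<Union>(m, n, s)\<in>bfaces M. phi M m ` cube_face n s"
  have cf: "compact (cube_face n s)" for n s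
  proof -
    have "cube_face n s = refK \<inter> {\<xi>. \<xi> $ n = s}" by (auto simp: cube_face_def)
    then show ?thesis
      using compact_refK by (auto intro!: compact_Int_closed closed_Collect_eq continuous_intros)
  qed
  have "closed (phi M m ` cube_face n s)" for m n s
    by (intro compact_imp_closed compact_continuous_image continuous_on_subset[OF continuous_on_phi_refK] cube_face_subset cf)
  then have "closed ?B" using finite_bfaces by (intro closed_UN) auto
  moreover have "x \<in> closure ?B"
    unfolding closure_approachable
  proof safe
    fix \<delta> :: real assume "0 < \<delta>"
    then obtain w where w: "w \<in> frontier (Omega M)" "dist w x < \<delta>" "\<And>m. w \<notin> phi M m ` edge_skeleton"
      using frontier_approach_off_edges[OF x] by blast
    then have "w \<in> closure (Omega M)" by (simp add: frontier_def)
    then obtain m \<xi> where \<xi>: "\<xi> \<in> refK" "w = phi M m \<xi>" by (auto simp: closure_Omega elem_def)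
    then have "\<xi> \<notin> interior refK" using frontier_interior_elem[OF w(1), of m] by (auto simp: interior_elem)
    moreover have "\<xi> \<notin> edge_skeleton" using \<xi> w(3) by blast
    ultimately obtain n s where ns: "s \<in> {-1, 1}" "\<xi> \<in> open_face n s" using not_edge_skeleton \<xi>(1) by blast
    then have "(m, n, s) \<in> bfaces M" using open_face_on_frontier w(1) \<xi>(2) by blast
    moreover have "w \<in> phi M m ` cube_face n s" using ns open_face_subset \<xi> by blast
    ultimately show "\<exists>y\<in>?B. dist y x < \<delta>" using w(2) by blast
  qed
  ultimately show ?thesis by auto
qed

end

section \<open>Pullback of the discrete fields\<close>

lemma matrix_inv:
  assumes "invertible A"
  shows "A ** matrix_inv A = mat 1" "matrix_inv A ** A = mat 1"
proof -
  have "A ** matrix_inv A = mat 1 \<and> matrix_inv A ** A = mat 1"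
    unfolding matrix_inv_def by (rule someI_ex) (use assms in \<open>simp add: invertible_def\<close>)
  then show "A ** matrix_inv A = mat 1" "matrix_inv A ** A = mat 1" by auto
qed

context mesh
begin

lemma refK_nbhd [simp]: "\<xi> \<in> refK \<Longrightarrow> \<xi> \<in> nbhd m"
  using refK_subset_nbhd by blast

lemma jac_phi_mult: "\<xi> \<in> nbhd m \<Longrightarrow> jac (phi M m) \<xi> *v v = (\<Sum>i\<in>UNIV. (v $ i) *\<^sub>R partial (phi M m) \<xi> i)"
  by (rule jac_mult[OF phi_differentiable])

lemma jac_phi_axis: "\<xi> \<in> nbhd m \<Longrightarrow> jac (phi M m) \<xi> *v axis i 1 = partial (phi M m) \<xi> i"
  by (rule jac_axis[OF phi_differentiable])

lemma area_vector_partial: "\<xi> \<in> nbhd m \<Longrightarrow>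
    area_vector M m n \<xi> = cross3 (partial (phi M m) \<xi> (n + 1)) (partial (phi M m) \<xi> (n + 2))"
  by (simp add: area_vector_def jac_phi_axis)

lemma det_jac_pos: "\<xi> \<in> refK \<Longrightarrow> 0 < det (jac (phi M m) \<xi>)"
  using element_map_phi by (simp add: element_map_def)

text \<open>The area vectors are the cofactor columns of the Jacobian: divided by its determinant,
  they form the basis dual to the partial derivatives of \<open>phi\<close>. Both Piola transforms
  are inverted through this duality.\<close>

lemma partial_inner_area_vector:
  assumes "\<xi> \<in> nbhd m"
  shows "partial (phi M m) \<xi> i \<bullet> area_vector M m n \<xi> = (if i = n then det (jac (phi M m) \<xi>) else 0)"
proof (cases "i = n")
  case True
  then show ?thesis using det_columns[of "jac (phi M m) \<xi>" n] assms by (simp add: area_vector_partial jac_phi_axis)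
next
  case False
  then have "i = n + 1 \<or> i = n + 2" using UNIV_3_cyclic[of n] by blast
  then show ?thesis using False assms by (auto simp: area_vector_partial dot_cross_self)
qed

lemma jac_phi_surj:
  assumes "\<xi> \<in> refK"
  obtains a where "w = (\<Sum>i\<in>UNIV. (a $ i) *\<^sub>R partial (phi M m) \<xi> i)"
proof -
  have "invertible (jac (phi M m) \<xi>)"
    using det_jac_pos[OF assms, of m] by (simp add: invertible_det_nz)
  then have "jac (phi M m) \<xi> *v (matrix_inv (jac (phi M m) \<xi>) *v w) = w"
    by (simp add: matrix_vector_mul_assoc matrix_inv)
  then show ?thesis using that jac_phi_mult[of \<xi> m] assms by (metis refK_nbhd)
qed

lemma eq_if_inner_partial_eq:
  assumes \<xi>: "\<xi> \<in> refK" and eq: "\<And>i. w \<bullet> partial (phi M m) \<xi> i = w' \<bullet> partial (phi M m) \<xi> i"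
  shows "w = w'"
proof -
  obtain a where "w - w' = (\<Sum>i\<in>UNIV. (a $ i) *\<^sub>R partial (phi M m) \<xi> i)" using jac_phi_surj[OF \<xi>] .
  then have "(w - w') \<bullet> (w - w') = (\<Sum>i\<in>UNIV. a $ i * ((w - w') \<bullet> partial (phi M m) \<xi> i))"
    by (metis (no_types, lifting) inner_scaleR_right inner_sum_right sum.cong)
  moreover have "(w - w') \<bullet> partial (phi M m) \<xi> i = 0" for i using eq by (simp add: inner_diff_left)
  ultimately show ?thesis by simp
qed

lemma inner_area_vector_expansion:
  assumes "\<xi> \<in> nbhd m"
  shows "(\<Sum>i\<in>UNIV. (a i) *\<^sub>R partial (phi M m) \<xi> i) \<bullet> area_vector M m n \<xi> = a n * det (jac (phi M m) \<xi>)"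
  using assms by (simp add: inner_sum_left partial_inner_area_vector if_distrib cong: if_cong)

lemma eq_if_inner_area_vector_eq:
  assumes \<xi>: "\<xi> \<in> refK" and eq: "\<And>n. w \<bullet> area_vector M m n \<xi> = w' \<bullet> area_vector M m n \<xi>"
  shows "w = w'"
proof -
  obtain a where a: "w - w' = (\<Sum>i\<in>UNIV. (a $ i) *\<^sub>R partial (phi M m) \<xi> i)" using jac_phi_surj[OF \<xi>] .
  have "a $ n * det (jac (phi M m) \<xi>) = (w - w') \<bullet> area_vector M m n \<xi>" for n
    using inner_area_vector_expansion[of \<xi> m "\<lambda>i. a $ i" n] \<xi> a by simp
  then have "a $ n = 0" for n using eq det_jac_pos[OF \<xi>, of m] by (simp add: inner_diff_left)
  then show ?thesis using a by simp
qed

lemma spaceG_pullback: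
  assumes "p \<in> spaceG M"
  obtains q where "q \<in> refG (pdeg M)" "\<And>\<xi>. \<xi> \<in> refK \<Longrightarrow> p m (phi M m \<xi>) = q \<xi>"
  using assms unfolding spaceG_def by blast

text \<open>Pairing with the tangent vectors J e_i undoes the factor J^-T and leaves the polynomial
  components, so the integrands of \<open>dof1\<close> are polynomial.\<close>

lemma spaceC_pullback:
  assumes "c \<in> spaceC M"
  obtains v where "v \<in> refC (pdeg M)" "\<And>\<xi> i. \<xi> \<in> refK \<Longrightarrow> c m (phi M m \<xi>) \<bullet> partial (phi M m) \<xi> i = v \<xi> $ i"
proof -
  obtain v where v: "v \<in> refC (pdeg M)"
    "\<And>\<xi>. \<xi> \<in> refK \<Longrightarrow> c m (phi M m \<xi>) = transpose (matrix_inv (jac (phi M m) \<xi>)) *v v \<xi>"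
    using assms unfolding spaceC_def by blast
  have "c m (phi M m \<xi>) \<bullet> partial (phi M m) \<xi> i = v \<xi> $ i" if \<xi>: "\<xi> \<in> refK" for \<xi> i
  proof -
    have "invertible (jac (phi M m) \<xi>)" using det_jac_pos[OF \<xi>, of m] by (simp add: invertible_det_nz)
    then have "matrix_inv (jac (phi M m) \<xi>) *v partial (phi M m) \<xi> i = axis i 1"
      using \<xi> by (simp add: jac_phi_axis[symmetric] matrix_vector_mul_assoc matrix_inv)
    then show ?thesis
      using v(2)[OF \<xi>] by (simp add: transpose_matrix_vector dot_lmul_matrix inner_axis)
  qed
  then show ?thesis using that v(1) by blast
qed

text \<open>Pairing with the area vectors undoes the factor J / det J, so the integrands of
  \<open>dof2\<close> are polynomial as well.\<close>

lemma spaceD_pullback: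
  assumes "q \<in> spaceD M"
  obtains u where "u \<in> refD (pdeg M)" "\<And>\<xi> n. \<xi> \<in> refK \<Longrightarrow> q m (phi M m \<xi>) \<bullet> area_vector M m n \<xi> = u \<xi> $ n"
proof -
  obtain u where u: "u \<in> refD (pdeg M)"
    "\<And>\<xi>. \<xi> \<in> refK \<Longrightarrow> q m (phi M m \<xi>) = (1 / det (jac (phi M m) \<xi>)) *\<^sub>R (jac (phi M m) \<xi> *v u \<xi>)"
    using assms unfolding spaceD_def by blast
  have "q m (phi M m \<xi>) \<bullet> area_vector M m n \<xi> = u \<xi> $ n" if \<xi>: "\<xi> \<in> refK" for \<xi> n
    using u(2)[OF \<xi>] det_jac_pos[OF \<xi>, of m] inner_area_vector_expansion[of \<xi> m "\<lambda>i. u \<xi> $ i" n] \<xi>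
    by (simp add: jac_phi_mult)
  then show ?thesis using that u(1) by blast
qed

text \<open>Members of the broken spaces can jump to 0 at the surface of their element, so
  differentiability there is asserted of a function \<open>f'\<close> that agrees with
  \<open>f\<close> on the closed element.\<close>

definition smooth_on_elem :: "'m \<Rightarrow> (real^3 \<Rightarrow> 'b::real_normed_vector) \<Rightarrow> bool" where
  "smooth_on_elem m f \<longleftrightarrow> (\<exists>f'. \<forall>x\<in>elem M m. f' differentiable (at x) \<and> f x = f' x)"

lemma smooth_on_elemI:
  assumes "\<And>x. x \<in> elem M m \<Longrightarrow> f' differentiable (at x)" "\<And>\<xi>. \<xi> \<in> refK \<Longrightarrow> f (phi M m \<xi>) = f' (phi M m \<xi>)"
  shows "smooth_on_elem m f"
  using assms unfolding smooth_on_elem_def elem_def by blast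

lemma smooth_on_elem_continuous:
  assumes "smooth_on_elem m f"
  shows "continuous_on (elem M m) f"
proof -
  obtain f' where f': "\<And>x. x \<in> elem M m \<Longrightarrow> f' differentiable (at x)" "\<And>x. x \<in> elem M m \<Longrightarrow> f x = f' x"
    using assms unfolding smooth_on_elem_def by blast
  have "continuous_on (elem M m) f'"
    using f'(1) by (auto intro!: continuous_at_imp_continuous_on differentiable_imp_continuous_within)
  then show ?thesis using f'(2) by (simp cong: continuous_on_cong)
qed

lemma smooth_on_elem_differentiable:
  assumes "smooth_on_elem m f" "x \<in> interior (elem M m)"
  shows "f differentiable (at x)"
proof -
  obtain f' where f': "\<And>x. x \<in> elem M m \<Longrightarrow> f' differentiable (at x)" "\<And>x. x \<in> elem M m \<Longrightarrow> f x = f' x"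
    using assms unfolding smooth_on_elem_def by blast
  show ?thesis
    by (rule differentiable_transform_open[OF open_interior assms(2), of f'])
       (use f' assms(2) interior_subset in blast)+
qed

lemma smooth_on_elem_sum:
  assumes "\<And>k. k \<in> S \<Longrightarrow> smooth_on_elem m (f k)" "finite S"
  shows "smooth_on_elem m (\<lambda>x. \<Sum>k\<in>S. a k *\<^sub>R f k x)"
proof -
  have "\<forall>k\<in>S. \<exists>f'. \<forall>x\<in>elem M m. f' differentiable (at x) \<and> f k x = f' x"
    using assms unfolding smooth_on_elem_def by blast
  then obtain f' where f': "\<And>k x. k \<in> S \<Longrightarrow> x \<in> elem M m \<Longrightarrow> f' k differentiable (at x) \<and> f k x = f' k x"
    by metis
  then show ?thesis
    unfolding smooth_on_elem_def
    using assms(2) by (intro exI[of _ "\<lambda>x. \<Sum>k\<in>S. a k *\<^sub>R f' k x"] ballI conjI differentiable_sum differentiable_scaleR)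
       (auto intro!: sum.cong)
qed

lemma inv_phi_elem: "x \<in> elem M m \<Longrightarrow> inv_phi m x \<in> refK" "x \<in> elem M m \<Longrightarrow> phi M m (inv_phi m x) = x"
  by (auto simp: elem_def inv_phi_phi)

lemma elem_subset_chart_image: "elem M m \<subseteq> chart_image m"
  using refK_subset_nbhd by (auto simp: elem_def)

lemma differentiable_compose_inv_phi:
  assumes "x \<in> elem M m" "f differentiable (at (inv_phi m x))"
  shows "(\<lambda>x. f (inv_phi m x)) differentiable (at x)"
  by (rule differentiable_compose[where f = f and g = "inv_phi m", OF assms(2)]) (use inv_phi_differentiable elem_subset_chart_image assms in blast)

lemma det_jac_differentiable:
  assumes "\<xi> \<in> nbhd m"
  shows "(\<lambda>\<xi>. det (jac (phi M m) \<xi>)) differentiable (at \<xi>)"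
proof (rule differentiable_transform_open[OF open_nbhd assms])
  show "(\<lambda>\<xi>. partial (phi M m) \<xi> 1 \<bullet> cross3 (partial (phi M m) \<xi> 2) (partial (phi M m) \<xi> 3)) differentiable (at \<xi>)"
    by (intro differentiable_inner differentiable_cross3 partial_phi_differentiable assms)
  show "det (jac (phi M m) \<zeta>) = partial (phi M m) \<zeta> 1 \<bullet> cross3 (partial (phi M m) \<zeta> 2) (partial (phi M m) \<zeta> 3)"
    if "\<zeta> \<in> nbhd m" for \<zeta>
    using det_columns[of "jac (phi M m) \<zeta>" 1] that by (simp add: jac_phi_axis)
qed

lemma area_vector_differentiable:
  assumes "\<xi> \<in> nbhd m"
  shows "area_vector M m n differentiable (at \<xi>)"
  by (rule differentiable_transform_open[OF open_nbhd assms _ area_vector_partial])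
     (intro differentiable_cross3 partial_phi_differentiable assms)

lemma smooth_on_elem_compose_inv_phi:
  assumes "\<And>\<xi>. \<xi> \<in> refK \<Longrightarrow> g differentiable (at \<xi>)" "\<And>\<xi>. \<xi> \<in> refK \<Longrightarrow> f (phi M m \<xi>) = g \<xi>"
  shows "smooth_on_elem m f"
  by (rule smooth_on_elemI[of m "\<lambda>x. g (inv_phi m x)"])
     (simp_all add: differentiable_compose_inv_phi inv_phi_elem assms inv_phi_phi)

lemma spaceG_smooth: "p \<in> spaceG M \<Longrightarrow> smooth_on_elem m (p m)"
  by (metis spaceG_pullback refG_def smooth_on_elem_compose_inv_phi tensor_differentiable)

lemma spaceS_smooth:
  assumes "s \<in> spaceS M"
  shows "smooth_on_elem m (s m)"
proof -
  obtain g where g: "g \<in> refS (pdeg M)" "\<And>\<xi>. \<xi> \<in> refK \<Longrightarrow> s m (phi M m \<xi>) = (1 / det (jac (phi M m) \<xi>)) * g \<xi>"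
    using assms unfolding spaceS_def by blast
  show ?thesis
  proof (rule smooth_on_elem_compose_inv_phi)
    fix \<xi> assume \<xi>: "\<xi> \<in> refK"
    show "(\<lambda>\<xi>. (1 / det (jac (phi M m) \<xi>)) * g \<xi>) differentiable (at \<xi>)"
      using \<xi> g(1) det_jac_pos[OF \<xi>, of m]
      by (intro differentiable_mult differentiable_divide differentiable_const det_jac_differentiable)
         (auto simp: refS_def intro: tensor_differentiable)
  qed (use g in simp)
qed

text \<open>The factor J^-T is expanded in area vectors divided by the determinant, which reduces
  differentiability to that of the partial derivatives of \<open>phi\<close>.\<close>

lemma spaceC_smooth:
  assumes "c \<in> spaceC M"
  shows "smooth_on_elem m (c m)"
proof -
  obtain v where v: "v \<in> refC (pdeg M)" "\<And>\<xi> i. \<xi> \<in> refK \<Longrightarrow> c m (phi M m \<xi>) \<bullet> partial (phi M m) \<xi> i = v \<xi> $ i"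
    using spaceC_pullback[OF assms] by blast
  show ?thesis
  proof (rule smooth_on_elem_compose_inv_phi)
    fix \<xi> assume \<xi>: "\<xi> \<in> refK"
    show "(\<lambda>\<xi>. \<Sum>i\<in>UNIV. (v \<xi> $ i / det (jac (phi M m) \<xi>)) *\<^sub>R area_vector M m i \<xi>) differentiable (at \<xi>)"
      using \<xi> det_jac_pos[OF \<xi>, of m] polynomial_field_nth_differentiable[OF polynomial_field_refC[OF v(1)]]
      by (intro differentiable_sum ballI differentiable_scaleR differentiable_divide det_jac_differentiable area_vector_differentiable) auto
    show "c m (phi M m \<xi>) = (\<Sum>i\<in>UNIV. (v \<xi> $ i / det (jac (phi M m) \<xi>)) *\<^sub>R area_vector M m i \<xi>)"
    proof (rule eq_if_inner_partial_eq[OF \<xi>])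
      fix j
      have "(\<Sum>i\<in>UNIV. (v \<xi> $ i / det (jac (phi M m) \<xi>)) *\<^sub>R area_vector M m i \<xi>) \<bullet> partial (phi M m) \<xi> j =
        (\<Sum>i\<in>UNIV. (v \<xi> $ i / det (jac (phi M m) \<xi>)) * (if j = i then det (jac (phi M m) \<xi>) else 0))"
        using \<xi> by (simp add: inner_sum_left inner_commute[of "area_vector M m _ \<xi>"] partial_inner_area_vector)
      also have "\<dots> = v \<xi> $ j"
        using det_jac_pos[OF \<xi>, of m]
        by (simp add: if_distrib[of "\<lambda>a. _ * a"] if_distrib[of "\<lambda>a. a / _"] cong: if_cong)
      finally show "c m (phi M m \<xi>) \<bullet> partial (phi M m) \<xi> j =
        (\<Sum>i\<in>UNIV. (v \<xi> $ i / det (jac (phi M m) \<xi>)) *\<^sub>R area_vector M m i \<xi>) \<bullet> partial (phi M m) \<xi> j"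
        using v(2)[OF \<xi>] by simp
    qed
  qed
qed

lemma spaceD_smooth:
  assumes "q \<in> spaceD M"
  shows "smooth_on_elem m (q m)"
proof -
  obtain u where u: "u \<in> refD (pdeg M)" "\<And>\<xi> n. \<xi> \<in> refK \<Longrightarrow> q m (phi M m \<xi>) \<bullet> area_vector M m n \<xi> = u \<xi> $ n"
    using spaceD_pullback[OF assms] by blast
  show ?thesis
  proof (rule smooth_on_elem_compose_inv_phi)
    fix \<xi> assume \<xi>: "\<xi> \<in> refK"
    show "(\<lambda>\<xi>. \<Sum>i\<in>UNIV. (u \<xi> $ i / det (jac (phi M m) \<xi>)) *\<^sub>R partial (phi M m) \<xi> i) differentiable (at \<xi>)"
      using \<xi> det_jac_pos[OF \<xi>, of m] polynomial_field_nth_differentiable[OF polynomial_field_refD[OF u(1)]]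
      by (intro differentiable_sum ballI differentiable_scaleR differentiable_divide det_jac_differentiable partial_phi_differentiable) auto
    show "q m (phi M m \<xi>) = (\<Sum>i\<in>UNIV. (u \<xi> $ i / det (jac (phi M m) \<xi>)) *\<^sub>R partial (phi M m) \<xi> i)"
      by (rule eq_if_inner_area_vector_eq[OF \<xi>, of _ m])
         (use \<xi> det_jac_pos[OF \<xi>, of m] u(2) in \<open>simp add: inner_area_vector_expansion\<close>)
  qed
qed

section \<open>Degrees of freedom\<close>

lemma gll_strict_mono: "i < j \<Longrightarrow> j \<le> pdeg M \<Longrightarrow> gll M i < gll M j"
  and gll_first: "gll M 0 = -1" and gll_last: "gll M (pdeg M) = 1"
  using meshed by (auto simp: meshed_domain_def gll_nodes_def strict_mono_on_def)

lemma gll_mono: "i \<le> j \<Longrightarrow> j \<le> pdeg M \<Longrightarrow> gll M i \<le> gll M j"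
  using gll_strict_mono[of i j] by (cases "i = j") (auto simp: less_imp_le)

lemma abs_gll_le: "i \<le> pdeg M \<Longrightarrow> \<bar>gll M i\<bar> \<le> 1"
  using gll_mono[of 0 i] gll_mono[of i "pdeg M"] gll_first gll_last by auto

lemma ref_indexD: "ref_index N I A \<Longrightarrow> I d \<le> N" "ref_index N I A \<Longrightarrow> d \<in> A \<Longrightarrow> I d < N"
  unfolding ref_index_def by (metis less_imp_le)+

lemma ref_cell_subset_refK:
  assumes "ref_index (pdeg M) I A"
  shows "ref_cell (gll M) I A \<subseteq> refK"
proof
  fix x assume "x \<in> ref_cell (gll M) I A"
  then have x: "gll M (I d) \<le> x $ d" "x $ d \<le> (if d \<in> A then gll M (Suc (I d)) else gll M (I d))" for d
    by (simp_all add: ref_cell_def mem_box_cart)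
  have "\<bar>x $ d\<bar> \<le> 1" for d
    using x[of d] abs_gll_le[of "I d"] abs_gll_le[of "Suc (I d)"] ref_indexD[OF assms, of d]
    by (auto split: if_splits)
  then show "x \<in> refK" by (simp add: mem_refK)
qed

text \<open>\<open>owner\<close> chooses among possibly several parametrizations of the same point
  set; all that is retained is that the chosen one is valid.\<close>

lemma ownerE:
  assumes "X \<in> cells M k"
  obtains m I A where "owner M k X = (m, I, A)" "ref_index (pdeg M) I A" "card A = k"
    "X = phi M m ` ref_cell (gll M) I A"
proof -
  obtain m I A where owner: "owner M k X = (m, I, A)" by (cases "owner M k X")
  have "\<exists>p. case p of (m, I, A) \<Rightarrow> ref_index (pdeg M) I A \<and> card A = k \<and> X = phi M m ` ref_cell (gll M) I A"
    using assms by (auto simp: cells_def)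
  from someI_ex[OF this] show ?thesis
    using that[OF owner] unfolding owner_def[symmetric] owner by simp
qed

lemma finite_cells: "finite (cells M k)"
proof -
  have "finite {I :: 3 \<Rightarrow> nat. \<forall>d. I d \<le> pdeg M}"
    using finite_PiE[of "UNIV :: 3 set" "\<lambda>_. {..pdeg M}"] by (simp add: PiE_def Pi_def extensional_def)
  then have "finite ((\<lambda>(m, I, A). phi M m ` ref_cell (gll M) I A) ` (UNIV \<times> {I. \<forall>d. I d \<le> pdeg M} \<times> UNIV))"
    by (intro finite_imageI finite_cartesian_product) auto
  moreover have "cells M k \<subseteq> (\<lambda>(m, I, A). phi M m ` ref_cell (gll M) I A) ` (UNIV \<times> {I. \<forall>d. I d \<le> pdeg M} \<times> UNIV)"
    unfolding cells_def using ref_indexD(1) by fastforce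
  ultimately show ?thesis by (rule finite_subset[rotated])
qed

lemma bcells_subset: "bcells M k \<subseteq> cells M k"
  by (auto simp: bcells_def)

lemma finite_bcells: "finite (bcells M k)"
  by (rule finite_subset[OF bcells_subset finite_cells])

end

lemma integrable_on_compact_continuous:
  fixes f :: "'a::euclidean_space \<Rightarrow> 'b::euclidean_space"
  assumes "compact S" "continuous_on S f"
  shows "f integrable_on S"
proof -
  have "set_integrable lborel S f"
    unfolding set_integrable_def by (rule borel_integrable_compact[OF assms])
  then show ?thesis by (rule set_borel_integral_eq_integral)
qed

lemma integral_lincomb:
  fixes f :: "'c \<Rightarrow> 'a::euclidean_space \<Rightarrow> real"
  assumes "finite J" "\<And>Y. Y \<in> J \<Longrightarrow> f Y integrable_on S"
  shows "integral S (\<lambda>x. \<Sum>Y\<in>J. a Y * f Y x) = (\<Sum>Y\<in>J. a Y * integral S (f Y))"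
  using assms by (subst integral_sum) (auto intro: integrable_on_mult_right)

context mesh
begin

section \<open>Linear combinations of fields and their degrees of freedom\<close>

lemma spaceC_expand:
  assumes J: "finite J" and \<psi>: "\<And>Y. Y \<in> J \<Longrightarrow> \<psi> Y \<in> spaceC M"
  shows "expand J \<psi> a \<in> spaceC M"
  unfolding spaceC_def mem_Collect_eq
proof (intro conjI allI)
  show "broken M (expand J \<psi> a)"
    using \<psi> by (auto simp: broken_def expand_def spaceC_def)
  have t: "tangentially_continuous M (\<psi> Y)" if "Y \<in> J" for Y using \<psi>[OF that] by (simp add: spaceC_def)
  show "tangentially_continuous M (expand J \<psi> a)"
    unfolding tangentially_continuous_def expand_def inner_sum_left inner_scaleR_left
    by (intro allI ballI impI sum.cong refl) (use t in \<open>auto simp: tangentially_continuous_def\<close>)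
  fix m
  have "\<forall>Y\<in>J. \<exists>v. v \<in> refC (pdeg M) \<and> (\<forall>\<xi>\<in>refK. \<psi> Y m (phi M m \<xi>) = transpose (matrix_inv (jac (phi M m) \<xi>)) *v v \<xi>)"
    using \<psi> unfolding spaceC_def by blast
  then obtain v where v: "\<And>Y. Y \<in> J \<Longrightarrow> v Y \<in> refC (pdeg M)"
    "\<And>Y \<xi>. Y \<in> J \<Longrightarrow> \<xi> \<in> refK \<Longrightarrow> \<psi> Y m (phi M m \<xi>) = transpose (matrix_inv (jac (phi M m) \<xi>)) *v v Y \<xi>"
    by metis
  show "\<exists>v\<in>refC (pdeg M). \<forall>\<xi>\<in>refK. expand J \<psi> a m (phi M m \<xi>) = transpose (matrix_inv (jac (phi M m) \<xi>)) *v v \<xi>"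
    by (rule bexI[OF _ refC_sum[OF J v(1), of _ a]])
       (simp_all add: expand_def v(2) linear_sum[OF matrix_vector_mul_linear] linear_cmul[OF matrix_vector_mul_linear])
qed

lemma spaceD_expand:
  assumes J: "finite J" and \<psi>: "\<And>Y. Y \<in> J \<Longrightarrow> \<psi> Y \<in> spaceD M"
  shows "expand J \<psi> a \<in> spaceD M"
  unfolding spaceD_def mem_Collect_eq
proof (intro conjI allI)
  show "broken M (expand J \<psi> a)"
    using \<psi> by (auto simp: broken_def expand_def spaceD_def)
  have t: "normally_continuous M (\<psi> Y)" if "Y \<in> J" for Y using \<psi>[OF that] by (simp add: spaceD_def)
  show "normally_continuous M (expand J \<psi> a)"
    unfolding normally_continuous_def expand_def inner_sum_left inner_scaleR_left
    by (intro allI ballI impI sum.cong refl) (use t in \<open>auto simp: normally_continuous_def\<close>)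
  fix m
  have "\<forall>Y\<in>J. \<exists>v. v \<in> refD (pdeg M) \<and> (\<forall>\<xi>\<in>refK. \<psi> Y m (phi M m \<xi>) = (1 / det (jac (phi M m) \<xi>)) *\<^sub>R (jac (phi M m) \<xi> *v v \<xi>))"
    using \<psi> unfolding spaceD_def by blast
  then obtain v where v: "\<And>Y. Y \<in> J \<Longrightarrow> v Y \<in> refD (pdeg M)"
    "\<And>Y \<xi>. Y \<in> J \<Longrightarrow> \<xi> \<in> refK \<Longrightarrow> \<psi> Y m (phi M m \<xi>) = (1 / det (jac (phi M m) \<xi>)) *\<^sub>R (jac (phi M m) \<xi> *v v Y \<xi>)"
    by metis
  show "\<exists>v\<in>refD (pdeg M). \<forall>\<xi>\<in>refK. expand J \<psi> a m (phi M m \<xi>) = (1 / det (jac (phi M m) \<xi>)) *\<^sub>R (jac (phi M m) \<xi> *v v \<xi>)"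
    by (rule bexI[OF _ refD_sum[OF J v(1), of _ a]])
       (simp_all add: expand_def v(2) linear_sum[OF matrix_vector_mul_linear] linear_cmul[OF matrix_vector_mul_linear]
         scaleR_sum_right mult.commute)
qed

definition grid_point :: "(3 \<Rightarrow> nat) \<Rightarrow> real^3" where
  "grid_point I = (\<chi> d. gll M (I d))"

lemma edge_point: "(\<chi> j. if j = d then t else gll M (I j)) = grid_point I + (t - gll M (I d)) *\<^sub>R axis d 1"
  by (simp add: vec_eq_iff grid_point_def axis_def)

lemma edge_point_mem:
  "t \<in> {gll M (I d)..gll M (Suc (I d))} \<Longrightarrow> (\<chi> j. if j = d then t else gll M (I j)) \<in> ref_cell (gll M) I {d}"
  by (auto simp: ref_cell_def mem_box_cart)

lemma face_point_mem:
  assumes "y \<in> cbox (gll M (I (n+1)), gll M (I (n+2))) (gll M (Suc (I (n+1))), gll M (Suc (I (n+2))))"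
  shows "plane_point n (gll M (I n)) y \<in> ref_cell (gll M) I (- {n})"
proof -
  have "j = n + 2" if "j \<noteq> n" "j \<noteq> n + 1" for j using UNIV_3_cyclic[of n] that by blast
  then show ?thesis
    using assms by (cases y) (auto simp: ref_cell_def mem_box_cart plane_point_def cbox_Pair_eq)
qed

lemma edge_ownerE:
  assumes "X \<in> cells M 1"
  obtains m I d where "owner M 1 X = (m, I, {d})" "ref_index (pdeg M) I {d}" "X = phi M m ` ref_cell (gll M) I {d}"
  using ownerE[OF assms] by (metis card_1_singletonE)

lemma face_ownerE:
  assumes "X \<in> cells M 2"
  obtains m I n where "owner M 2 X = (m, I, - {n})" "ref_index (pdeg M) I (- {n})" "X = phi M m ` ref_cell (gll M) I (- {n})"
proof -
  obtain m I A where *: "owner M 2 X = (m, I, A)" "ref_index (pdeg M) I A" "card A = 2" "X = phi M m ` ref_cell (gll M) I A"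
    using ownerE[OF assms] .
  have "card (- A) = 1" using *(3) card_Diff_subset[of A UNIV] by (simp add: Compl_eq_Diff_UNIV)
  then obtain n where "- A = {n}" by (metis card_1_singletonE)
  then have "A = - {n}" by blast
  then show ?thesis using * that by blast
qed

lemma dof1_pullback:
  assumes "owner M 1 X = (m, I, {d})" "ref_index (pdeg M) I {d}"
    and "\<And>\<xi>. \<xi> \<in> refK \<Longrightarrow> c m (phi M m \<xi>) \<bullet> partial (phi M m) \<xi> d = w \<xi>"
  shows "dof1 M c X = orient M X * integral {gll M (I d)..gll M (Suc (I d))} (\<lambda>t. w (\<chi> j. if j = d then t else gll M (I j)))"
proof -
  have "(\<chi> j. if j = d then t else gll M (I j)) \<in> refK" if "t \<in> {gll M (I d)..gll M (Suc (I d))}" for t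
    using edge_point_mem[of t I d, OF that] ref_cell_subset_refK[OF assms(2)] by blast
  then show ?thesis
    unfolding dof1_def assms(1) by (auto simp: Let_def jac_phi_axis assms(3) intro!: integral_cong)
qed

lemma dof2_pullback:
  assumes "owner M 2 X = (m, I, - {n})" "ref_index (pdeg M) I (- {n})"
    and "\<And>\<xi>. \<xi> \<in> refK \<Longrightarrow> q m (phi M m \<xi>) \<bullet> area_vector M m n \<xi> = w \<xi>"
  shows "dof2 M q X = orient M X *
    integral (cbox (gll M (I (n+1)), gll M (I (n+2))) (gll M (Suc (I (n+1))), gll M (Suc (I (n+2)))))
      (\<lambda>y. w (plane_point n (gll M (I n)) y))"
proof -
  have "plane_point n (gll M (I n)) y \<in> refK"
    if "y \<in> cbox (gll M (I (n+1)), gll M (I (n+2))) (gll M (Suc (I (n+1))), gll M (Suc (I (n+2))))" for y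
    using face_point_mem[of y I n, OF that] ref_cell_subset_refK[OF assms(2)] by blast
  then show ?thesis
    unfolding dof2_def assms(1) by (auto simp: Let_def assms(3) intro!: integral_cong)
qed

lemma continuous_on_edge_point:
  "continuous_on S (\<lambda>t. (\<chi> j. if j = d then t else gll M (I j)) :: real^3)"
  unfolding edge_point by (intro continuous_intros)

text \<open>The owner depends on \<open>X\<close> alone, so all terms are integrated along the same
  parametrized edge; the polynomial pullbacks supply the integrability that linearity of the
  integral requires.\<close>

lemma dof1_expand:
  assumes J: "finite J" and \<psi>: "\<And>Y. Y \<in> J \<Longrightarrow> \<psi> Y \<in> spaceC M" and X: "X \<in> cells M 1"
  shows "dof1 M (expand J \<psi> a) X = (\<Sum>Y\<in>J. a Y * dof1 M (\<psi> Y) X)"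
proof -
  obtain m I d where o: "owner M 1 X = (m, I, {d})" "ref_index (pdeg M) I {d}" using edge_ownerE[OF X] by blast
  have "\<forall>Y\<in>J. \<exists>v. v \<in> refC (pdeg M) \<and> (\<forall>\<xi>\<in>refK. \<psi> Y m (phi M m \<xi>) \<bullet> partial (phi M m) \<xi> d = v \<xi> $ d)"
    using spaceC_pullback[OF \<psi>] by metis
  then obtain v where v: "\<And>Y. Y \<in> J \<Longrightarrow> v Y \<in> refC (pdeg M)"
    "\<And>Y \<xi>. Y \<in> J \<Longrightarrow> \<xi> \<in> refK \<Longrightarrow> \<psi> Y m (phi M m \<xi>) \<bullet> partial (phi M m) \<xi> d = v Y \<xi> $ d" by metis
  let ?S = "{gll M (I d)..gll M (Suc (I d))}" let ?\<gamma> = "\<lambda>t. \<chi> j. if j = d then t else gll M (I j)"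
  have "(\<lambda>t. v Y (?\<gamma> t) $ d) integrable_on ?S" if "Y \<in> J" for Y
    by (intro integrable_continuous_interval continuous_on_edge_point
        continuous_on_compose2[OF polynomial_field_nth_continuous_on[OF polynomial_field_refC[OF v(1)[OF that]], of UNIV]]) auto
  then have "integral ?S (\<lambda>t. \<Sum>Y\<in>J. a Y * v Y (?\<gamma> t) $ d) = (\<Sum>Y\<in>J. a Y * integral ?S (\<lambda>t. v Y (?\<gamma> t) $ d))"
    by (rule integral_lincomb[OF J])
  moreover have "dof1 M (expand J \<psi> a) X = orient M X * integral ?S (\<lambda>t. \<Sum>Y\<in>J. a Y * v Y (?\<gamma> t) $ d)"
    by (rule dof1_pullback[OF o]) (simp add: expand_def inner_sum_left v(2))
  moreover have "dof1 M (\<psi> Y) X = orient M X * integral ?S (\<lambda>t. v Y (?\<gamma> t) $ d)" if "Y \<in> J" for Y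
    by (rule dof1_pullback[OF o]) (rule v(2)[OF that])
  ultimately show ?thesis by (simp add: sum_distrib_left mult.left_commute)
qed

lemma dof2_expand:
  assumes J: "finite J" and \<psi>: "\<And>Y. Y \<in> J \<Longrightarrow> \<psi> Y \<in> spaceD M" and X: "X \<in> cells M 2"
  shows "dof2 M (expand J \<psi> a) X = (\<Sum>Y\<in>J. a Y * dof2 M (\<psi> Y) X)"
proof -
  obtain m I n where o: "owner M 2 X = (m, I, - {n})" "ref_index (pdeg M) I (- {n})" using face_ownerE[OF X] by blast
  have "\<forall>Y\<in>J. \<exists>v. v \<in> refD (pdeg M) \<and> (\<forall>\<xi>\<in>refK. \<psi> Y m (phi M m \<xi>) \<bullet> area_vector M m n \<xi> = v \<xi> $ n)"
    using spaceD_pullback[OF \<psi>] by metis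
  then obtain v where v: "\<And>Y. Y \<in> J \<Longrightarrow> v Y \<in> refD (pdeg M)"
    "\<And>Y \<xi>. Y \<in> J \<Longrightarrow> \<xi> \<in> refK \<Longrightarrow> \<psi> Y m (phi M m \<xi>) \<bullet> area_vector M m n \<xi> = v Y \<xi> $ n" by metis
  let ?S = "cbox (gll M (I (n+1)), gll M (I (n+2))) (gll M (Suc (I (n+1))), gll M (Suc (I (n+2))))"
  let ?\<gamma> = "\<lambda>y. plane_point n (gll M (I n)) y"
  have "(\<lambda>t. v Y (?\<gamma> t) $ n) integrable_on ?S" if "Y \<in> J" for Y
    by (intro integrable_continuous continuous_on_plane_point continuous_on_id
        continuous_on_compose2[OF polynomial_field_nth_continuous_on[OF polynomial_field_refD[OF v(1)[OF that]], of UNIV]]) auto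
  then have "integral ?S (\<lambda>t. \<Sum>Y\<in>J. a Y * v Y (?\<gamma> t) $ n) = (\<Sum>Y\<in>J. a Y * integral ?S (\<lambda>t. v Y (?\<gamma> t) $ n))"
    by (rule integral_lincomb[OF J])
  moreover have "dof2 M (expand J \<psi> a) X = orient M X * integral ?S (\<lambda>t. \<Sum>Y\<in>J. a Y * v Y (?\<gamma> t) $ n)"
    by (rule dof2_pullback[OF o]) (simp add: expand_def inner_sum_left v(2))
  moreover have "dof2 M (\<psi> Y) X = orient M X * integral ?S (\<lambda>t. v Y (?\<gamma> t) $ n)" if "Y \<in> J" for Y
    by (rule dof2_pullback[OF o]) (rule v(2)[OF that])
  ultimately show ?thesis by (simp add: sum_distrib_left mult.left_commute)
qed

text \<open>\<open>dof3\<close> integrates over the physical cell, so integrability comes from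
  continuity on the closed element instead of a polynomial pullback.\<close>

lemma dof3_expand:
  assumes J: "finite J" and \<psi>: "\<And>Y. Y \<in> J \<Longrightarrow> \<psi> Y \<in> spaceS M" and X: "X \<in> cells M 3"
  shows "dof3 M (expand J \<psi> a) X = (\<Sum>Y\<in>J. a Y * dof3 M (\<psi> Y) X)"
proof -
  obtain m I A where o: "owner M 3 X = (m, I, A)" "ref_index (pdeg M) I A" "X = phi M m ` ref_cell (gll M) I A"
    using ownerE[OF X] by metis
  have sub: "X \<subseteq> elem M m" using ref_cell_subset_refK[OF o(2)] o(3) by (auto simp: elem_def)
  have "compact X"
    unfolding o(3) using ref_cell_subset_refK[OF o(2)]
    by (intro compact_continuous_image continuous_on_subset[OF continuous_on_phi_refK]) (auto simp: ref_cell_def)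
  then have "\<psi> Y m integrable_on X" if "Y \<in> J" for Y
    by (intro integrable_on_compact_continuous continuous_on_subset[OF _ sub] smooth_on_elem_continuous spaceS_smooth \<psi> that)
  then have "integral X (\<lambda>x. \<Sum>Y\<in>J. a Y * \<psi> Y m x) = (\<Sum>Y\<in>J. a Y * integral X (\<psi> Y m))"
    by (rule integral_lincomb[OF J])
  then show ?thesis by (simp add: dof3_def o(1) expand_def)
qed

end

section \<open>Line integrals\<close>

lemma integral_unit_interval_affine:
  fixes f :: "real \<Rightarrow> real"
  assumes h: "0 < h" and f: "continuous_on {c..c + h} f"
  shows "integral {0..1} (\<lambda>t. h * f (c + t * h)) = integral {c..c + h} f"
proof -
  have "(f has_integral integral {c..c + h} f) (cbox c (c + h))"
    using integrable_integral[OF integrable_continuous_interval[OF f]] by (simp add: cbox_interval)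
  from has_integral_affinity[OF this, of h c] h
  have "((\<lambda>t. f (h * t + c)) has_integral (1 / h) * integral {c..c + h} f) ((\<lambda>x. x / h - c / h) ` cbox c (c + h))"
    by simp
  moreover have "(\<lambda>x. x / h - c / h) ` cbox c (c + h) = {0..1}"
  proof -
    have "t \<in> (\<lambda>x. x / h - c / h) ` {c..c + h}" if "t \<in> {0..1}" for t
      using that h by (intro image_eqI[of _ _ "c + t * h"]) (auto simp: field_simps mult_left_le)
    moreover have "x / h - c / h \<in> {0..1}" if "x \<in> {c..c + h}" for x
      using that h by (auto simp: field_simps)
    ultimately show ?thesis by (auto simp: cbox_interval simp del: atLeastAtMost_iff)
  qed
  ultimately have "((\<lambda>t. h * f (h * t + c)) has_integral h * ((1 / h) * integral {c..c + h} f)) {0..1}"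
    by (intro has_integral_mult_right) simp
  then show ?thesis using h by (intro integral_unique) (simp add: ac_simps)
qed

lemma integral_unit_interval_reverse:
  fixes f :: "real \<Rightarrow> real"
  shows "integral {0..1} (\<lambda>t. f (1 - t)) = integral {0..1} f"
proof -
  have *: "((\<lambda>t. f (1 - t)) has_integral i) {0..1}" if "(f has_integral i) {0..1}" for f :: "real \<Rightarrow> real" and i
  proof -
    have "(\<lambda>x. - x + 1) ` {0..1} = {0..1::real}"
      by (auto intro!: image_eqI[of _ _ "1 - _"])
    then show ?thesis
      using has_integral_affinity[of f i 0 1 "-1" 1] that by (simp add: cbox_interval)
  qed
  show ?thesis
  proof (cases "f integrable_on {0..1}")
    case True
    then show ?thesis using * by (metis has_integral_integral integral_unique)
  next
    \<comment> \<open>The integral of a non-integrable function is 0 by convention, and reflection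
      preserves non-integrability.\<close>
    case False
    moreover have "\<not> (\<lambda>t. f (1 - t)) integrable_on {0..1}"
      using False *[of "\<lambda>t. f (1 - t)"] by (auto simp: integrable_on_def)
    ultimately show ?thesis by (simp add: not_integrable_integral)
  qed
qed

lemma eq_on_closure:
  fixes f g :: "'a::topological_space \<Rightarrow> 'b::real_normed_vector"
  assumes "continuous_on (closure S) f" "continuous_on (closure S) g" "\<And>x. x \<in> S \<Longrightarrow> f x = g x" "x \<in> closure S"
  shows "f x = g x"
proof -
  have "(\<lambda>x. f x - g x) ` closure S \<subseteq> {0}"
    by (rule image_closure_subset) (use assms in \<open>auto intro!: continuous_intros\<close>)
  then show ?thesis using assms(4) by auto
qed

context mesh
begin

lemma eq_on_refK:
  fixes f g :: "real^3 \<Rightarrow> 'b::real_normed_vector"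
  assumes "continuous_on refK f" "continuous_on refK g" "\<And>x. x \<in> interior refK \<Longrightarrow> f x = g x" "x \<in> refK"
  shows "f x = g x"
  using eq_on_closure[of "interior refK" f g x] assms by (simp add: closure_interior_refK)

text \<open>Circulation along the image of the segment from \<open>a\<close> to \<open>b\<close>,
  seen from element \<open>m\<close>. Endpoints replace the grid indices of \<open>dof1\<close>, so
  that a symmetry of the cube acts by moving \<open>a\<close> and \<open>b\<close>.\<close>

definition line_integral :: "'m \<Rightarrow> ('m, real^3) bfun \<Rightarrow> real^3 \<Rightarrow> real^3 \<Rightarrow> real" where
  "line_integral m c a b = integral {0..1}
     (\<lambda>t. c m (phi M m (a + t *\<^sub>R (b - a))) \<bullet> (jac (phi M m) (a + t *\<^sub>R (b - a)) *v (b - a)))"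

lemma line_integral_reverse: "line_integral m c b a = - line_integral m c a b"
proof -
  have pt: "b + t *\<^sub>R (a - b) = a + (1 - t) *\<^sub>R (b - a)" for t by (simp add: algebra_simps)
  have neg: "jac (phi M m) \<xi> *v (a - b) = - (jac (phi M m) \<xi> *v (b - a))" for \<xi>
    by (simp add: matrix_vector_mult_diff_distrib)
  have "line_integral m c b a = - integral {0..1} (\<lambda>t. c m (phi M m (a + (1 - t) *\<^sub>R (b - a))) \<bullet>
      (jac (phi M m) (a + (1 - t) *\<^sub>R (b - a)) *v (b - a)))"
    unfolding line_integral_def pt neg by simp
  also have "\<dots> = - line_integral m c a b"
    unfolding line_integral_def
    using integral_unit_interval_reverse[of "\<lambda>t. c m (phi M m (a + t *\<^sub>R (b - a))) \<bullet> (jac (phi M m) (a + t *\<^sub>R (b - a)) *v (b - a))"]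
    by simp
  finally show ?thesis .
qed

lemma has_vector_derivative_phi_line:
  assumes "a + t *\<^sub>R v \<in> nbhd m"
  shows "((\<lambda>t. phi M m (a + t *\<^sub>R v)) has_vector_derivative jac (phi M m) (a + t *\<^sub>R v) *v v) (at t)"
proof -
  have "((\<lambda>t. a + t *\<^sub>R v) has_derivative (\<lambda>h. h *\<^sub>R v)) (at t)"
    by (auto intro!: derivative_eq_intros)
  from has_derivative_compose[OF this differentiable_has_derivative_partial[OF phi_differentiable[OF assms]]]
  have "((\<lambda>t. phi M m (a + t *\<^sub>R v)) has_derivative (\<lambda>h. jac (phi M m) (a + t *\<^sub>R v) *v (h *\<^sub>R v))) (at t)"
    by (simp add: jac_phi_mult[OF assms])
  then show ?thesis by (simp add: has_vector_derivative_def matrix_vector_mult_scaleR)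
qed

text \<open>On the common face the two parametrized curves coincide, hence so do their velocities,
  and tangential continuity exchanges the field of one element for that of the other. The endpoints
  are left out of the comparison, which does not change the integral.\<close>

lemma line_integral_transfer:
  assumes c: "c \<in> spaceC M" and F: "F face_of refK" and \<sigma>: "orthogonal_transformation \<sigma>" "\<sigma> ` refK = refK"
    and img: "phi M m ` F \<subseteq> elem M n" and glue: "\<And>\<xi>. \<xi> \<in> F \<Longrightarrow> phi M m \<xi> = phi M n (\<sigma> \<xi>)"
    and ab: "a \<in> F" "b \<in> F"
  shows "line_integral m c a b = line_integral n c (\<sigma> a) (\<sigma> b)"
proof -
  have lin: "linear \<sigma>" by (rule orthogonal_transformation_linear[OF \<sigma>(1)])
  have \<sigma>_line: "\<sigma> (a + t *\<^sub>R (b - a)) = \<sigma> a + t *\<^sub>R (\<sigma> b - \<sigma> a)" for t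
    by (simp add: linear_add[OF lin] linear_cmul[OF lin] linear_diff[OF lin])
  have line_F: "a + t *\<^sub>R (b - a) \<in> F" if "0 \<le> t" "t \<le> 1" for t
  proof -
    have "a + t *\<^sub>R (b - a) = (1 - t) *\<^sub>R a + t *\<^sub>R b" by (simp add: algebra_simps)
    then show ?thesis using convexD[OF face_of_imp_convex[OF F] ab, of "1 - t" t] that by simp
  qed
  have F_refK: "F \<subseteq> refK" by (rule face_of_imp_subset[OF F])
  have "c m (phi M m (a + t *\<^sub>R (b - a))) \<bullet> (jac (phi M m) (a + t *\<^sub>R (b - a)) *v (b - a)) =
    c n (phi M n (\<sigma> a + t *\<^sub>R (\<sigma> b - \<sigma> a))) \<bullet> (jac (phi M n) (\<sigma> a + t *\<^sub>R (\<sigma> b - \<sigma> a)) *v (\<sigma> b - \<sigma> a))"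
    if t: "t \<in> {0<..<1}" for t
  proof -
    let ?\<xi> = "a + t *\<^sub>R (b - a)"
    have \<xi>: "?\<xi> \<in> F" using line_F t by simp
    then have \<xi>K: "?\<xi> \<in> refK" "\<sigma> ?\<xi> \<in> refK" using F_refK \<sigma>(2) by blast+
    \<comment> \<open>Tangential continuity is stated for differences of interface points. With
      \<eta> = b the difference is (1 - t) (b - a), and t < 1 permits division.\<close>
    have "c m (phi M m ?\<xi>) \<bullet> (jac (phi M m) ?\<xi> *v (b - ?\<xi>)) = c n (phi M m ?\<xi>) \<bullet> (jac (phi M m) ?\<xi> *v (b - ?\<xi>))"
      using c \<xi> ab img F_refK unfolding spaceC_def tangentially_continuous_def by blast
    moreover have "b - ?\<xi> = (1 - t) *\<^sub>R (b - a)" by (simp add: algebra_simps)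
    ultimately have "c m (phi M m ?\<xi>) \<bullet> (jac (phi M m) ?\<xi> *v (b - a)) = c n (phi M m ?\<xi>) \<bullet> (jac (phi M m) ?\<xi> *v (b - a))"
      using t by (simp only: matrix_vector_mult_scaleR inner_scaleR_right) simp
    \<comment> \<open>The Jacobians of the two elements are not related in all directions. The
      curves agree near an interior parameter, so uniqueness of the derivative equates the
      velocities.\<close>
    moreover have "jac (phi M m) ?\<xi> *v (b - a) = jac (phi M n) (\<sigma> ?\<xi>) *v (\<sigma> b - \<sigma> a)"
    proof (rule vector_derivative_unique_at)
      show "((\<lambda>t. phi M m (a + t *\<^sub>R (b - a))) has_vector_derivative jac (phi M m) ?\<xi> *v (b - a)) (at t)"
        by (rule has_vector_derivative_phi_line) (use \<xi>K in simp)
      have "((\<lambda>t. phi M n (\<sigma> a + t *\<^sub>R (\<sigma> b - \<sigma> a))) has_vector_derivative jac (phi M n) (\<sigma> ?\<xi>) *v (\<sigma> b - \<sigma> a)) (at t)"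
        unfolding \<sigma>_line by (rule has_vector_derivative_phi_line) (use \<xi>K \<sigma>_line in simp)
      then show "((\<lambda>t. phi M m (a + t *\<^sub>R (b - a))) has_vector_derivative jac (phi M n) (\<sigma> ?\<xi>) *v (\<sigma> b - \<sigma> a)) (at t)"
        by (rule has_vector_derivative_transform_within_open[OF _ open_greaterThanLessThan t])
           (use glue line_F \<sigma>_line in auto)
    qed
    ultimately show ?thesis using glue[OF \<xi>] \<sigma>_line by simp
  qed
  then have "integral {0<..<1} (\<lambda>t. c m (phi M m (a + t *\<^sub>R (b - a))) \<bullet> (jac (phi M m) (a + t *\<^sub>R (b - a)) *v (b - a))) =
    integral {0<..<1} (\<lambda>t. c n (phi M n (\<sigma> a + t *\<^sub>R (\<sigma> b - \<sigma> a))) \<bullet> (jac (phi M n) (\<sigma> a + t *\<^sub>R (\<sigma> b - \<sigma> a)) *v (\<sigma> b - \<sigma> a)))"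
    by (rule integral_cong)
  then show ?thesis by (simp add: line_integral_def integral_open_interval_real)
qed

lemma ref_cell_edge:
  assumes "ref_index (pdeg M) I {d}"
  shows "ref_cell (gll M) I {d} = closed_segment (grid_point I) (grid_point (I(d := Suc (I d))))"
proof -
  let ?h = "gll M (Suc (I d)) - gll M (I d)"
  have h: "0 < ?h" using gll_strict_mono[of "I d" "Suc (I d)"] ref_indexD(2)[OF assms, of d] by simp
  have line: "(1 - u) *\<^sub>R grid_point I + u *\<^sub>R grid_point (I(d := Suc (I d))) =
      (\<chi> j. if j = d then gll M (I d) + u * ?h else gll M (I j))" for u
    by (simp add: vec_eq_iff grid_point_def algebra_simps)
  show ?thesis
  proof (intro equalityI subsetI)
    fix x assume x: "x \<in> ref_cell (gll M) I {d}"
    have xd: "gll M (I d) \<le> x $ d" "x $ d \<le> gll M (Suc (I d))" and xj: "\<And>j. j \<noteq> d \<Longrightarrow> x $ j = gll M (I j)"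
      using x by (auto simp: ref_cell_def mem_box_cart split: if_splits intro: antisym)
    have "x = (1 - (x $ d - gll M (I d)) / ?h) *\<^sub>R grid_point I + ((x $ d - gll M (I d)) / ?h) *\<^sub>R grid_point (I(d := Suc (I d)))"
      unfolding line using xj h by (auto simp: vec_eq_iff)
    moreover have "0 \<le> (x $ d - gll M (I d)) / ?h" "(x $ d - gll M (I d)) / ?h \<le> 1"
      using xd h by auto
    ultimately show "x \<in> closed_segment (grid_point I) (grid_point (I(d := Suc (I d))))"
      unfolding in_segment by blast
  next
    fix x assume "x \<in> closed_segment (grid_point I) (grid_point (I(d := Suc (I d))))"
    then obtain u where u: "0 \<le> u" "u \<le> 1" and x: "x = (\<chi> j. if j = d then gll M (I d) + u * ?h else gll M (I j))"
      unfolding in_segment line by blast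
    have "0 \<le> u * ?h" "u * ?h \<le> ?h" using u h by (simp_all add: mult_left_le_one_le)
    then show "x \<in> ref_cell (gll M) I {d}"
      unfolding x by (auto simp: ref_cell_def mem_box_cart)
  qed
qed

text \<open>Substitution from the unit interval to the grid interval; the factor \<open>h\<close> is
  the speed of the segment along axis \<open>d\<close>.\<close>

lemma edge_line_integral:
  assumes I: "ref_index (pdeg M) I {d}" and v: "polynomial_field v"
    and pull: "\<And>\<xi>. \<xi> \<in> refK \<Longrightarrow> c m (phi M m \<xi>) \<bullet> partial (phi M m) \<xi> d = v \<xi> $ d"
  shows "line_integral m c (grid_point I) (grid_point (I(d := Suc (I d)))) =
    integral {gll M (I d)..gll M (Suc (I d))} (\<lambda>t. v (\<chi> j. if j = d then t else gll M (I j)) $ d)"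
proof -
  define h where "h = gll M (Suc (I d)) - gll M (I d)"
  have h: "0 < h" using gll_strict_mono[of "I d" "Suc (I d)"] ref_indexD(2)[OF I, of d] by (simp add: h_def)
  define f where "f t = v (\<chi> j. if j = d then t else gll M (I j)) $ d" for t
  have diff: "grid_point (I(d := Suc (I d))) - grid_point I = h *\<^sub>R axis d 1"
    by (simp add: vec_eq_iff grid_point_def axis_def h_def)
  have "line_integral m c (grid_point I) (grid_point (I(d := Suc (I d)))) = integral {0..1} (\<lambda>t. h * f (gll M (I d) + t * h))"
    unfolding line_integral_def
  proof (rule integral_cong)
    fix t :: real assume t: "t \<in> {0..1}"
    have pt: "grid_point I + t *\<^sub>R (grid_point (I(d := Suc (I d))) - grid_point I) =
        (\<chi> j. if j = d then gll M (I d) + t * h else gll M (I j))" (is "?x = _")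
      unfolding diff by (simp add: vec_eq_iff grid_point_def axis_def)
    have "?x = (1 - t) *\<^sub>R grid_point I + t *\<^sub>R grid_point (I(d := Suc (I d)))" by (simp add: algebra_simps)
    then have "?x \<in> ref_cell (gll M) I {d}" unfolding ref_cell_edge[OF I] in_segment using t by auto
    then have "?x \<in> refK" using ref_cell_subset_refK[OF I] by blast
    then have "c m (phi M m ?x) \<bullet> (jac (phi M m) ?x *v (h *\<^sub>R axis d 1)) = h * v ?x $ d"
      by (simp add: matrix_vector_mult_scaleR jac_phi_axis pull)
    then show "c m (phi M m ?x) \<bullet> (jac (phi M m) ?x *v (grid_point (I(d := Suc (I d))) - grid_point I)) = h * f (gll M (I d) + t * h)"
      unfolding diff[symmetric] f_def pt by simp
  qed
  also have "\<dots> = integral {gll M (I d)..gll M (I d) + h} f"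
    unfolding f_def
    by (intro integral_unit_interval_affine h continuous_on_edge_point
        continuous_on_compose2[OF polynomial_field_nth_continuous_on[OF v, of UNIV]]) auto
  finally show ?thesis by (simp add: h_def f_def[abs_def])
qed

lemma abs_orient: "\<bar>orient M X\<bar> = 1"
proof -
  have "orient M X \<in> {-1, 1}" using meshed by (simp add: meshed_domain_def)
  then show ?thesis by auto
qed

text \<open>The degree of freedom refers to the owner of the edge, which may be another element and
  may traverse the edge in the opposite direction, and it carries the sign \<open>orient\<close>.
  These choices affect only the sign, so the absolute value suffices to transfer the vanishing of a
  degree of freedom.\<close>

lemma abs_line_integral:
  assumes c: "c \<in> spaceC M" and X: "X \<in> cells M 1"
    and ab: "a \<in> refK" "b \<in> refK" "X = phi M m ` closed_segment a b"
  shows "\<bar>line_integral m c a b\<bar> = \<bar>dof1 M c X\<bar>"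
proof -
  obtain n I d where o: "owner M 1 X = (n, I, {d})" and I: "ref_index (pdeg M) I {d}"
    and Xn: "X = phi M n ` ref_cell (gll M) I {d}" using edge_ownerE[OF X] .
  obtain v where v: "v \<in> refC (pdeg M)" "\<And>\<xi> i. \<xi> \<in> refK \<Longrightarrow> c n (phi M n \<xi>) \<bullet> partial (phi M n) \<xi> i = v \<xi> $ i"
    using spaceC_pullback[OF c] by blast
  define a' b' where "a' = grid_point I" and "b' = grid_point (I(d := Suc (I d)))"
  have "line_integral n c a' b' = integral {gll M (I d)..gll M (Suc (I d))} (\<lambda>t. v (\<chi> j. if j = d then t else gll M (I j)) $ d)"
    unfolding a'_def b'_def by (rule edge_line_integral[OF I polynomial_field_refC[OF v(1)]]) (rule v(2))
  then have "dof1 M c X = orient M X * line_integral n c a' b'"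
    using dof1_pullback[OF o I, of c "\<lambda>\<xi>. v \<xi> $ d"] v(2) by simp
  then have dof: "\<bar>line_integral n c a' b'\<bar> = \<bar>dof1 M c X\<bar>" by (simp add: abs_mult abs_orient)
  have seg': "closed_segment a' b' \<subseteq> refK" "X = phi M n ` closed_segment a' b'"
    using ref_cell_subset_refK[OF I] Xn ref_cell_edge[OF I] by (auto simp: a'_def b'_def)
  have seg: "closed_segment a b \<subseteq> refK" by (rule closed_segment_subset[OF ab(1,2) convex_refK])
  \<comment> \<open>As a point set, a segment determines its endpoints only up to order.\<close>
  have swap: "\<bar>line_integral n c e f\<bar> = \<bar>dof1 M c X\<bar>" if "closed_segment e f = closed_segment a' b'" for e f
  proof -
    have "{e, f} = {a', b'}" using that by simp
    then have "e = a' \<and> f = b' \<or> e = b' \<and> f = a'" by (auto simp: doubleton_eq_iff)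
    moreover have "\<bar>line_integral n c b' a'\<bar> = \<bar>dof1 M c X\<bar>" by (subst line_integral_reverse) (simp add: dof)
    ultimately show ?thesis using dof by blast
  qed
  show ?thesis
  proof (cases "m = n")
    case True
    then have "closed_segment a b = closed_segment a' b'"
      using inj_on_image_eq_iff[OF inj_on_phi_refK[of n] seg seg'(1)] ab(3) seg'(2) by blast
    then show ?thesis using swap True by simp
  next
    case False
    obtain F \<sigma> where F: "F face_of refK" and \<sigma>: "orthogonal_transformation \<sigma>" "\<sigma> ` refK = refK"
      and img: "phi M m ` F = elem M m \<inter> elem M n" and glue: "\<And>\<xi>. \<xi> \<in> F \<Longrightarrow> phi M m \<xi> = phi M n (\<sigma> \<xi>)"
      and iff: "\<And>\<xi>. \<xi> \<in> refK \<Longrightarrow> phi M m \<xi> \<in> elem M n \<longleftrightarrow> \<xi> \<in> F"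
      using conformingE[OF False] by metis
    have "X \<subseteq> elem M n" using seg' by (auto simp: elem_def)
    then have segF: "closed_segment a b \<subseteq> F" using iff seg ab(3) by blast
    then have "phi M n ` \<sigma> ` closed_segment a b = phi M n ` closed_segment a' b'"
      using glue ab(3) seg'(2) by (metis (no_types, lifting) image_cong image_image subsetD)
    moreover have "\<sigma> ` closed_segment a b \<subseteq> refK" using seg \<sigma>(2) by blast
    ultimately have "\<sigma> ` closed_segment a b = closed_segment a' b'"
      using inj_on_image_eq_iff[OF inj_on_phi_refK _ seg'(1)] by blast
    then have "closed_segment (\<sigma> a) (\<sigma> b) = closed_segment a' b'"
      by (simp add: closed_segment_linear_image[OF orthogonal_transformation_linear[OF \<sigma>(1)]])
    moreover have "line_integral m c a b = line_integral n c (\<sigma> a) (\<sigma> b)"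
      by (rule line_integral_transfer[OF c F \<sigma> _ glue]) (use img segF in auto)
    ultimately show ?thesis using swap by simp
  qed
qed

lemma edge_integral_zero:
  assumes c: "c \<in> spaceC M" and I: "ref_index (pdeg M) I {d}" and X: "dof1 M c (phi M m ` ref_cell (gll M) I {d}) = 0"
    and v: "polynomial_field v" and pull: "\<And>\<xi>. \<xi> \<in> refK \<Longrightarrow> c m (phi M m \<xi>) \<bullet> partial (phi M m) \<xi> d = v \<xi> $ d"
  shows "integral {gll M (I d)..gll M (Suc (I d))} (\<lambda>t. v (\<chi> j. if j = d then t else gll M (I j)) $ d) = 0"
proof -
  have "phi M m ` ref_cell (gll M) I {d} \<in> cells M 1"
    unfolding cells_def using I by force
  moreover have "grid_point I \<in> refK" "grid_point (I(d := Suc (I d))) \<in> refK"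
    using ref_cell_subset_refK[OF I] unfolding ref_cell_edge[OF I] by auto
  ultimately show ?thesis
    using abs_line_integral[OF c _ _ _ arg_cong[OF ref_cell_edge[OF I], of "image (phi M m)"]] X
      edge_line_integral[where c = c and m = m and v = v, OF I v pull] by simp
qed

section \<open>Gradient, curl and divergence in reference coordinates\<close>

lemma phi_interior: "\<xi> \<in> interior refK \<Longrightarrow> phi M m \<xi> \<in> interior (elem M m)"
  by (simp add: interior_elem)

text \<open>The comparison takes place in the interior of the cube, an open set on which
  \<open>partial_cong\<close> may replace the composite by its polynomial representative.\<close>

lemma gradient_reference:
  assumes p: "p differentiable (at (phi M m \<xi>))" and P: "\<And>\<zeta>. \<zeta> \<in> interior refK \<Longrightarrow> p (phi M m \<zeta>) = P \<zeta>"
    and \<xi>: "\<xi> \<in> interior refK"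
  shows "gradient p (phi M m \<xi>) \<bullet> partial (phi M m) \<xi> i = partial P \<xi> i"
proof -
  have "partial P \<xi> i = partial (\<lambda>\<zeta>. p (phi M m \<zeta>)) \<xi> i"
    by (rule partial_cong[OF open_interior \<xi>]) (simp add: P)
  also have "\<dots> = (\<Sum>j\<in>UNIV. (partial (phi M m) \<xi> i $ j) *\<^sub>R partial p (phi M m \<xi>) j)"
    using \<xi> interior_refK_subset_nbhd by (intro partial_chain p phi_differentiable) blast
  finally show ?thesis by (simp add: gradient_def inner_vec_def mult.commute)
qed

lemma curl_reference:
  assumes c: "c differentiable (at (phi M m \<xi>))" and \<xi>: "\<xi> \<in> interior refK"
    and v: "\<And>\<zeta> i. \<zeta> \<in> interior refK \<Longrightarrow> c (phi M m \<zeta>) \<bullet> partial (phi M m) \<zeta> i = v \<zeta> $ i"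
  shows "curl c (phi M m \<xi>) \<bullet> area_vector M m n \<xi> =
    partial (\<lambda>\<zeta>. v \<zeta> $ (n + 2)) \<xi> (n + 1) - partial (\<lambda>\<zeta>. v \<zeta> $ (n + 1)) \<xi> (n + 2)"
proof -
  have \<xi>': "\<xi> \<in> nbhd m" using \<xi> interior_refK_subset_nbhd by blast
  have "partial (\<lambda>\<zeta>. c (phi M m \<zeta>) \<bullet> partial (phi M m) \<zeta> i) \<xi> j = partial (\<lambda>\<zeta>. v \<zeta> $ i) \<xi> j" for i j
    by (rule partial_cong[OF open_interior \<xi>]) (rule v)
  then show ?thesis
    using curl_pullback[OF open_nbhd \<xi>' C2_phi c] by (simp add: area_vector_partial[OF \<xi>'])
qed

lemma divergence_reference:
  assumes q: "q differentiable (at (phi M m \<xi>))" and \<xi>: "\<xi> \<in> interior refK"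
    and u: "\<And>\<zeta> n. \<zeta> \<in> interior refK \<Longrightarrow> q (phi M m \<zeta>) \<bullet> area_vector M m n \<zeta> = u \<zeta> n"
  shows "divergence q (phi M m \<xi>) * det (jac (phi M m) \<xi>) = (\<Sum>n\<in>UNIV. partial (\<lambda>\<zeta>. u \<zeta> n) \<xi> n)"
proof -
  have \<xi>': "\<xi> \<in> nbhd m" using \<xi> interior_refK_subset_nbhd by blast
  have "partial (\<lambda>\<zeta>. q (phi M m \<zeta>) \<bullet> cross3 (partial (phi M m) \<zeta> (n + 1)) (partial (phi M m) \<zeta> (n + 2))) \<xi> j =
      partial (\<lambda>\<zeta>. u \<zeta> n) \<xi> j" for n j
  proof (rule partial_cong[OF open_interior \<xi>])
    fix \<zeta> assume \<zeta>: "\<zeta> \<in> interior refK"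
    then have "\<zeta> \<in> nbhd m" using interior_refK_subset_nbhd by blast
    then show "q (phi M m \<zeta>) \<bullet> cross3 (partial (phi M m) \<zeta> (n + 1)) (partial (phi M m) \<zeta> (n + 2)) = u \<zeta> n"
      using u[OF \<zeta>, of n] by (simp add: area_vector_partial)
  qed
  then show ?thesis
    using divergence_pullback[OF open_nbhd \<xi>' C2_phi q] det_columns[of "jac (phi M m) \<xi>" 1]
    by (simp add: jac_phi_axis[OF \<xi>'])
qed

text \<open>The incidence relations are given in element interiors only. Continuity carries the zero
  to the closed element, and \<open>broken\<close> covers the points outside.\<close>

lemma zero_if_zero_on_interior:
  fixes f :: "('m, 'b::real_normed_vector) bfun"
  assumes "broken M f" "\<And>m. smooth_on_elem m (f m)" "\<And>m x. x \<in> interior (elem M m) \<Longrightarrow> f m x = 0"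
  shows "f = (\<lambda>m x. 0)"
proof (intro ext)
  fix m x
  show "f m x = 0"
  proof (cases "x \<in> elem M m")
    case True
    have "closure (interior (elem M m)) = elem M m"
      using elem_subset_closure_interior closed_elem by (metis closure_minimal interior_subset subset_antisym)
    then show ?thesis
      using eq_on_closure[of "interior (elem M m)" "f m" "\<lambda>_. 0" x] True assms(3)
        smooth_on_elem_continuous[OF assms(2)] by simp
  next
    case False then show ?thesis using assms(1) by (simp add: broken_def)
  qed
qed

lemma smooth_expand:
  assumes "finite J" "\<And>Y. Y \<in> J \<Longrightarrow> smooth_on_elem m (\<psi> Y m)"
  shows "smooth_on_elem m (expand J \<psi> a m)"
  unfolding expand_def by (rule smooth_on_elem_sum) (use assms in auto)

lemma broken_expand:
  assumes "\<And>Y. Y \<in> J \<Longrightarrow> broken M (\<psi> Y)"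
  shows "broken M (expand J \<psi> a)"
  using assms by (auto simp: broken_def expand_def)

text \<open>Stokes on the small face: the flux of the curl is a signed sum of four edge integrals,
  each of which vanishes by \<open>edge_integral_zero\<close> whatever its sign.\<close>

lemma dof2_curl_zero:
  assumes c: "c \<in> spaceC M" and q: "q \<in> spaceD M" and Y: "Y \<in> cells M 2"
    and curl: "\<And>m x. x \<in> interior (elem M m) \<Longrightarrow> curl (c m) x = q m x"
    and zero: "\<And>X. X \<in> cells M 1 \<Longrightarrow> X \<subseteq> Y \<Longrightarrow> dof1 M c X = 0"
  shows "dof2 M q Y = 0"
proof -
  obtain m I n where o: "owner M 2 Y = (m, I, - {n})" and I: "ref_index (pdeg M) I (- {n})"
    and Y_eq: "Y = phi M m ` ref_cell (gll M) I (- {n})" using face_ownerE[OF Y] .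
  obtain v where v: "v \<in> refC (pdeg M)" "\<And>\<xi> i. \<xi> \<in> refK \<Longrightarrow> c m (phi M m \<xi>) \<bullet> partial (phi M m) \<xi> i = v \<xi> $ i"
    using spaceC_pullback[OF c] by blast
  obtain u where u: "u \<in> refD (pdeg M)" "\<And>\<xi> n. \<xi> \<in> refK \<Longrightarrow> q m (phi M m \<xi>) \<bullet> area_vector M m n \<xi> = u \<xi> $ n"
    using spaceD_pullback[OF q] by blast
  have pv: "polynomial_field v" by (rule polynomial_field_refC[OF v(1)])
  let ?w = "\<lambda>\<xi>. partial (\<lambda>\<zeta>. v \<zeta> $ (n + 2)) \<xi> (n + 1) - partial (\<lambda>\<zeta>. v \<zeta> $ (n + 1)) \<xi> (n + 2)"
  \<comment> \<open>The small face may come from the surface of the cube, where the differential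
    relation is not given, so the identity is extended from the interior by continuity.\<close>
  have flux: "q m (phi M m \<xi>) \<bullet> area_vector M m n \<xi> = ?w \<xi>" if \<xi>: "\<xi> \<in> refK" for \<xi>
  proof -
    have "u \<zeta> $ n = ?w \<zeta>" if \<zeta>: "\<zeta> \<in> interior refK" for \<zeta>
    proof -
      have "\<zeta> \<in> refK" using \<zeta> interior_subset by blast
      have "curl (c m) (phi M m \<zeta>) \<bullet> area_vector M m n \<zeta> = ?w \<zeta>"
        by (rule curl_reference[OF smooth_on_elem_differentiable[OF spaceC_smooth[OF c] phi_interior[OF \<zeta>]] \<zeta>])
           (use v(2) interior_subset in blast)
      then show ?thesis using curl[OF phi_interior[OF \<zeta>]] u(2)[OF \<open>\<zeta> \<in> refK\<close>] by simp
    qed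
    moreover have "continuous_on refK ?w"
      by (rule continuous_on_diff) (rule polynomial_field_partial_continuous_on[OF pv])+
    ultimately have "u \<xi> $ n = ?w \<xi>"
      using eq_on_refK[of "\<lambda>\<xi>. u \<xi> $ n" ?w \<xi>] polynomial_field_nth_continuous_on[OF polynomial_field_refD[OF u(1)]] \<xi>
      by blast
    then show ?thesis using u(2)[OF \<xi>] by simp
  qed
  have le: "gll M (I j) \<le> gll M (Suc (I j))" if "j \<noteq> n" for j
    using gll_mono[of "I j" "Suc (I j)"] ref_indexD(2)[OF I, of j] that by simp
  \<comment> \<open>The edges in direction \<open>d\<close> are the one at \<open>I\<close> and its
    translate by one grid step in the other face direction \<open>e\<close>.\<close>
  have edge: "integral {gll M (J d)..gll M (Suc (J d))} (\<lambda>t. v (\<chi> j. if j = d then t else gll M (J j)) $ d) = 0"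
    if J: "J = I \<or> J = I(e := Suc (I e))" and de: "d \<noteq> n" "e \<noteq> n" "d \<noteq> e" for J d e
  proof (rule edge_integral_zero[OF c _ _ pv])
    show J': "ref_index (pdeg M) J {d}"
      using ref_indexD[OF I] J de unfolding ref_index_def[of _ J] by (auto simp: Suc_le_eq)
    have "ref_cell (gll M) J {d} \<subseteq> ref_cell (gll M) I (- {n})"
    proof
      fix x assume "x \<in> ref_cell (gll M) J {d}"
      then have x: "gll M (J j) \<le> x $ j" "x $ j \<le> (if j = d then gll M (Suc (J j)) else gll M (J j))" for j
        by (simp_all add: ref_cell_def mem_box_cart)
      have "gll M (I j) \<le> x $ j \<and> x $ j \<le> (if j \<in> - {n} then gll M (Suc (I j)) else gll M (I j))" for j
        using x[of j] le[of j] J de by (auto split: if_splits)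
      then show "x \<in> ref_cell (gll M) I (- {n})" by (simp add: ref_cell_def mem_box_cart)
    qed
    then have "phi M m ` ref_cell (gll M) J {d} \<subseteq> Y" unfolding Y_eq by blast
    moreover have "phi M m ` ref_cell (gll M) J {d} \<in> cells M 1"
      unfolding cells_def using J' by force
    ultimately show "dof1 M c (phi M m ` ref_cell (gll M) J {d}) = 0" by (rule zero[rotated])
  qed (use v(2) in blast)
  have cases: "j = n + 2" if "j \<noteq> n" "j \<noteq> n + 1" for j using UNIV_3_cyclic[of n] that by blast
  have pt1: "plane_point n (gll M (I n)) (t, gll M (J (n + 2))) = (\<chi> j. if j = n + 1 then t else gll M (J j))"
    if "J n = I n" for t J using cases that by (auto simp: vec_eq_iff plane_point_def)
  have pt2: "plane_point n (gll M (I n)) (gll M (J (n + 1)), t) = (\<chi> j. if j = n + 2 then t else gll M (J j))"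
    if "J n = I n" for t J using cases that by (auto simp: vec_eq_iff plane_point_def)
  let ?I1 = "I(n + 1 := Suc (I (n + 1)))" and ?I2 = "I(n + 2 := Suc (I (n + 2)))"
  have "dof2 M q Y = orient M Y * integral
      (cbox (gll M (I (n+1)), gll M (I (n+2))) (gll M (Suc (I (n+1))), gll M (Suc (I (n+2)))))
      (\<lambda>y. ?w (plane_point n (gll M (I n)) y))"
    by (rule dof2_pullback[OF o I]) (rule flux)
  also have "\<dots> = 0"
    unfolding stokes_rectangle[OF pv le[OF three_distinct(1)] le[OF three_distinct(2)]]
    using edge[of I "n + 1" "n + 2"] edge[of ?I1 "n + 1" "n + 2"] edge[of I "n + 2" "n + 1"] edge[of ?I2 "n + 2" "n + 1"]
      pt1[of I] pt1[of ?I2] pt2[of I] pt2[of ?I1]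
    by simp
  finally show ?thesis .
qed

lemma spaceG_agree:
  assumes "p \<in> spaceG M" "x \<in> elem M m" "x \<in> elem M n"
  shows "p m x = p n x"
  using assms unfolding spaceG_def by force

text \<open>Global continuity makes the nodal value independent of the element that owns the
  node.\<close>

lemma dof0_node:
  assumes p: "p \<in> spaceG M" and X: "{x} \<in> cells M 0" and x: "x \<in> elem M m"
  shows "dof0 M p {x} = p m x"
proof -
  obtain n I A where o: "owner M 0 {x} = (n, I, A)" "ref_index (pdeg M) I A" "card A = 0"
    "{x} = phi M n ` ref_cell (gll M) I A" using ownerE[OF X] .
  have "A = {}" using o(3) by simp
  then have "ref_cell (gll M) I A = {grid_point I}" by (simp add: ref_cell_def grid_point_def)
  then have "x = phi M n (grid_point I)" "grid_point I \<in> refK"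
    using o(4) ref_cell_subset_refK[OF o(2)] by auto
  then have "dof0 M p {x} = p n x" "x \<in> elem M n"
    using o(1) by (auto simp: dof0_def grid_point_def elem_def)
  then show ?thesis using spaceG_agree[OF p x] by simp
qed

text \<open>Fundamental theorem of calculus on the small edge: the integral is a difference of two
  nodal values, both zero.\<close>

lemma dof1_gradient_zero:
  assumes p: "p \<in> spaceG M" and c: "c \<in> spaceC M" and Y: "Y \<in> cells M 1"
    and grad: "\<And>m x. x \<in> interior (elem M m) \<Longrightarrow> gradient (p m) x = c m x"
    and zero: "\<And>X. X \<in> cells M 0 \<Longrightarrow> X \<subseteq> Y \<Longrightarrow> dof0 M p X = 0"
  shows "dof1 M c Y = 0"
proof -
  obtain m I d where o: "owner M 1 Y = (m, I, {d})" and I: "ref_index (pdeg M) I {d}"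
    and Y_eq: "Y = phi M m ` ref_cell (gll M) I {d}" using edge_ownerE[OF Y] .
  obtain P where P: "P \<in> refG (pdeg M)" "\<And>\<xi>. \<xi> \<in> refK \<Longrightarrow> p m (phi M m \<xi>) = P \<xi>"
    using spaceG_pullback[OF p] by blast
  obtain v where v: "v \<in> refC (pdeg M)" "\<And>\<xi> i. \<xi> \<in> refK \<Longrightarrow> c m (phi M m \<xi>) \<bullet> partial (phi M m) \<xi> i = v \<xi> $ i"
    using spaceC_pullback[OF c] by blast
  have tP: "P \<in> tensor (pdeg M) (pdeg M) (pdeg M)" using P(1) by (simp add: refG_def)
  have slope: "c m (phi M m \<xi>) \<bullet> partial (phi M m) \<xi> d = partial P \<xi> d" if \<xi>: "\<xi> \<in> refK" for \<xi>
  proof -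
    have "v \<zeta> $ d = partial P \<zeta> d" if \<zeta>: "\<zeta> \<in> interior refK" for \<zeta>
    proof -
      have "\<zeta> \<in> refK" using \<zeta> interior_subset by blast
      have "gradient (p m) (phi M m \<zeta>) \<bullet> partial (phi M m) \<zeta> d = partial P \<zeta> d"
        by (rule gradient_reference[OF smooth_on_elem_differentiable[OF spaceG_smooth[OF p] phi_interior[OF \<zeta>]] _ \<zeta>])
           (use P(2) interior_subset in blast)
      then show ?thesis using grad[OF phi_interior[OF \<zeta>]] v(2)[OF \<open>\<zeta> \<in> refK\<close>] by simp
    qed
    then have "v \<xi> $ d = partial P \<xi> d"
      using eq_on_refK[of "\<lambda>\<xi>. v \<xi> $ d" "\<lambda>\<xi>. partial P \<xi> d" \<xi>] polynomial_field_nth_continuous_on[OF polynomial_field_refC[OF v(1)]]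
        tensor_continuous_on[OF tensor_partial[OF tP]] \<xi>
      by blast
    then show ?thesis using v(2)[OF \<xi>] by simp
  qed
  have node: "P (grid_point J) = 0" if J: "J = I \<or> J = I(d := Suc (I d))" for J
  proof -
    have J': "ref_index (pdeg M) J {}"
      using ref_indexD[OF I] J unfolding ref_index_def[of _ J] by (auto simp: Suc_le_eq)
    have cell: "ref_cell (gll M) J {} = {grid_point J}" by (simp add: ref_cell_def grid_point_def)
    have "grid_point J \<in> ref_cell (gll M) I {d}" unfolding ref_cell_edge[OF I] using J by auto
    then have "{phi M m (grid_point J)} \<subseteq> Y" "grid_point J \<in> refK"
      using Y_eq ref_cell_subset_refK[OF I] by auto
    moreover have "{phi M m (grid_point J)} \<in> cells M 0"
      unfolding cells_def using J' cell by force
    ultimately have "p m (phi M m (grid_point J)) = 0"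
      using zero dof0_node[OF p, of "phi M m (grid_point J)" m] by (auto simp: elem_def)
    then show ?thesis using P(2) \<open>grid_point J \<in> refK\<close> by simp
  qed
  have le: "gll M (I d) \<le> gll M (Suc (I d))"
    using gll_mono[of "I d" "Suc (I d)"] ref_indexD(2)[OF I, of d] by simp
  \<comment> \<open>The base point has its coordinate \<open>d\<close> reset to 0, so that the line
    parameter is that coordinate.\<close>
  let ?p = "grid_point I - gll M (I d) *\<^sub>R axis d 1"
  have pt: "(\<chi> j. if j = d then t else gll M (I j)) = ?p + t *\<^sub>R axis d 1" for t
    unfolding edge_point by (simp add: algebra_simps)
  have "dof1 M c Y = orient M Y * integral {gll M (I d)..gll M (Suc (I d))} (\<lambda>t. partial P (\<chi> j. if j = d then t else gll M (I j)) d)"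
    by (rule dof1_pullback[OF o I]) (rule slope)
  also have "\<dots> = orient M Y * (P (?p + gll M (Suc (I d)) *\<^sub>R axis d 1) - P (?p + gll M (I d) *\<^sub>R axis d 1))"
    unfolding pt by (subst ftc_axis_line[OF le tensor_differentiable[OF tP]]) simp
  also have "?p + gll M (Suc (I d)) *\<^sub>R axis d 1 = grid_point (I(d := Suc (I d)))"
    by (simp add: vec_eq_iff grid_point_def axis_def)
  also have "?p + gll M (I d) *\<^sub>R axis d 1 = grid_point I" by simp
  finally show ?thesis using node[of I] node[of "I(d := Suc (I d))"] by (simp add: fun_upd_def)
qed

end

section \<open>The discrete complex\<close>

locale discrete_complex =
  fixes D :: "'m::finite complex_data"
  assumes meshed_D: "meshed_domain D"
    and basis: "basis_functions D"
    and incidence: "incidence_matrices D"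
    and bsign: "\<And>k X. bsign D k X \<in> {-1, 1}"
begin

sublocale mesh D by unfold_locales (rule meshed_D)

lemma psi0_mem: "X \<in> cells D 0 \<Longrightarrow> psi0 D X \<in> spaceG D"
  and psi1_mem: "X \<in> cells D 1 \<Longrightarrow> psi1 D X \<in> spaceC D"
  and psi2_mem: "X \<in> cells D 2 \<Longrightarrow> psi2 D X \<in> spaceD D"
  and psi3_mem: "X \<in> cells D 3 \<Longrightarrow> psi3 D X \<in> spaceS D"
  using basis by (simp_all add: basis_functions_def dof_basis_def)

lemma dof0_psi: "X \<in> cells D 0 \<Longrightarrow> Y \<in> cells D 0 \<Longrightarrow> dof0 D (psi0 D X) Y = of_bool (X = Y)"
  and dof1_psi: "X \<in> cells D 1 \<Longrightarrow> Y \<in> cells D 1 \<Longrightarrow> dof1 D (psi1 D X) Y = of_bool (X = Y)"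
  and dof2_psi: "X \<in> cells D 2 \<Longrightarrow> Y \<in> cells D 2 \<Longrightarrow> dof2 D (psi2 D X) Y = of_bool (X = Y)"
  and dof3_psi: "X \<in> cells D 3 \<Longrightarrow> Y \<in> cells D 3 \<Longrightarrow> dof3 D (psi3 D X) Y = of_bool (X = Y)"
  using basis by (simp_all add: basis_functions_def dof_basis_def)

lemma sum_delta_cells: "X \<in> cells D k \<Longrightarrow> (\<Sum>Y\<in>cells D k. a Y * of_bool (Y = X)) = (a X :: real)"
  using finite_cells[of k] by (simp add: of_bool_def if_distrib cong: if_cong)

lemma dof1_expand_psi: "X \<in> cells D 1 \<Longrightarrow> dof1 D (expand (cells D 1) (psi1 D) a) X = a X"
  by (simp add: dof1_expand finite_cells psi1_mem dof1_psi sum_delta_cells)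

lemma dof2_expand_psi: "X \<in> cells D 2 \<Longrightarrow> dof2 D (expand (cells D 2) (psi2 D) a) X = a X"
  by (simp add: dof2_expand finite_cells psi2_mem dof2_psi sum_delta_cells)

lemma dof3_expand_psi: "X \<in> cells D 3 \<Longrightarrow> dof3 D (expand (cells D 3) (psi3 D) a) X = a X"
  by (simp add: dof3_expand finite_cells psi3_mem dof3_psi sum_delta_cells)

lemma expand_zero: "expand J \<psi> (\<lambda>X. 0) = (\<lambda>m x. 0)"
  by (simp add: expand_def)

lemma psi1_independent: "expand (cells D 1) (psi1 D) a = (\<lambda>m x. 0) \<Longrightarrow> X \<in> cells D 1 \<Longrightarrow> a X = 0"
  using dof1_expand_psi[of X a] dof1_expand_psi[of X "\<lambda>X. 0"] by (simp add: expand_zero)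

lemma psi2_independent: "expand (cells D 2) (psi2 D) a = (\<lambda>m x. 0) \<Longrightarrow> X \<in> cells D 2 \<Longrightarrow> a X = 0"
  using dof2_expand_psi[of X a] dof2_expand_psi[of X "\<lambda>X. 0"] by (simp add: expand_zero)

lemma psi3_independent: "expand (cells D 3) (psi3 D) a = (\<lambda>m x. 0) \<Longrightarrow> X \<in> cells D 3 \<Longrightarrow> a X = 0"
  using dof3_expand_psi[of X a] dof3_expand_psi[of X "\<lambda>X. 0"] by (simp add: expand_zero)

text \<open>A member of \<open>spaceC\<close> that coincides with the gradient of a basis function
  in the element interiors; its degrees of freedom form a column of \<open>E10\<close>.\<close>

abbreviation grad_psi :: "cell \<Rightarrow> ('m, real^3) bfun" where
  "grad_psi X \<equiv> expand (cells D 1) (psi1 D) (\<lambda>Y. E10 D Y X)"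

abbreviation curl_psi :: "cell \<Rightarrow> ('m, real^3) bfun" where
  "curl_psi X \<equiv> expand (cells D 2) (psi2 D) (\<lambda>Y. E21 D Y X)"

lemma grad_psi_mem: "grad_psi X \<in> spaceC D"
  by (rule spaceC_expand[OF finite_cells psi1_mem])

lemma curl_psi_mem: "curl_psi X \<in> spaceD D"
  by (rule spaceD_expand[OF finite_cells psi2_mem])

lemma gradient_psi0:
  assumes X: "X \<in> cells D 0" and x: "x \<in> interior (elem D m)"
  shows "gradient (psi0 D X m) x = grad_psi X m x"
proof -
  have "mat_vec (cells D 0) (E10 D) (dof0 D (psi0 D X)) = (\<lambda>Y. E10 D Y X)"
    using sum_delta_cells[OF X] by (simp add: mat_vec_def dof0_psi[OF X] eq_commute[of X] cong: sum.cong)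
  then show ?thesis using incidence psi0_mem[OF X] x by (simp add: incidence_matrices_def)
qed

lemma curl_psi1:
  assumes X: "X \<in> cells D 1" and x: "x \<in> interior (elem D m)"
  shows "curl (psi1 D X m) x = curl_psi X m x"
proof -
  have "mat_vec (cells D 1) (E21 D) (dof1 D (psi1 D X)) = (\<lambda>Y. E21 D Y X)"
    using sum_delta_cells[OF X] by (simp add: mat_vec_def dof1_psi[OF X] eq_commute[of X] cong: sum.cong)
  then show ?thesis using incidence psi1_mem[OF X] x by (simp add: incidence_matrices_def)
qed

text \<open>The pullback of \<open>grad_psi X\<close> is the gradient of a polynomial, so its curl
  vanishes by equality of mixed partials. That curl has column \<open>X\<close> of the matrix
  product as coefficients, and these are zero by independence of \<open>psi2\<close>.\<close>

lemma E21_E10_zero: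
  assumes X: "X \<in> cells D 0" and Z: "Z \<in> cells D 2"
  shows "(\<Sum>Y\<in>cells D 1. E21 D Z Y * E10 D Y X) = 0"
proof -
  let ?c = "grad_psi X" and ?a = "mat_vec (cells D 1) (E21 D) (\<lambda>Y. E10 D Y X)"
  have a: "mat_vec (cells D 1) (E21 D) (dof1 D ?c) = ?a"
    unfolding mat_vec_def by (intro ext sum.cong refl) (simp only: dof1_expand_psi)
  have "curl (?c m) x = 0" if x: "x \<in> interior (elem D m)" for m x
  proof -
    obtain \<xi> where \<xi>: "\<xi> \<in> interior refK" "x = phi D m \<xi>" using x by (auto simp: interior_elem)
    have \<xi>K: "\<xi> \<in> refK" using \<xi>(1) interior_subset by blast
    obtain P where P: "P \<in> refG (pdeg D)" "\<And>\<xi>. \<xi> \<in> refK \<Longrightarrow> psi0 D X m (phi D m \<xi>) = P \<xi>"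
      using spaceG_pullback[OF psi0_mem[OF X]] by blast
    have "?c m (phi D m \<zeta>) \<bullet> partial (phi D m) \<zeta> i = (\<chi> i. partial P \<zeta> i) $ i" if \<zeta>: "\<zeta> \<in> interior refK" for \<zeta> i
      using gradient_psi0[OF X phi_interior[OF \<zeta>]]
        gradient_reference[OF smooth_on_elem_differentiable[OF spaceG_smooth[OF psi0_mem[OF X]] phi_interior[OF \<zeta>]] _ \<zeta>, where P = P and i = i]
        P(2) interior_subset[of refK] by auto
    then have "curl (?c m) (phi D m \<xi>) \<bullet> area_vector D m n \<xi> =
      partial (\<lambda>\<zeta>. (\<chi> i. partial P \<zeta> i) $ (n + 2)) \<xi> (n + 1) - partial (\<lambda>\<zeta>. (\<chi> i. partial P \<zeta> i) $ (n + 1)) \<xi> (n + 2)" for n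
      by (intro curl_reference smooth_on_elem_differentiable[OF spaceC_smooth[OF grad_psi_mem]] phi_interior \<xi>(1))
    then have "curl (?c m) (phi D m \<xi>) \<bullet> area_vector D m n \<xi> = 0 \<bullet> area_vector D m n \<xi>" for n
      using tensor_mixed_partials[of P] P(1) by (simp add: refG_def)
    then show ?thesis using eq_if_inner_area_vector_eq[OF \<xi>K] \<xi>(2) by blast
  qed
  then have int: "expand (cells D 2) (psi2 D) ?a m x = 0" if "x \<in> interior (elem D m)" for m x
    using that incidence grad_psi_mem[of X] a unfolding incidence_matrices_def by metis
  have "expand (cells D 2) (psi2 D) ?a = (\<lambda>m x. 0)"
  proof (rule zero_if_zero_on_interior[OF _ _ int])
    have "expand (cells D 2) (psi2 D) ?a \<in> spaceD D" by (rule spaceD_expand[OF finite_cells psi2_mem])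
    then show "broken D (expand (cells D 2) (psi2 D) ?a)" "smooth_on_elem m (expand (cells D 2) (psi2 D) ?a m)" for m
      using spaceD_smooth by (auto simp: spaceD_def)
  qed
  from psi2_independent[OF this Z] show ?thesis by (simp add: mat_vec_def)
qed

text \<open>In reference coordinates the flux components of \<open>curl_psi X\<close> are the curl
  of a polynomial field, whose divergence cancels by equality of mixed partials. Independence of
  \<open>psi3\<close> then gives the matrix identity.\<close>

lemma E32_E21_zero:
  assumes X: "X \<in> cells D 1" and Z: "Z \<in> cells D 3"
  shows "(\<Sum>Y\<in>cells D 2. E32 D Z Y * E21 D Y X) = 0"
proof -
  let ?q = "curl_psi X" and ?a = "mat_vec (cells D 2) (E32 D) (\<lambda>Y. E21 D Y X)"
  have a: "mat_vec (cells D 2) (E32 D) (dof2 D ?q) = ?a"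
    unfolding mat_vec_def by (intro ext sum.cong refl) (simp only: dof2_expand_psi)
  have "divergence (?q m) x = 0" if x: "x \<in> interior (elem D m)" for m x
  proof -
    obtain \<xi> where \<xi>: "\<xi> \<in> interior refK" "x = phi D m \<xi>" using x by (auto simp: interior_elem)
    have \<xi>K: "\<xi> \<in> refK" using \<xi>(1) interior_subset by blast
    obtain v where v: "v \<in> refC (pdeg D)" "\<And>\<xi> i. \<xi> \<in> refK \<Longrightarrow> psi1 D X m (phi D m \<xi>) \<bullet> partial (phi D m) \<xi> i = v \<xi> $ i"
      using spaceC_pullback[OF psi1_mem[OF X]] by blast
    let ?d = "\<lambda>k i \<zeta>. partial (\<lambda>\<zeta>. v \<zeta> $ k) \<zeta> i"
    have u: "?q m (phi D m \<zeta>) \<bullet> area_vector D m n \<zeta> = ?d (n + 2) (n + 1) \<zeta> - ?d (n + 1) (n + 2) \<zeta>"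
      if \<zeta>: "\<zeta> \<in> interior refK" for \<zeta> n
    proof -
      have "curl (psi1 D X m) (phi D m \<zeta>) \<bullet> area_vector D m n \<zeta> = ?d (n + 2) (n + 1) \<zeta> - ?d (n + 1) (n + 2) \<zeta>"
        by (rule curl_reference[OF smooth_on_elem_differentiable[OF spaceC_smooth[OF psi1_mem[OF X]] phi_interior[OF \<zeta>]] \<zeta>])
           (use v(2) interior_subset in blast)
      then show ?thesis using curl_psi1[OF X phi_interior[OF \<zeta>]] by simp
    qed
    have tensor_v: "\<exists>a b c. (\<lambda>x. v x $ k) \<in> tensor a b c" for k
      using polynomial_field_refC[OF v(1)] by (simp add: polynomial_field_def)
    have dd: "?d k i differentiable (at \<zeta>)" for k i \<zeta>
      using tensor_v[of k] tensor_differentiable[OF tensor_partial] by blast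
    have sym: "partial (?d k i) \<xi> j = partial (?d k j) \<xi> i" for k i j
      using tensor_v[of k] tensor_mixed_partials by blast
    have sub: "partial (\<lambda>\<zeta>. ?d k i \<zeta> - ?d l j \<zeta>) \<xi> n = partial (?d k i) \<xi> n - partial (?d l j) \<xi> n" for k i l j n
    proof -
      have "((\<lambda>\<zeta>. ?d k i \<zeta> - ?d l j \<zeta>) has_derivative (\<lambda>h. frechet_derivative (?d k i) (at \<xi>) h - frechet_derivative (?d l j) (at \<xi>) h)) (at \<xi>)"
        using dd by (intro has_derivative_diff) (auto simp: frechet_derivative_works[symmetric])
      from has_derivative_partial[OF this, of n] show ?thesis by (simp add: partial_def)
    qed
    have "divergence (?q m) (phi D m \<xi>) * det (jac (phi D m) \<xi>) =
      (\<Sum>n\<in>UNIV. partial (\<lambda>\<zeta>. ?d (n + 2) (n + 1) \<zeta> - ?d (n + 1) (n + 2) \<zeta>) \<xi> n)"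
      by (intro divergence_reference smooth_on_elem_differentiable[OF spaceD_smooth[OF curl_psi_mem]] phi_interior \<xi>(1) u)
    also have "\<dots> = 0"
      unfolding sub
      using sym[of 1 2 3] sym[of 2 1 3] sym[of 3 1 2] by (simp add: sum_3 three_arith)
    finally show ?thesis using det_jac_pos[OF \<xi>K, of m] \<xi>(2) by simp
  qed
  then have int: "expand (cells D 3) (psi3 D) ?a m x = 0" if "x \<in> interior (elem D m)" for m x
    using that incidence curl_psi_mem[of X] a unfolding incidence_matrices_def by metis
  have "expand (cells D 3) (psi3 D) ?a = (\<lambda>m x. 0)"
  proof (rule zero_if_zero_on_interior[OF _ _ int])
    show "broken D (expand (cells D 3) (psi3 D) ?a)"
      using psi3_mem by (intro broken_expand) (simp add: spaceS_def)
    show "smooth_on_elem m (expand (cells D 3) (psi3 D) ?a m)" for m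
      by (intro smooth_expand finite_cells spaceS_smooth psi3_mem)
  qed
  from psi3_independent[OF this Z] show ?thesis by (simp add: mat_vec_def)
qed

text \<open>The entry is the degree of freedom of \<open>curl_psi X\<close> on \<open>Y\<close>. All
  edges inside \<open>Y\<close> lie on the frontier, so none of them is \<open>X\<close>, and the
  basis function of \<open>X\<close> has zero circulation along each.\<close>

lemma E21_boundary_zero:
  assumes Y: "Y \<in> bcells D 2" and X: "X \<in> cells D 1" "X \<notin> bcells D 1"
  shows "E21 D Y X = 0"
proof -
  have Y2: "Y \<in> cells D 2" and sub: "Y \<subseteq> frontier (Omega D)" using Y by (auto simp: bcells_def)
  have "dof2 D (curl_psi X) Y = 0"
  proof (rule dof2_curl_zero[OF psi1_mem[OF X(1)] curl_psi_mem Y2 curl_psi1[OF X(1)]])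
    fix X' assume X': "X' \<in> cells D 1" "X' \<subseteq> Y"
    then have "X' \<noteq> X" using X(2) sub X(1) by (auto simp: bcells_def)
    then show "dof1 D (psi1 D X) X' = 0" using dof1_psi[OF X(1) X'(1)] by simp
  qed
  then show ?thesis using dof2_expand_psi[OF Y2] by simp
qed

text \<open>One dimension lower: the nodes inside \<open>Y\<close> lie on the frontier, hence differ
  from \<open>X\<close>, and the basis function of \<open>X\<close> vanishes at them.\<close>

lemma E10_boundary_zero:
  assumes Y: "Y \<in> bcells D 1" and X: "X \<in> cells D 0" "X \<notin> bcells D 0"
  shows "E10 D Y X = 0"
proof -
  have Y1: "Y \<in> cells D 1" and sub: "Y \<subseteq> frontier (Omega D)" using Y by (auto simp: bcells_def)
  have "dof1 D (grad_psi X) Y = 0"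
  proof (rule dof1_gradient_zero[OF psi0_mem[OF X(1)] grad_psi_mem Y1 gradient_psi0[OF X(1)]])
    fix X' assume X': "X' \<in> cells D 0" "X' \<subseteq> Y"
    then have "X' \<noteq> X" using X(2) sub X(1) by (auto simp: bcells_def)
    then show "dof0 D (psi0 D X) X' = 0" using dof0_psi[OF X(1) X'(1)] by simp
  qed
  then show ?thesis using dof1_expand_psi[OF Y1] by simp
qed

end

section \<open>Mass matrices\<close>

text \<open>A box around the point inside \<open>S\<close> reduces the claim to a continuous
  non-negative function on a box. The restriction to interior points is essential, since a compact
  set may have parts of measure zero.\<close>

lemma nonneg_integral_zero_interior:
  fixes h :: "'a::euclidean_space \<Rightarrow> real"
  assumes S: "compact S" "continuous_on S h" and nonneg: "\<And>x. x \<in> S \<Longrightarrow> 0 \<le> h x"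
    and zero: "integral S h = 0" and x: "x \<in> interior S"
  shows "h x = 0"
proof -
  obtain a b where ab: "x \<in> box a b" "cbox a b \<subseteq> interior S"
    using open_contains_cbox[of "interior S"] x by (metis open_interior)
  then have sub: "cbox a b \<subseteq> S" using interior_subset by blast
  have cont: "continuous_on (cbox a b) h" by (rule continuous_on_subset[OF S(2) sub])
  have int: "h integrable_on cbox a b" by (rule integrable_continuous[OF cont])
  have "integral (cbox a b) h \<le> integral S h"
    by (rule integral_subset_le[OF sub int integrable_on_compact_continuous[OF S]]) (use nonneg in blast)
  moreover have "0 \<le> integral (cbox a b) h"
    by (rule integral_nonneg[OF int]) (use nonneg sub in blast)
  ultimately have "(h has_integral 0) (cbox a b)" using zero int by (metis antisym has_integral_integral)
  then show ?thesis
    using has_integral_0_cbox_imp_0[OF cont] nonneg sub ab box_subset_cbox by blast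
qed

text \<open>Energy identity. The weight \<open>w\<close> serves two cases: 1 in the volume, the area
  density on boundary faces.\<close>

lemma quadratic_form_integral:
  fixes f :: "'c \<Rightarrow> 'a::euclidean_space \<Rightarrow> 'b::real_inner"
  assumes J: "finite J" and int: "\<And>X Y. X \<in> J \<Longrightarrow> Y \<in> J \<Longrightarrow> (\<lambda>x. f X x \<bullet> f Y x * w x) integrable_on S"
  shows "integral S (\<lambda>x. (\<Sum>X\<in>J. a X *\<^sub>R f X x) \<bullet> (\<Sum>X\<in>J. a X *\<^sub>R f X x) * w x) =
    (\<Sum>X\<in>J. a X * (\<Sum>Y\<in>J. integral S (\<lambda>x. f X x \<bullet> f Y x * w x) * a Y))"
proof -
  have "(\<lambda>x. (\<Sum>X\<in>J. a X *\<^sub>R f X x) \<bullet> (\<Sum>X\<in>J. a X *\<^sub>R f X x) * w x) =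
    (\<lambda>x. \<Sum>X\<in>J. a X * (\<Sum>Y\<in>J. a Y * (f X x \<bullet> f Y x * w x)))"
    by (simp add: inner_sum_left inner_sum_right sum_distrib_left sum_distrib_right inner_commute mult_ac)
  moreover have "integral S (\<lambda>x. \<Sum>Y\<in>J. a Y * (f X x \<bullet> f Y x * w x)) = (\<Sum>Y\<in>J. a Y * integral S (\<lambda>x. f X x \<bullet> f Y x * w x))"
    if "X \<in> J" for X
    by (rule integral_lincomb[OF J int[OF that]])
  moreover have "(\<lambda>x. \<Sum>Y\<in>J. a Y * (f X x \<bullet> f Y x * w x)) integrable_on S" if "X \<in> J" for X
    using J int[OF that] by (intro integrable_sum integrable_on_mult_right) auto
  then have "integral S (\<lambda>x. \<Sum>X\<in>J. a X * (\<Sum>Y\<in>J. a Y * (f X x \<bullet> f Y x * w x))) =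
      (\<Sum>X\<in>J. a X * integral S (\<lambda>x. \<Sum>Y\<in>J. a Y * (f X x \<bullet> f Y x * w x)))"
    by (rule integral_lincomb[OF J])
  ultimately show ?thesis by (simp add: mult.commute)
qed

context mesh
begin

text \<open>Pairing the kernel relation with \<open>a\<close> shows that the integrals of the
  squared norm of the expansion sum to zero. The expansion therefore vanishes in every element
  interior, then everywhere, and independence applies.\<close>

lemma mass_trivial_kernel:
  fixes \<psi> :: "cell \<Rightarrow> ('m, real^3) bfun"
  assumes J: "finite J" and smooth: "\<And>Y m. Y \<in> J \<Longrightarrow> smooth_on_elem m (\<psi> Y m)" and broken: "\<And>Y. Y \<in> J \<Longrightarrow> broken M (\<psi> Y)"
    and indep: "\<And>a. expand J \<psi> a = (\<lambda>m x. 0) \<Longrightarrow> \<forall>X\<in>J. a X = 0"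
    and ker: "\<And>X. X \<in> J \<Longrightarrow> (\<Sum>Y\<in>J. mass M \<psi> X Y * a Y) = 0"
  shows "\<forall>Y\<in>J. a Y = 0"
proof (rule indep)
  let ?f = "expand J \<psi> a"
  have sf: "smooth_on_elem m (?f m)" for m by (rule smooth_expand[OF J smooth])
  have cont: "continuous_on (elem M m) (\<lambda>x. \<psi> X m x \<bullet> \<psi> Y m x)" if "X \<in> J" "Y \<in> J" for X Y m
    by (intro continuous_on_inner smooth_on_elem_continuous smooth that)
  have energy: "integral (elem M m) (\<lambda>x. ?f m x \<bullet> ?f m x) =
      (\<Sum>X\<in>J. a X * (\<Sum>Y\<in>J. integral (elem M m) (\<lambda>x. \<psi> X m x \<bullet> \<psi> Y m x) * a Y))" for m
    using quadratic_form_integral[OF J, of "\<lambda>X. \<psi> X m" "\<lambda>_. 1" "elem M m" a]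
      integrable_on_compact_continuous[OF compact_elem cont] by (simp add: expand_def)
  have "(\<Sum>m\<in>UNIV. integral (elem M m) (\<lambda>x. ?f m x \<bullet> ?f m x)) =
      (\<Sum>X\<in>J. a X * (\<Sum>Y\<in>J. mass M \<psi> X Y * a Y))"
    unfolding energy mass_def sum_distrib_left sum_distrib_right
    by (subst sum.swap, rule sum.cong[OF refl], subst sum.swap) simp
  also have "\<dots> = 0" using ker by simp
  finally have sum0: "(\<Sum>m\<in>UNIV. integral (elem M m) (\<lambda>x. ?f m x \<bullet> ?f m x)) = 0" .
  have cf: "continuous_on (elem M m) (\<lambda>x. ?f m x \<bullet> ?f m x)" for m
    by (intro continuous_on_inner smooth_on_elem_continuous sf)
  have "0 \<le> integral (elem M m) (\<lambda>x. ?f m x \<bullet> ?f m x)" for m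
    by (rule integral_nonneg[OF integrable_on_compact_continuous[OF compact_elem cf]]) simp
  then have "integral (elem M m) (\<lambda>x. ?f m x \<bullet> ?f m x) = 0" for m
    using sum0 by (simp add: sum_nonneg_eq_0_iff)
  then have "?f m x \<bullet> ?f m x = 0" if "x \<in> interior (elem M m)" for m x
    using nonneg_integral_zero_interior[OF compact_elem cf _ _ that] by simp
  then show "?f = (\<lambda>m x. 0)"
    by (intro zero_if_zero_on_interior broken_expand broken sf) auto
qed

section \<open>Boundary mass matrices\<close>

lemma cube_face_plane_point:
  assumes "\<xi> \<in> cube_face n s"
  obtains y where "y \<in> cbox (-1, -1) (1, 1)" "\<xi> = plane_point n s y"
proof -
  have "j = n + 2" if "j \<noteq> n" "j \<noteq> n + 1" for j using UNIV_3_cyclic[of n] that by blast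
  then have "\<xi> = plane_point n s (\<xi> $ (n + 1), \<xi> $ (n + 2))"
    using assms by (auto simp: vec_eq_iff plane_point_def cube_face_def)
  moreover have "(\<xi> $ (n + 1), \<xi> $ (n + 2)) \<in> cbox (-1, -1) (1, 1)"
    using assms by (auto simp: cbox_Pair_eq cube_face_def mem_refK abs_le_iff minus_le_iff)
  ultimately show ?thesis using that by blast
qed

lemma plane_point_cube_face:
  assumes "s \<in> {-1, 1}" "y \<in> cbox (-1, -1) (1, 1)"
  shows "plane_point n s y \<in> cube_face n s"
  using assms by (cases y) (auto simp: cube_face_def mem_refK plane_point_def cbox_Pair_eq abs_le_iff)

lemma area_vector_nonzero:
  assumes "\<xi> \<in> refK"
  shows "area_vector M m n \<xi> \<noteq> 0"
  using partial_inner_area_vector[of \<xi> m n n] det_jac_pos[OF assms, of m] assms by auto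

lemma continuous_on_area_vector: "continuous_on refK (area_vector M m n)"
  by (auto intro!: continuous_at_imp_continuous_on differentiable_imp_continuous_within area_vector_differentiable)

lemma bfacesD: "(m, n, s) \<in> bfaces M \<Longrightarrow> s \<in> {-1, 1}"
  by (simp add: bfaces_def)

lemma on_bface_iff: "(m, n, s) \<in> bfaces M \<Longrightarrow> on_bface M (m, n, s) x \<longleftrightarrow> x \<in> phi M m ` cube_face n s"
  by (simp add: on_bface_def)

lemma unit_normal_phi: "\<xi> \<in> refK \<Longrightarrow> unit_normal M (m, n, s) (phi M m \<xi>) = s *\<^sub>R sgn (area_vector M m n \<xi>)"
  by (simp add: unit_normal_def inv_into_f_f[OF inj_on_phi_refK])

text \<open>The argument of \<open>mass_trivial_kernel\<close> on the parameter squares of the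
  boundary faces. The area density is strictly positive, so the expansion vanishes on each closed
  square; \<open>supp\<close> covers the points off the boundary faces.\<close>

lemma bmass_trivial_kernel:
  fixes \<psi> :: "cell \<Rightarrow> 'm bface \<Rightarrow> real^3 \<Rightarrow> 'b::real_inner"
  assumes J: "finite J"
    and cont: "\<And>X m n s. X \<in> J \<Longrightarrow> (m, n, s) \<in> bfaces M \<Longrightarrow> continuous_on (cube_face n s) (\<lambda>\<xi>. \<psi> X (m, n, s) (phi M m \<xi>))"
    and supp: "\<And>X F x. X \<in> J \<Longrightarrow> \<not> on_bface M F x \<Longrightarrow> \<psi> X F x = 0"
    and indep: "\<And>a. expand J \<psi> a = (\<lambda>m x. 0) \<Longrightarrow> \<forall>X\<in>J. a X = 0"
    and ker: "\<And>X. X \<in> J \<Longrightarrow> (\<Sum>Y\<in>J. bmass M \<psi> X Y * a Y) = 0"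
  shows "\<forall>Y\<in>J. a Y = 0"
proof (rule indep)
  let ?f = "expand J \<psi> a" and ?Q = "cbox (-1, -1) (1, 1) :: (real \<times> real) set"
  define \<psi>' where "\<psi>' X F y = (case F of (m, n, s) \<Rightarrow> \<psi> X F (phi M m (plane_point n s y)))" for X F y
  define w where "w F y = (case F of (m, n, s) \<Rightarrow> norm (area_vector M m n (plane_point n s y)))" for F y
  define f' where "f' F y = (\<Sum>X\<in>J. a X *\<^sub>R \<psi>' X F y)" for F y
  have c\<psi>: "continuous_on ?Q (\<psi>' X F)" if "X \<in> J" "F \<in> bfaces M" for X F
  proof -
    obtain m n s where F: "F = (m, n, s)" by (cases F)
    show ?thesis
      unfolding \<psi>'_def F prod.case
      by (rule continuous_on_compose2[OF cont[OF that[unfolded F]]])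
         (use plane_point_cube_face bfacesD that F in \<open>auto intro!: continuous_intros\<close>)
  qed
  have cw: "continuous_on ?Q (w F)" if "F \<in> bfaces M" for F
  proof -
    obtain m n s where F: "F = (m, n, s)" by (cases F)
    have "s \<in> {-1, 1}" using bfacesD that F by blast
    then have sub: "plane_point n s ` ?Q \<subseteq> refK"
      using plane_point_cube_face[of s _ n] cube_face_subset[of n s] by blast
    show ?thesis
      unfolding w_def F prod.case
      by (rule continuous_on_norm, rule continuous_on_compose2[OF continuous_on_area_vector _ sub])
         (intro continuous_on_plane_point continuous_on_id)
  qed
  have cf: "continuous_on ?Q (\<lambda>y. f' F y \<bullet> f' F y * w F y)" if "F \<in> bfaces M" for F
    unfolding f'_def by (intro continuous_intros c\<psi> cw that)
  have energy: "integral ?Q (\<lambda>y. f' F y \<bullet> f' F y * w F y) =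
      (\<Sum>X\<in>J. a X * (\<Sum>Y\<in>J. integral ?Q (\<lambda>y. \<psi>' X F y \<bullet> \<psi>' Y F y * w F y) * a Y))" if "F \<in> bfaces M" for F
    unfolding f'_def
    by (rule quadratic_form_integral[OF J]) (intro integrable_continuous continuous_intros c\<psi> cw that)
  have bm: "bmass M \<psi> X Y = (\<Sum>F\<in>bfaces M. integral ?Q (\<lambda>y. \<psi>' X F y \<bullet> \<psi>' Y F y * w F y))" for X Y
    unfolding bmass_def by (intro sum.cong refl) (auto simp: \<psi>'_def w_def Let_def)
  have "(\<Sum>F\<in>bfaces M. integral ?Q (\<lambda>y. f' F y \<bullet> f' F y * w F y)) =
      (\<Sum>F\<in>bfaces M. \<Sum>X\<in>J. a X * (\<Sum>Y\<in>J. integral ?Q (\<lambda>y. \<psi>' X F y \<bullet> \<psi>' Y F y * w F y) * a Y))"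
    by (rule sum.cong[OF refl energy])
  also have "\<dots> = (\<Sum>X\<in>J. a X * (\<Sum>Y\<in>J. bmass M \<psi> X Y * a Y))"
    unfolding bm sum_distrib_left sum_distrib_right
    by (subst sum.swap, rule sum.cong[OF refl], subst sum.swap) simp
  also have "\<dots> = 0" using ker by simp
  finally have sum0: "(\<Sum>F\<in>bfaces M. integral ?Q (\<lambda>y. f' F y \<bullet> f' F y * w F y)) = 0" .
  have w_nonneg: "0 \<le> w F y" for F y by (simp add: w_def split: prod.split)
  have "0 \<le> integral ?Q (\<lambda>y. f' F y \<bullet> f' F y * w F y)" if "F \<in> bfaces M" for F
    by (rule integral_nonneg[OF integrable_continuous[OF cf[OF that]]]) (simp add: w_nonneg)
  then have int0: "integral ?Q (\<lambda>y. f' F y \<bullet> f' F y * w F y) = 0" if "F \<in> bfaces M" for F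
    using sum0 that by (simp add: sum_nonneg_eq_0_iff finite_bfaces)
  show "?f = (\<lambda>F x. 0)"
  proof (intro ext)
    fix F x
    show "?f F x = 0"
    proof (cases "on_bface M F x")
      case False
      then show ?thesis using supp by (simp add: expand_def)
    next
      case True
      obtain m n s where F: "F = (m, n, s)" by (cases F)
      have Fb: "F \<in> bfaces M" using True by (simp add: on_bface_def)
      obtain \<xi> where \<xi>: "\<xi> \<in> cube_face n s" "x = phi M m \<xi>"
        using True on_bface_iff Fb F by auto
      obtain y where y: "y \<in> ?Q" "\<xi> = plane_point n s y" using cube_face_plane_point[OF \<xi>(1)] .
      have "((\<lambda>y. f' F y \<bullet> f' F y * w F y) has_integral 0) ?Q"
        using int0[OF Fb] integrable_continuous[OF cf[OF Fb]] by (metis has_integral_integral)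
      then have "f' F y \<bullet> f' F y * w F y = 0"
        by (intro has_integral_0_cbox_imp_0[OF cf[OF Fb]] y(1)) (auto simp: w_nonneg box_ne_empty Basis_prod_def)
      moreover have "w F y \<noteq> 0"
        using area_vector_nonzero[of \<xi> m n] \<xi>(1) cube_face_subset y(2) by (auto simp: w_def F)
      ultimately have "f' F y = 0" by simp
      then show ?thesis by (simp add: f'_def \<psi>'_def F expand_def \<xi>(2) y(2))
    qed
  qed
qed

text \<open>By \<open>frontier_subset_bfaces\<close> the midpoint of the edge lies in some boundary
  face. A coordinate bounded by 1 in modulus that attains -1 or 1 at the midpoint of a segment
  attains it at both ends, so the whole edge lies in that face.\<close>

lemma boundary_edge:
  assumes X: "X \<in> bcells M 1"
  obtains m n s a b where "(m, n, s) \<in> bfaces M" "a \<in> cube_face n s" "b \<in> cube_face n s"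
    "X = phi M m ` closed_segment a b"
proof -
  have X1: "X \<in> cells M 1" and fr: "X \<subseteq> frontier (Omega M)" using X by (auto simp: bcells_def)
  obtain k I d where I: "ref_index (pdeg M) I {d}" and X_eq: "X = phi M k ` ref_cell (gll M) I {d}"
    using edge_ownerE[OF X1] .
  define p q where "p = grid_point I" and "q = grid_point (I(d := Suc (I d)))"
  have seg: "X = phi M k ` closed_segment p q" "closed_segment p q \<subseteq> refK"
    using X_eq ref_cell_subset_refK[OF I] ref_cell_edge[OF I] by (auto simp: p_def q_def)
  then have pq: "p \<in> refK" "q \<in> refK" by auto
  have "p \<noteq> q"
  proof
    assume "p = q"
    then have "p $ d = q $ d" by simp
    then show False
      using gll_strict_mono[of "I d" "Suc (I d)"] ref_indexD(2)[OF I, of d] by (simp add: p_def q_def grid_point_def)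
  qed
  let ?\<mu> = "midpoint p q"
  have \<mu>: "?\<mu> \<in> open_segment p q" "?\<mu> \<in> closed_segment p q" using \<open>p \<noteq> q\<close> by simp_all
  have \<mu>K: "?\<mu> \<in> refK" using \<mu> seg by blast
  have "phi M k ?\<mu> \<in> frontier (Omega M)" using \<mu> seg fr by blast
  then obtain m n s where face: "(m, n, s) \<in> bfaces M" "phi M k ?\<mu> \<in> phi M m ` cube_face n s"
    using frontier_subset_bfaces by blast
  then obtain \<eta> where \<eta>: "\<eta> \<in> cube_face n s" "phi M k ?\<mu> = phi M m \<eta>" by blast
  have ends: "e \<in> cube_face n s \<and> f \<in> cube_face n s"
    if "midpoint e f \<in> cube_face n s" "e \<in> refK" "f \<in> refK" for e f
  proof -
    have "e $ n + f $ n = 2 * s" using that(1) by (simp add: cube_face_def midpoint_def)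
    moreover have "\<bar>e $ n\<bar> \<le> 1" "\<bar>f $ n\<bar> \<le> 1" using that mem_refK by blast+
    ultimately have "e $ n = s \<and> f $ n = s" using bfacesD[OF face(1)] by auto
    then show ?thesis using that by (simp add: cube_face_def)
  qed
  show ?thesis
  proof (cases "k = m")
    case True
    then have "\<eta> = ?\<mu>" using phi_eq_iff[OF \<mu>K, of \<eta> m] \<eta> cube_face_subset by auto
    then show ?thesis using ends[of p q] \<eta>(1) pq that[OF face(1)] seg True by metis
  next
    case False
    obtain F \<sigma> where F: "F face_of refK" and \<sigma>: "orthogonal_transformation \<sigma>" "\<sigma> ` refK = refK"
      and glue: "\<And>\<xi>. \<xi> \<in> F \<Longrightarrow> phi M k \<xi> = phi M m (\<sigma> \<xi>)"
      and iff: "\<And>\<xi>. \<xi> \<in> refK \<Longrightarrow> phi M k \<xi> \<in> elem M m \<longleftrightarrow> \<xi> \<in> F"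
      using conformingE[OF False] by metis
    have lin: "linear \<sigma>" by (rule orthogonal_transformation_linear[OF \<sigma>(1)])
    have \<mu>F: "?\<mu> \<in> F" using iff[OF \<mu>K] \<eta> cube_face_subset by (auto simp: elem_def)
    \<comment> \<open>The midpoint is interior to the edge, so the defining property of a face
      brings both endpoints into \<open>F\<close>.\<close>
    then have pqF: "p \<in> F" "q \<in> F" using face_ofD[OF F \<mu>(1) pq] by auto
    then have segF: "closed_segment p q \<subseteq> F" using face_of_imp_convex[OF F] by (simp add: closed_segment_subset)
    have \<sigma>K: "\<sigma> e \<in> refK" if "e \<in> refK" for e using that \<sigma>(2) by blast
    have "\<sigma> ?\<mu> = \<eta>"
      using phi_eq_iff[OF \<sigma>K[OF \<mu>K], of \<eta> m] \<eta> cube_face_subset glue[OF \<mu>F] by auto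
    moreover have "\<sigma> ?\<mu> = midpoint (\<sigma> p) (\<sigma> q)"
      by (simp add: midpoint_def linear_add[OF lin] linear_cmul[OF lin])
    ultimately have "\<sigma> p \<in> cube_face n s \<and> \<sigma> q \<in> cube_face n s"
      using ends[of "\<sigma> p" "\<sigma> q"] \<eta>(1) \<sigma>K pq by simp
    moreover have "X = phi M m ` closed_segment (\<sigma> p) (\<sigma> q)"
    proof -
      have "X = phi M m ` \<sigma> ` closed_segment p q"
        unfolding seg(1) image_image using glue segF by (intro image_cong) auto
      then show ?thesis by (simp add: closed_segment_linear_image[OF lin])
    qed
    ultimately show ?thesis using that[OF face(1)] by blast
  qed
qed

text \<open>Zero tangential trace makes the field normal to the boundary face, whereas the edge,
  lying in that face by \<open>boundary_edge\<close>, has tangential velocity; the line integrand is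
  zero.\<close>

lemma dof1_trace_zero:
  assumes c: "c \<in> spaceC M" and tr: "trace1 M c = (\<lambda>F x. 0)" and X: "X \<in> bcells M 1"
  shows "dof1 M c X = 0"
proof -
  obtain m n s a b where face: "(m, n, s) \<in> bfaces M" and ab: "a \<in> cube_face n s" "b \<in> cube_face n s"
    and X_eq: "X = phi M m ` closed_segment a b" using boundary_edge[OF X] .
  have "c m (phi M m (a + t *\<^sub>R (b - a))) \<bullet> (jac (phi M m) (a + t *\<^sub>R (b - a)) *v (b - a)) = 0"
    if t: "t \<in> {0..1}" for t
  proof -
    let ?\<xi> = "a + t *\<^sub>R (b - a)"
    have "?\<xi> = (1 - t) *\<^sub>R a + t *\<^sub>R b" by (simp add: algebra_simps)
    then have "?\<xi> \<in> refK"
      using convexD[OF convex_refK, of a b "1 - t" t] ab cube_face_subset t by auto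
    moreover have n: "(b - a) $ n = 0" using ab by (simp add: cube_face_def)
    ultimately have face\<xi>: "?\<xi> \<in> cube_face n s" using ab by (simp add: cube_face_def)
    define \<nu> where "\<nu> = unit_normal M (m, n, s) (phi M m ?\<xi>)"
    have "trace1 M c (m, n, s) (phi M m ?\<xi>) = 0" using tr by simp
    then have "c m (phi M m ?\<xi>) = (c m (phi M m ?\<xi>) \<bullet> \<nu>) *\<^sub>R \<nu>"
      using face\<xi> on_bface_iff[OF face] by (simp add: trace1_def \<nu>_def)
    moreover have "\<nu> \<bullet> (jac (phi M m) ?\<xi> *v (b - a)) = 0"
      using inner_area_vector_expansion[of ?\<xi> m "\<lambda>i. (b - a) $ i" n] \<open>?\<xi> \<in> refK\<close> n
      unfolding \<nu>_def by (simp add: unit_normal_phi jac_phi_mult sgn_div_norm inner_commute)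
    ultimately show ?thesis by (metis inner_scaleR_left mult_zero_right)
  qed
  then have "line_integral m c a b = integral {0..1} (\<lambda>t::real. 0)"
    unfolding line_integral_def by (rule integral_cong)
  then show ?thesis
    using abs_line_integral[OF c subsetD[OF bcells_subset X] _ _ X_eq] ab cube_face_subset by auto
qed

end

context discrete_complex
begin

section \<open>Trivial kernels for the mass matrices of the complex\<close>

lemma mass2_kernel:
  assumes "\<And>X. X \<in> cells D 2 \<Longrightarrow> (\<Sum>Y\<in>cells D 2. mass D (psi2 D) X Y * a Y) = 0"
  shows "\<forall>Y\<in>cells D 2. a Y = 0"
  by (rule mass_trivial_kernel[OF finite_cells _ _ _ assms])
     (use psi2_mem spaceD_smooth psi2_independent in \<open>auto simp: spaceD_def\<close>)

lemma mass1_kernel: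
  assumes "\<And>X. X \<in> cells D 1 \<Longrightarrow> (\<Sum>Y\<in>cells D 1. mass D (psi1 D) X Y * a Y) = 0"
  shows "\<forall>Y\<in>cells D 1. a Y = 0"
  by (rule mass_trivial_kernel[OF finite_cells _ _ _ assms])
     (use psi1_mem spaceC_smooth psi1_independent in \<open>auto simp: spaceC_def simp del: One_nat_def\<close>)

lemma expand_inclusion:
  assumes "Y \<in> cells D k"
  shows "expand (cells D k) \<psi> (\<lambda>X. inclusion D k X Y) = (\<lambda>m x. bsign D k Y *\<^sub>R \<psi> Y m x)"
  using assms finite_cells[of k]
  by (simp add: expand_def inclusion_def if_distrib[of "\<lambda>a. a *\<^sub>R _"] cong: if_cong)

lemma bsign_nonzero: "bsign D k X \<noteq> 0" and bsign_square: "bsign D k X * bsign D k X = 1"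
  using bsign[of k X] by auto

lemma bpsi0_eq: "Y \<in> bcells D 0 \<Longrightarrow> bpsi0 D Y = trace0 D (\<lambda>m x. bsign D 0 Y *\<^sub>R psi0 D Y m x)"
  using bcells_subset by (simp add: bpsi0_def expand_inclusion subset_iff)

lemma bpsi1_eq: "Y \<in> bcells D 1 \<Longrightarrow> bpsi1 D Y = trace1 D (\<lambda>m x. bsign D 1 Y *\<^sub>R psi1 D Y m x)"
  using bcells_subset[of 1] unfolding bpsi1_def by (subst expand_inclusion) auto

text \<open>Evaluation at a node, on a boundary face that contains it, isolates one
  coefficient.\<close>

lemma bpsi0_independent:
  assumes zero: "expand (bcells D 0) (bpsi0 D) a = (\<lambda>F x. 0)"
  shows "\<forall>X\<in>bcells D 0. a X = 0"
proof
  fix X assume X: "X \<in> bcells D 0"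
  have X0: "X \<in> cells D 0" and fr: "X \<subseteq> frontier (Omega D)" using X by (auto simp: bcells_def)
  obtain k I A where "ref_index (pdeg D) I A" "card A = 0" "X = phi D k ` ref_cell (gll D) I A" using ownerE[OF X0] .
  then have "X = {phi D k (grid_point I)}" by (simp add: ref_cell_def grid_point_def)
  then obtain x where x: "X = {x}" by blast
  obtain m n s where face: "(m, n, s) \<in> bfaces D" "x \<in> phi D m ` cube_face n s"
    using frontier_subset_bfaces[of x] fr x by blast
  have xm: "x \<in> elem D m" using face(2) cube_face_subset by (auto simp: elem_def)
  have val: "bpsi0 D Y (m, n, s) x = bsign D 0 Y * of_bool (Y = X)" if Y: "Y \<in> bcells D 0" for Y
  proof -
    have Y0: "Y \<in> cells D 0" using Y bcells_subset by blast
    have "psi0 D Y m x = of_bool (Y = X)"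
      using dof0_node[OF psi0_mem[OF Y0], of x m] X0 xm x dof0_psi[OF Y0 X0] by simp
    then show ?thesis using on_bface_iff[OF face(1)] face(2) by (simp add: bpsi0_eq[OF Y] trace0_def)
  qed
  have "0 = expand (bcells D 0) (bpsi0 D) a (m, n, s) x" using zero by simp
  also have "\<dots> = (\<Sum>Y\<in>bcells D 0. a Y * (bsign D 0 Y * of_bool (Y = X)))"
    by (simp add: expand_def val cong: sum.cong)
  also have "\<dots> = a X * bsign D 0 X"
    using X finite_bcells[of 0] by (simp add: of_bool_def if_distrib cong: if_cong)
  finally show "a X = 0" using bsign_nonzero[of 0 X] by simp
qed

text \<open>The trace is linear, so a combination of the \<open>psi1\<close>, with the signs
  absorbed into the coefficients, has zero tangential trace; its degrees of freedom on boundary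
  edges vanish, and these are the coefficients up to sign.\<close>

lemma bpsi1_independent:
  assumes zero: "expand (bcells D 1) (bpsi1 D) a = (\<lambda>F x. 0)"
  shows "\<forall>X\<in>bcells D 1. a X = 0"
proof
  fix X assume X: "X \<in> bcells D 1"
  have X1: "X \<in> cells D 1" using X bcells_subset by blast
  have mem: "psi1 D Y \<in> spaceC D" if "Y \<in> bcells D 1" for Y using psi1_mem that bcells_subset by blast
  let ?c = "expand (bcells D 1) (psi1 D) (\<lambda>Y. a Y * bsign D 1 Y)"
  have "trace1 D ?c = expand (bcells D 1) (bpsi1 D) a"
  proof (intro ext)
    fix F x
    have "expand (bcells D 1) (bpsi1 D) a F x = (\<Sum>Y\<in>bcells D 1. a Y *\<^sub>R trace1 D (\<lambda>m x. bsign D 1 Y *\<^sub>R psi1 D Y m x) F x)"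
      unfolding expand_def by (intro sum.cong refl) (simp only: bpsi1_eq)
    then show "trace1 D ?c F x = expand (bcells D 1) (bpsi1 D) a F x"
      by (simp add: trace1_def expand_def inner_sum_left scaleR_sum_left sum_subtractf scaleR_right_diff_distrib mult.assoc)
  qed
  then have "trace1 D ?c = (\<lambda>F x. 0)" using zero by simp
  moreover have "?c \<in> spaceC D" by (rule spaceC_expand[OF finite_bcells mem])
  ultimately have "dof1 D ?c X = 0" using dof1_trace_zero X by blast
  moreover have "dof1 D ?c X = (\<Sum>Y\<in>bcells D 1. (a Y * bsign D 1 Y) * of_bool (Y = X))"
  proof -
    have "dof1 D ?c X = (\<Sum>Y\<in>bcells D 1. (a Y * bsign D 1 Y) * dof1 D (psi1 D Y) X)"
      by (rule dof1_expand[OF finite_bcells mem X1])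
    also have "\<dots> = (\<Sum>Y\<in>bcells D 1. (a Y * bsign D 1 Y) * of_bool (Y = X))"
    proof (rule sum.cong[OF refl])
      fix Y assume "Y \<in> bcells D 1"
      then have "Y \<in> cells D 1" using bcells_subset by blast
      then show "(a Y * bsign D 1 Y) * dof1 D (psi1 D Y) X = (a Y * bsign D 1 Y) * of_bool (Y = X)"
        using dof1_psi[OF _ X1] by simp
    qed
    finally show ?thesis .
  qed
  moreover have "\<dots> = a X * bsign D 1 X"
    using X finite_bcells[of 1] by (simp add: of_bool_def if_distrib cong: if_cong del: One_nat_def)
  ultimately show "a X = 0" using bsign_nonzero[of 1 X] by simp
qed

lemma bmass0_kernel:
  assumes "\<And>X. X \<in> bcells D 0 \<Longrightarrow> (\<Sum>Y\<in>bcells D 0. bmass D (bpsi0 D) X Y * a Y) = 0"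
  shows "\<forall>Y\<in>bcells D 0. a Y = 0"
proof (rule bmass_trivial_kernel[OF finite_bcells _ _ bpsi0_independent assms])
  fix X F x assume X: "X \<in> bcells D 0"
  show "bpsi0 D X F x = 0" if "\<not> on_bface D F x" using that by (simp add: bpsi0_def trace0_def)
  fix m n s assume F: "(m, n, s) \<in> bfaces D"
  have "continuous_on (elem D m) (psi0 D X m)"
    using X bcells_subset by (intro smooth_on_elem_continuous spaceG_smooth psi0_mem) auto
  then have "continuous_on (cube_face n s) (\<lambda>\<xi>. psi0 D X m (phi D m \<xi>))"
    by (rule continuous_on_compose2[OF _ continuous_on_subset[OF continuous_on_phi_refK cube_face_subset]])
       (use cube_face_subset in \<open>auto simp: elem_def\<close>)
  then have "continuous_on (cube_face n s) (\<lambda>\<xi>. bsign D 0 X *\<^sub>R psi0 D X m (phi D m \<xi>))"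
    by (intro continuous_intros)
  then show "continuous_on (cube_face n s) (\<lambda>\<xi>. bpsi0 D X (m, n, s) (phi D m \<xi>))"
    by (rule continuous_on_eq) (simp add: bpsi0_eq[OF X] trace0_def on_bface_iff[OF F])
qed

lemma bmass1_kernel:
  assumes "\<And>X. X \<in> bcells D 1 \<Longrightarrow> (\<Sum>Y\<in>bcells D 1. bmass D (bpsi1 D) X Y * a Y) = 0"
  shows "\<forall>Y\<in>bcells D 1. a Y = 0"
proof (rule bmass_trivial_kernel[OF finite_bcells _ _ bpsi1_independent assms])
  fix X F x assume X: "X \<in> bcells D 1"
  show "bpsi1 D X F x = 0" if "\<not> on_bface D F x" using that by (simp add: bpsi1_def trace1_def)
  fix m n s assume F: "(m, n, s) \<in> bfaces D"
  have "continuous_on (elem D m) (psi1 D X m)"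
    using X bcells_subset[of 1] by (intro smooth_on_elem_continuous spaceC_smooth psi1_mem) auto
  then have c: "continuous_on (cube_face n s) (\<lambda>\<xi>. psi1 D X m (phi D m \<xi>))"
    by (rule continuous_on_compose2[OF _ continuous_on_subset[OF continuous_on_phi_refK cube_face_subset]])
       (use cube_face_subset in \<open>auto simp: elem_def\<close>)
  \<comment> \<open>Normalization is continuous because the area vector has no zero on the
    cube.\<close>
  have \<nu>: "continuous_on (cube_face n s) (\<lambda>\<xi>. s *\<^sub>R sgn (area_vector D m n \<xi>))"
    unfolding sgn_div_norm
    by (intro continuous_intros continuous_on_subset[OF continuous_on_area_vector cube_face_subset])
       (use area_vector_nonzero cube_face_subset in force)
  have "continuous_on (cube_face n s) (\<lambda>\<xi>. bsign D 1 X *\<^sub>R psi1 D X m (phi D m \<xi>) -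
      ((bsign D 1 X *\<^sub>R psi1 D X m (phi D m \<xi>)) \<bullet> (s *\<^sub>R sgn (area_vector D m n \<xi>))) *\<^sub>R (s *\<^sub>R sgn (area_vector D m n \<xi>)))"
    by (intro continuous_intros c \<nu>)
  then show "continuous_on (cube_face n s) (\<lambda>\<xi>. bpsi1 D X (m, n, s) (phi D m \<xi>))"
  proof (rule continuous_on_eq)
    fix \<xi> assume "\<xi> \<in> cube_face n s"
    moreover from this have "\<xi> \<in> refK" using cube_face_subset by blast
    ultimately show "bsign D 1 X *\<^sub>R psi1 D X m (phi D m \<xi>) -
      ((bsign D 1 X *\<^sub>R psi1 D X m (phi D m \<xi>)) \<bullet> (s *\<^sub>R sgn (area_vector D m n \<xi>))) *\<^sub>R (s *\<^sub>R sgn (area_vector D m n \<xi>))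
      = bpsi1 D X (m, n, s) (phi D m \<xi>)"
      unfolding bpsi1_eq[OF X] trace1_def by (simp add: on_bface_iff[OF F] unit_normal_phi)
  qed
qed

section \<open>The dual complex\<close>

text \<open>The dual basis carries the inverse mass matrix and the dual degrees of freedom the mass
  matrix, so the two cancel.\<close>

lemma ddof1_expand_dual:
  assumes "X \<in> cells D 2"
  shows "ddof1 D (expand (cells D 2) (dpsi1 D) a) X = a X"
proof -
  have "ddof1 D (expand (cells D 2) (dpsi1 D) a) X =
    mat_vec (cells D 2) (mass D (psi2 D)) (mat_vec (cells D 2) (mat_inverse (cells D 2) (mass D (psi2 D))) a) X"
    unfolding ddof1_def dpsi1_def expand_dual_basis mat_vec_def
    by (intro sum.cong refl) (simp add: dof2_expand_psi)
  then show ?thesis using mat_vec_mat_inverse[OF finite_cells mass2_kernel assms] by simp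
qed

lemma ddof2_expand_dual:
  assumes "X \<in> cells D 1"
  shows "ddof2 D (expand (cells D 1) (dpsi2 D) a) X = a X"
proof -
  have "ddof2 D (expand (cells D 1) (dpsi2 D) a) X =
    mat_vec (cells D 1) (mass D (psi1 D)) (mat_vec (cells D 1) (mat_inverse (cells D 1) (mass D (psi1 D))) a) X"
    unfolding ddof2_def dpsi2_def expand_dual_basis mat_vec_def
    by (intro sum.cong refl) (simp only: dof1_expand_psi)
  then show ?thesis using mat_vec_mat_inverse[OF finite_cells mass1_kernel assms] by simp
qed

lemma bcoef1_expand_dual:
  "bcoef1 D (expand (bcells D 1) (dbpsi1 D) a) = (\<lambda>X. if X \<in> bcells D 1 then a X else 0)"
  unfolding bcoef1_def dbpsi1_def
  by (rule coefficients_dual_basis[OF finite_bcells bmass1_kernel bpsi1_independent])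

lemma bcoef2_expand_dual:
  "bcoef2 D (expand (bcells D 0) (dbpsi2 D) a) = (\<lambda>X. if X \<in> bcells D 0 then a X else 0)"
  unfolding bcoef2_def dbpsi2_def
  by (rule coefficients_dual_basis[OF finite_bcells bmass0_kernel bpsi0_independent])

lemma mat_vec_inclusion:
  "mat_vec (bcells D k) (inclusion D k) a = (\<lambda>X. if X \<in> bcells D k then bsign D k X * a X else 0)"
  using finite_bcells[of k] by (auto simp: mat_vec_def inclusion_def if_distrib[of "\<lambda>b. b * _"] cong: if_cong)

lemma mat_vec_inclusion_transpose:
  "X \<in> cells D k \<Longrightarrow> mat_vec (cells D k) (mat_transpose (inclusion D k)) a X = bsign D k X * a X"
  using finite_cells[of k] by (auto simp: mat_vec_def mat_transpose_def inclusion_def if_distrib[of "\<lambda>b. b * _"] cong: if_cong)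

lemma mat_vec_cong: "(\<And>Y. Y \<in> J \<Longrightarrow> a Y = b Y) \<Longrightarrow> mat_vec J A a X = mat_vec J A b X"
  by (simp add: mat_vec_def cong: sum.cong)

lemma mat_vec_add: "mat_vec J A (\<lambda>Y. a Y + b Y) X = mat_vec J A a X + mat_vec J A b X"
  and mat_vec_minus: "mat_vec J A (\<lambda>Y. - a Y) X = - mat_vec J A a X"
  by (simp_all add: mat_vec_def distrib_left sum.distrib sum_negf)

lemma mat_vec_transpose_compose:
  "mat_vec J (mat_transpose A) (mat_vec I (mat_transpose B) a) X = (\<Sum>Z\<in>I. (\<Sum>Y\<in>J. B Z Y * A Y X) * a Z)"
  unfolding mat_vec_def mat_transpose_def sum_distrib_left sum_distrib_right
  by (subst sum.swap) (simp add: mult_ac)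

lemma E32_E21_transpose: "X \<in> cells D 1 \<Longrightarrow>
    mat_vec (cells D 2) (mat_transpose (E21 D)) (mat_vec (cells D 3) (mat_transpose (E32 D)) a) X = 0"
  unfolding mat_vec_transpose_compose by (rule sum.neutral) (simp add: E32_E21_zero)

lemma E21_E10_transpose: "X \<in> cells D 0 \<Longrightarrow>
    mat_vec (cells D 1) (mat_transpose (E10 D)) (mat_vec (cells D 2) (mat_transpose (E21 D)) a) X = 0"
  unfolding mat_vec_transpose_compose using E21_E10_zero by (intro sum.neutral) (simp del: One_nat_def)

lemma expand_eq_zero: "(\<And>X. X \<in> J \<Longrightarrow> a X = 0) \<Longrightarrow> expand J \<psi> a = (\<lambda>m x. 0)"
  by (simp add: expand_def)

text \<open>Boundary faces have zero entries against non-boundary edges, so E21^T N_2 a is supported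
  on the boundary edges, where N_1 N_1^T acts as the identity.\<close>

lemma E21_transpose_boundary:
  assumes "X \<in> cells D 1" "X \<notin> bcells D 1"
  shows "mat_vec (cells D 2) (mat_transpose (E21 D)) (mat_vec (bcells D 2) (inclusion D 2) a) X = 0"
  unfolding mat_vec_inclusion unfolding mat_vec_def mat_transpose_def
  by (rule sum.neutral) (use E21_boundary_zero assms in auto)

lemma E10_transpose_boundary:
  assumes "X \<in> cells D 0" "X \<notin> bcells D 0"
  shows "mat_vec (cells D 1) (mat_transpose (E10 D)) (mat_vec (bcells D 1) (inclusion D 1) a) X = 0"
  unfolding mat_vec_inclusion unfolding mat_vec_def mat_transpose_def
  by (rule sum.neutral) (use E10_boundary_zero assms in auto)

text \<open>The term with E21^T E32^T drops out, leaving e = E21^T b, which the boundary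
  contribution -e cancels. The boundary output contains -E10^T e = -E10^T E21^T b, which is
  zero.\<close>

lemma CURL_GRAD_dual: "CURL_dual D (GRAD_dual D (s, sb)) = ((\<lambda>m x. 0), (\<lambda>F x. 0))"
proof -
  define b where "b = mat_vec (bcells D 2) (inclusion D 2) (bcoef0 D sb)"
  define e where "e = mat_vec (cells D 2) (mat_transpose (E21 D)) b"
  define \<alpha> where "\<alpha> X = - mat_vec (cells D 3) (mat_transpose (E32 D)) (ddof0 D s) X + b X" for X
  define q where "q = expand (cells D 2) (dpsi1 D) \<alpha>"
  define qb where "qb = expand (bcells D 1) (dbpsi1 D) (\<lambda>X. - mat_vec (cells D 1) (mat_transpose (inclusion D 1)) e X)"
  have GRAD: "GRAD_dual D (s, sb) = (q, qb)"
    by (simp add: GRAD_dual_def q_def qb_def \<alpha>_def[abs_def] b_def e_def Let_def del: One_nat_def)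
  define b' where "b' = mat_vec (bcells D 1) (inclusion D 1) (bcoef1 D qb)"
  \<comment> \<open>On boundary edges the sign of the inclusion occurs twice and squares to 1;
    elsewhere both sides vanish, the right one by sparsity.\<close>
  have b': "b' X = - e X" if X: "X \<in> cells D 1" for X
  proof (cases "X \<in> bcells D 1")
    case True
    then have "b' X = - (bsign D 1 X * bsign D 1 X * e X)"
      unfolding b'_def qb_def bcoef1_expand_dual mat_vec_inclusion
      using mat_vec_inclusion_transpose[OF X] by simp
    then show ?thesis by (simp add: bsign_square)
  next
    case False
    then show ?thesis
      using E21_transpose_boundary[OF X False] by (simp add: b'_def e_def b_def mat_vec_inclusion)
  qed
  have "mat_vec (cells D 2) (mat_transpose (E21 D)) (ddof1 D q) X + b' X = 0" if X: "X \<in> cells D 1" for X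
  proof -
    have "mat_vec (cells D 2) (mat_transpose (E21 D)) (ddof1 D q) X = mat_vec (cells D 2) (mat_transpose (E21 D)) \<alpha> X"
      by (rule mat_vec_cong) (simp add: q_def ddof1_expand_dual)
    also have "\<dots> = e X"
      unfolding \<alpha>_def mat_vec_add mat_vec_minus e_def using E32_E21_transpose[OF X] by simp
    finally show ?thesis using b'[OF X] by simp
  qed
  moreover have "mat_vec (cells D 0) (mat_transpose (inclusion D 0)) (mat_vec (cells D 1) (mat_transpose (E10 D)) b') X = 0"
    if "X \<in> bcells D 0" for X
  proof -
    have X: "X \<in> cells D 0" using that bcells_subset by blast
    have "mat_vec (cells D 1) (mat_transpose (E10 D)) b' X = mat_vec (cells D 1) (mat_transpose (E10 D)) (\<lambda>Y. - e Y) X"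
      by (rule mat_vec_cong[OF b'])
    also have "\<dots> = 0" unfolding mat_vec_minus e_def using E21_E10_transpose[OF X] by simp
    finally show ?thesis by (simp add: mat_vec_inclusion_transpose[OF X])
  qed
  ultimately show ?thesis
    unfolding GRAD CURL_dual_def prod.case Let_def b'_def[symmetric] prod.inject
    by (intro conjI expand_eq_zero)
qed

text \<open>The pattern one dimension lower, with signs exchanged: the boundary component now
  returns +e, and the minus sign in front of E10^T in the divergence produces the
  cancellation.\<close>

lemma DIV_CURL_dual: "DIV_dual D (CURL_dual D (q, qb)) = ((\<lambda>m x. 0), (\<lambda>F x. 0))"
proof -
  define b where "b = mat_vec (bcells D 1) (inclusion D 1) (bcoef1 D qb)"
  define e where "e = mat_vec (cells D 1) (mat_transpose (E10 D)) b"
  define \<alpha> where "\<alpha> X = mat_vec (cells D 2) (mat_transpose (E21 D)) (ddof1 D q) X + b X" for X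
  define c where "c = expand (cells D 1) (dpsi2 D) \<alpha>"
  define cb where "cb = expand (bcells D 0) (dbpsi2 D) (mat_vec (cells D 0) (mat_transpose (inclusion D 0)) e)"
  have CURL: "CURL_dual D (q, qb) = (c, cb)"
    by (simp add: CURL_dual_def c_def cb_def \<alpha>_def[abs_def] b_def e_def Let_def del: One_nat_def)
  define b' where "b' = mat_vec (bcells D 0) (inclusion D 0) (bcoef2 D cb)"
  have b': "b' X = e X" if X: "X \<in> cells D 0" for X
  proof (cases "X \<in> bcells D 0")
    case True
    then have "b' X = bsign D 0 X * bsign D 0 X * e X"
      unfolding b'_def cb_def bcoef2_expand_dual mat_vec_inclusion
      using mat_vec_inclusion_transpose[OF X] by simp
    then show ?thesis by (simp add: bsign_square)
  next
    case False
    then show ?thesis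
      using E10_transpose_boundary[OF X False] by (simp add: b'_def e_def b_def mat_vec_inclusion del: One_nat_def)
  qed
  have "- mat_vec (cells D 1) (mat_transpose (E10 D)) (ddof2 D c) X + b' X = 0" if X: "X \<in> cells D 0" for X
  proof -
    have "mat_vec (cells D 1) (mat_transpose (E10 D)) (ddof2 D c) X = mat_vec (cells D 1) (mat_transpose (E10 D)) \<alpha> X"
      unfolding c_def by (rule mat_vec_cong) (rule ddof2_expand_dual)
    also have "\<dots> = e X"
      unfolding \<alpha>_def mat_vec_add e_def using E21_E10_transpose[OF X] by simp
    finally show ?thesis using b'[OF X] by simp
  qed
  then show ?thesis
    unfolding CURL DIV_dual_def prod.case Let_def b'_def[symmetric] prod.inject
    by (intro conjI expand_eq_zero refl)
qed

end

theorem mainTheorem3: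
  fixes D :: "'m::finite complex_data"
  assumes "meshed_domain D"
    and "basis_functions D"
    and "incidence_matrices D"
    and "\<And>k X. bsign D k X \<in> {-1, 1}"
  shows "(\<forall>s\<in>dual_spaceS D. \<forall>sb\<in>dual_bspaceD D.
            CURL_dual D (GRAD_dual D (s, sb)) = ((\<lambda>m x. 0), (\<lambda>F x. 0))) \<and>
         (\<forall>q\<in>dual_spaceD D. \<forall>qb\<in>dual_bspaceC D.
            DIV_dual D (CURL_dual D (q, qb)) = ((\<lambda>m x. 0), (\<lambda>F x. 0)))"
proof -
  interpret discrete_complex D by unfold_locales fact+
  show ?thesis by (simp only: CURL_GRAD_dual DIV_CURL_dual) simp
qed

end
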